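(* For any unbiased estimator $\xi$ of the intensity and any $\alpha\in(0,1)$, $$\mathbb{E}^u\big[\,\|\xi-u\|^2_{W^{\alpha,2}_0}\,\big]\;\ge\;2\int_0^T\mathbb{E}^u[\dot u_r]\int_r^T\int_0^r\frac{1}{(t-s)^{2\alpha+1}}\,ds\,dt\,dr,\qquad\text{for every }u\in\Theta .$$ Moreover, there exists no unbiased estimator $\xi$ with finite risk in $W^{\alpha,2}$ for $\alpha\in[1/2,1)$, nor in $H^1_0$: that is, if $\xi$ is unbiased then, for every $u\in\Theta$, $\mathbb{E}^u[\|\xi-u\|^2_{W^{\alpha,2}_0}]=+\infty$ for all $\alpha\in[1/2,1)$, and $\mathbb{E}^u[\|\xi-u\|^2_{H^1_0}]=+\infty$.
   Context: Fix $T>0$ and let $X=(X_t)_{t\in[0,T]}$ be a (standard, unit rate) Poisson process on a filtered probability space $(\Omega,\mathcal{F},(\mathcal{F}_t)_{t\in[0,T]},\mathbb{P})$, with jump times $(T_k)_{k\ge1}$. The parameter space $\Theta$ is the set of all absolutely continuous, strictly increasing, $\mathcal{F}_0$-measurable processes $u_t=\int_0^t\dot u_s\,ds$, $t\in[0,T]$, whose a.e. derivatives $\dot u$ satisfy the assumptions of Girsanov's theorem for the Poisson process: with $$L^u:=\prod_{k=1}^{X_T}\dot u_{T_k}\,\exp\Big(-\int_0^T(\dot u_s-1)\,ds\Big),$$ $\mathbb{P}^u:=L^u\,\mathbb{P}$ is a probability measure under which $X$ is a Cox process with intensity $(\dot u_t)_{t\in[0,T]}$; moreover $u_t$ is integrable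 for every $t\in[0,T]$. $\mathbb{E}^u$ denotes expectation under $\mathbb{P}^u$. Note that $\mathbb{P}^u(A)$ does not depend on $u$ for $A\in\mathcal{F}_0$, so $\mathbb{E}^v[u_t]=\mathbb{E}[u_t]$ for all $u,v\in\Theta$. An estimator of the intensity is any measurable stochastic process $\xi:\Omega\times[0,T]\to\mathbb{R}$ (not depending on $u$). It is unbiased if, for every $u\in\Theta$ and $t\in[0,T]$, $\xi_t$ is $\mathbb{P}^u$-integrable and $\mathbb{E}^u[\xi_t]=\mathbb{E}[u_t]$. For $\alpha\in(0,1)$ and a measurable function $f:[0,T]\to\mathbb{R}$, $$\|f\|^2_{W^{\alpha,2}_0}:=\int_0^T\int_0^T\frac{|f_t-f_s|^2}{|t-s|^{2\alpha+1}}\,dt\,ds\in[0,+\infty].$$ $H^1_0=H^1_0(0,T)$ is the space of functions $h(t)=\int_0^t\dot h(s)\,ds$ with $\dot h\in L^2(0,T)$ (only vanishing at $t=0$ is required), with $\|h\|_{H^1_0}:=\|\dot h\|_{L^2(0,T)}$, and $\|h\|_{H^1_0}:=+\infty$ for Borel $h:[0,T]\to\mathbb{R}$ not in $H^1_0$. *)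

theory Defs
  imports "HOL-Probability.Probability"
begin

text \<open>
  Processes are written \<open>Y t \<omega>\<close>, time first. Time is a real number; only \<open>t \<in> {0..T}\<close> is
  ever constrained or used.
\<close>

definition filtered_prob_space :: "'a measure \<Rightarrow> real \<Rightarrow> (real \<Rightarrow> 'a measure) \<Rightarrow> bool" where
  "filtered_prob_space M T F \<longleftrightarrow>
     prob_space M \<and>
     (\<forall>t\<in>{0..T}. subalgebra M (F t)) \<and>
     (\<forall>s\<in>{0..T}. \<forall>t\<in>{0..T}. s \<le> t \<longrightarrow> sets (F s) \<subseteq> sets (F t))"

definition poisson_process ::
  "'a measure \<Rightarrow> real \<Rightarrow> (real \<Rightarrow> 'a measure) \<Rightarrow> (real \<Rightarrow> 'a \<Rightarrow> nat) \<Rightarrow> bool" where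
  "poisson_process M T F X \<longleftrightarrow>
     (\<forall>t\<in>{0..T}. X t \<in> measurable (F t) (count_space UNIV)) \<and>
     (\<forall>\<omega>\<in>space M. X 0 \<omega> = 0 \<and> mono_on {0..T} (\<lambda>t. X t \<omega>) \<and>
        (\<forall>t\<in>{0..<T}. continuous (at_right t) (\<lambda>s. X s \<omega>))) \<and>
     (\<forall>s t. 0 \<le> s \<and> s < t \<and> t \<le> T \<longrightarrow>
        distr M (count_space UNIV) (\<lambda>\<omega>. X t \<omega> - X s \<omega>) = measure_pmf (poisson_pmf (t - s)) \<and>
        prob_space.indep_set M (sets (F s))
          (range (\<lambda>B. (\<lambda>\<omega>. X t \<omega> - X s \<omega>) -` B \<inter> space M)))"

text \<open>Only used for \<open>1 \<le> k \<le> X T \<omega>\<close>, where the infimum is over a nonempty set.\<close>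

definition jump_time :: "real \<Rightarrow> (real \<Rightarrow> 'a \<Rightarrow> nat) \<Rightarrow> nat \<Rightarrow> 'a \<Rightarrow> real" where
  "jump_time T X k \<omega> = Inf {t\<in>{0..T}. k \<le> X t \<omega>}"

text \<open>
  Cox (doubly stochastic Poisson) process with respect to the filtration: given \<open>F s\<close>, the
  increment over \<open>(s, t]\<close> has the Poisson law with parameter the integral of the intensity.
  The intensity is \<open>F 0\<close>-measurable wherever this is used.
\<close>

definition cox_process ::
  "'a measure \<Rightarrow> real \<Rightarrow> (real \<Rightarrow> 'a measure) \<Rightarrow> (real \<Rightarrow> 'a \<Rightarrow> nat) \<Rightarrow> (real \<Rightarrow> 'a \<Rightarrow> real) \<Rightarrow> bool"
  where
  "cox_process Q T F X v \<longleftrightarrow>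
     (\<forall>s t k. 0 \<le> s \<and> s < t \<and> t \<le> T \<longrightarrow>
        (AE \<omega> in Q. real_cond_exp Q (F s) (indicator {\<omega>\<in>space Q. X t \<omega> - X s \<omega> = k}) \<omega> =
           (LINT r:{s..t}|lborel. v r \<omega>) ^ k / fact k * exp (- (LINT r:{s..t}|lborel. v r \<omega>))))"

definition girsanov_density ::
  "real \<Rightarrow> (real \<Rightarrow> 'a \<Rightarrow> nat) \<Rightarrow> (real \<Rightarrow> 'a \<Rightarrow> real) \<Rightarrow> 'a \<Rightarrow> real" where
  "girsanov_density T X v \<omega> =
     (\<Prod>k=1..X T \<omega>. v (jump_time T X k \<omega>) \<omega>) * exp (- (LINT s:{0..T}|lborel. (v s \<omega> - 1)))"

definition girsanov_measure ::
  "'a measure \<Rightarrow> real \<Rightarrow> (real \<Rightarrow> 'a \<Rightarrow> nat) \<Rightarrow> (real \<Rightarrow> 'a \<Rightarrow> real) \<Rightarrow> 'a measure" where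
  "girsanov_measure M T X v = density M (\<lambda>\<omega>. ennreal (girsanov_density T X v \<omega>))"

text \<open>
  A parameter is the process \<open>u\<close> together with a jointly measurable version \<open>v\<close> of its
  a.e. derivative; \<open>v\<close> is what enters the density. Two such versions of the derivative of
  the same \<open>u\<close> give almost surely equal densities, hence the same measure. The
  representation of \<open>u\<close> as the integral of an integrable \<open>v\<close> is absolute continuity
  with \<open>u 0 = 0\<close>.
\<close>

definition Theta ::
  "'a measure \<Rightarrow> real \<Rightarrow> (real \<Rightarrow> 'a measure) \<Rightarrow> (real \<Rightarrow> 'a \<Rightarrow> nat) \<Rightarrow>
   ((real \<Rightarrow> 'a \<Rightarrow> real) \<times> (real \<Rightarrow> 'a \<Rightarrow> real)) set" where
  "Theta M T F X = {(u, v).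
     (\<forall>t\<in>{0..T}. u t \<in> borel_measurable (F 0)) \<and>
     case_prod v \<in> borel_measurable (restrict_space borel {0..T} \<Otimes>\<^sub>M F 0) \<and>
     (\<forall>\<omega>\<in>space M.
        set_integrable lborel {0..T} (\<lambda>s. v s \<omega>) \<and>
        (\<forall>t\<in>{0..T}. u t \<omega> = (LINT s:{0..t}|lborel. v s \<omega>)) \<and>
        strict_mono_on {0..T} (\<lambda>t. u t \<omega>)) \<and>
     prob_space (girsanov_measure M T X v) \<and>
     cox_process (girsanov_measure M T X v) T F X v \<and>
     (\<forall>t\<in>{0..T}. integrable M (u t))}"

definition estimator :: "'a measure \<Rightarrow> real \<Rightarrow> (real \<Rightarrow> 'a \<Rightarrow> real) \<Rightarrow> bool" where
  "estimator M T \<xi> \<longleftrightarrow> case_prod \<xi> \<in> borel_measurable (restrict_space borel {0..T} \<Otimes>\<^sub>M M)"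

definition unbiased ::
  "'a measure \<Rightarrow> real \<Rightarrow> (real \<Rightarrow> 'a measure) \<Rightarrow> (real \<Rightarrow> 'a \<Rightarrow> nat) \<Rightarrow> (real \<Rightarrow> 'a \<Rightarrow> real) \<Rightarrow> bool" where
  "unbiased M T F X \<xi> \<longleftrightarrow>
     (\<forall>(u, v)\<in>Theta M T F X. \<forall>t\<in>{0..T}.
        integrable (girsanov_measure M T X v) (\<xi> t) \<and>
        (LINT \<omega>|girsanov_measure M T X v. \<xi> t \<omega>) = (LINT \<omega>|M. u t \<omega>))"

text \<open>On the diagonal, a null set, the integrand is \<open>0 / 0 = 0\<close>.\<close>

definition W_norm_sq :: "real \<Rightarrow> real \<Rightarrow> (real \<Rightarrow> real) \<Rightarrow> ennreal" where
  "W_norm_sq T \<alpha> f =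
     (\<integral>\<^sup>+s\<in>{0..T}. (\<integral>\<^sup>+t\<in>{0..T}.
        ennreal (\<bar>f t - f s\<bar>\<^sup>2 / \<bar>t - s\<bar> powr (2 * \<alpha> + 1)) \<partial>lborel) \<partial>lborel)"

text \<open>
  The derivative \<open>g\<close> is unique up to null sets, so the infimum is over at most one value;
  it is \<open>\<infinity>\<close>, the infimum of the empty set, if \<open>h\<close> is not in the space.
\<close>

definition H1_norm_sq :: "real \<Rightarrow> (real \<Rightarrow> real) \<Rightarrow> ennreal" where
  "H1_norm_sq T h =
     Inf {\<integral>\<^sup>+s\<in>{0..T}. ennreal ((g s)\<^sup>2) \<partial>lborel | g.
       g \<in> borel_measurable borel \<and> set_integrable lborel {0..T} (\<lambda>s. (g s)\<^sup>2) \<and>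
       (\<forall>t\<in>{0..T}. h t = (LINT s:{0..t}|lborel. g s))}"

end

theory Submission
  imports Defs
begin

text \<open>
  Everything follows from one inequality for increments, lemma \<open>increment_bound\<close>: for
  \<open>s \<le> t\<close> and an unbiased \<open>\<xi>\<close>, the mean square under \<open>P\<^sup>u\<close> of
  \<open>(\<xi>\<^sub>t - u\<^sub>t) - (\<xi>\<^sub>s - u\<^sub>s)\<close> is at least the mean of \<open>u\<^sub>t - u\<^sub>s\<close>. It is a Cramer-Rao
  bound in the finite-difference form of Chapman and Robbins. Put \<open>a = u\<^sub>t - u\<^sub>s\<close> and speed up the
  clock \<open>u\<close> on \<open>(s, t]\<close> by the factor \<open>c = 1 + \<epsilon> 1{a \<le> K}\<close>, which is known at time 0.
  The result is again a parameter, and the density of its law with respect to \<open>P\<^sup>u\<close> is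
  \<open>R = c ^ N exp (- (c - 1) a)\<close>, where \<open>N\<close> counts the jumps in \<open>(s, t]\<close>. Writing
  \<open>h\<close> for the increment of \<open>\<xi> - u\<close> and \<open>b = a 1{a \<le> K}\<close>, unbiasedness at both
  parameters says that \<open>h (R - 1)\<close> has mean \<open>\<epsilon> E[b]\<close>. Since \<open>N\<close> is Poisson
  with parameter \<open>a\<close> given the past, \<open>(R - 1)\<^sup>2\<close> has mean
  \<open>E[exp (\<epsilon>\<^sup>2 b) - 1]\<close>. Now expand \<open>0 \<le> (h - (R - 1) / \<epsilon>)\<^sup>2\<close>, take means and
  let \<open>\<epsilon> \<rightarrow> 0\<close> and \<open>K \<rightarrow> \<infinity>\<close>. Finite differences avoid differentiating under the
  integral; the truncation at \<open>K\<close> is there because \<open>u\<close> is only integrable, so that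
  \<open>exp (\<epsilon>\<^sup>2 a)\<close> may have infinite mean.

  Two facts about the measures support this. The speeded-up clock must be shown to be a parameter
  (\<open>tilted_in_Theta\<close>): the Cox property is checked separately before, inside and after
  \<open>(s, t]\<close>, where the change of measure is easy to follow, and the pieces are glued because
  Poisson laws form a convolution semigroup. And \<open>P\<^sup>u\<close> must agree with the reference measure
  at time 0 (\<open>nn_integral_P_F0\<close>); for this it suffices to look at the event of no jump, on which
  the density is explicit and both measures give the probability of no jump in terms of \<open>u\<^sub>T\<close>.

  The three claims follow by choosing increments. Integrating the bound against
  \<open>|t - s| powr (- 2 \<alpha> - 1)\<close> and applying Tonelli's theorem, with \<open>u\<^sub>t - u\<^sub>s\<close> written as the
  integral of the rate, gives the first. For \<open>\<alpha> \<ge> 1/2\<close> the kernel on the right-hand side is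
  infinite at every interior \<open>r\<close>, while the mean rate has a positive integral. For \<open>H\<^sup>1\<close>,
  split \<open>[0, T]\<close> into \<open>n\<close> equal parts: \<open>n / T\<close> times the sum of the squared increments of a
  function is at most its squared norm, by the Cauchy-Schwarz inequality, whereas the mean of
  that quantity for \<open>\<xi> - u\<close> is at least \<open>n / T\<close> times the mean of \<open>u\<^sub>T\<close>, which grows without
  bound.
\<close>

section \<open>Counts that are conditionally Poisson\<close>

definition poisson_weight :: "real \<Rightarrow> nat \<Rightarrow> real" where
  "poisson_weight a k = a ^ k / fact k * exp (- a)"

text \<open>
  This is the statement that, given the sub-sigma-algebra \<open>G\<close>, the count \<open>N\<close> has the Poisson law
  with parameter \<open>a\<close>. Testing against all nonnegative \<open>Z\<close>, instead of naming a conditional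
  expectation, needs no integrability and survives multiplication by a density, which amounts to
  a change of \<open>Z\<close>.
\<close>

definition cond_poisson :: "'a measure \<Rightarrow> 'a measure \<Rightarrow> ('a \<Rightarrow> nat) \<Rightarrow> ('a \<Rightarrow> real) \<Rightarrow> bool" where
  "cond_poisson Q G N a \<longleftrightarrow>
     (\<forall>k. \<forall>Z\<in>borel_measurable G.
        (\<integral>\<^sup>+\<omega>. Z \<omega> * indicator {k} (N \<omega>) \<partial>Q) = (\<integral>\<^sup>+\<omega>. Z \<omega> * ennreal (poisson_weight (a \<omega>) k) \<partial>Q))"

lemma poisson_weight_nonneg: "0 \<le> a \<Longrightarrow> 0 \<le> poisson_weight a k"
  by (simp add: poisson_weight_def)

lemma poisson_weight_measurable [measurable (raw)]:
  assumes [measurable]: "a \<in> borel_measurable G"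
  shows "(\<lambda>\<omega>. poisson_weight (a \<omega>) k) \<in> borel_measurable G"
  unfolding poisson_weight_def by measurable

lemma indicator_count_measurable [measurable (raw)]:
  assumes "N \<in> measurable G (count_space UNIV)"
  shows "(\<lambda>\<omega>. indicator {k::nat} (N \<omega>) :: ennreal) \<in> borel_measurable G"
  using measurable_compose[OF assms, of "indicator {k}" borel] by simp

lemma poisson_weight_generating_sums: "(\<lambda>k. c ^ k * poisson_weight a k) sums exp ((c - 1) * a)"
proof -
  have "(\<lambda>k. (c * a) ^ k /\<^sub>R fact k * exp (- a)) sums (exp (c * a) * exp (- a))"
    by (intro sums_mult2 exp_converges)
  then show ?thesis
    by (simp add: poisson_weight_def power_mult_distrib divide_inverse exp_add[symmetric] algebra_simps)
qed

lemma poisson_weight_sums: "poisson_weight a sums 1"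
  using poisson_weight_generating_sums[of 1 a] by simp

lemma poisson_weight_le_1: "0 \<le> a \<Longrightarrow> poisson_weight a k \<le> 1"
  using poisson_weight_sums[of a] sum_le_suminf[of "poisson_weight a" "{k}"] poisson_weight_nonneg[of a]
  by (auto simp: sums_iff)

lemma poisson_weight_convolution:
  "(\<Sum>j\<le>k. poisson_weight a j * poisson_weight b (k - j)) = poisson_weight (a + b) k"
proof -
  have "(\<Sum>j\<le>k. poisson_weight a j * poisson_weight b (k - j)) =
      (\<Sum>j\<le>k. (of_nat (k choose j) * a ^ j * b ^ (k - j)) * (exp (- (a + b)) / fact k))"
    by (intro sum.cong refl) (simp add: poisson_weight_def binomial_fact field_simps exp_add exp_diff exp_minus)
  also have "\<dots> = poisson_weight (a + b) k"
    unfolding sum_distrib_right[symmetric] binomial_ring[symmetric] poisson_weight_def by simp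
  finally show ?thesis .
qed

text \<open>
  The two densities \<open>f\<close> and \<open>g\<close> define measures whose restrictions to \<open>G\<close> coincide.
\<close>

lemma nn_integral_eq_from_subalgebra_sets:
  fixes f g Z :: "'a \<Rightarrow> ennreal"
  assumes sub: "subalgebra Q G"
    and f[measurable]: "f \<in> borel_measurable Q" and g[measurable]: "g \<in> borel_measurable Q"
    and eq: "\<And>A. A \<in> sets G \<Longrightarrow> (\<integral>\<^sup>+\<omega>\<in>A. f \<omega> \<partial>Q) = (\<integral>\<^sup>+\<omega>\<in>A. g \<omega> \<partial>Q)"
    and Z: "Z \<in> borel_measurable G"
  shows "(\<integral>\<^sup>+\<omega>. Z \<omega> * f \<omega> \<partial>Q) = (\<integral>\<^sup>+\<omega>. Z \<omega> * g \<omega> \<partial>Q)"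
proof -
  have [measurable]: "Z \<in> borel_measurable Q" by (rule measurable_from_subalg[OF sub Z])
  have sf: "subalgebra (density Q h) G" for h using sub by (simp add: subalgebra_def)
  have "restr_to_subalg (density Q f) G = restr_to_subalg (density Q g) G"
  proof (rule measure_eqI)
    fix A assume "A \<in> sets (restr_to_subalg (density Q f) G)"
    then have A: "A \<in> sets G" by (simp add: sets_restr_to_subalg[OF sf])
    then have "A \<in> sets Q" using sub by (auto simp: subalgebra_def)
    then show "emeasure (restr_to_subalg (density Q f) G) A = emeasure (restr_to_subalg (density Q g) G) A"
      using eq[OF A] by (simp add: emeasure_restr_to_subalg[OF sf A] emeasure_density)
  qed (simp add: sets_restr_to_subalg[OF sf])
  then have "(\<integral>\<^sup>+\<omega>. Z \<omega> \<partial>density Q f) = (\<integral>\<^sup>+\<omega>. Z \<omega> \<partial>density Q g)"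
    using nn_integral_subalgebra2[OF sf Z] by metis
  then show ?thesis by (simp add: nn_integral_density mult.commute)
qed

text \<open>
  This connects the tested form with the form in which the Cox property is stated for parameters.
\<close>

lemma cond_poisson_iff_cond_exp:
  assumes Q: "prob_space Q" and sub: "subalgebra Q G"
    and N[measurable]: "N \<in> measurable Q (count_space UNIV)"
    and a: "a \<in> borel_measurable G" "\<And>\<omega>. \<omega> \<in> space Q \<Longrightarrow> 0 \<le> a \<omega>"
  shows "cond_poisson Q G N a \<longleftrightarrow>
    (\<forall>k. AE \<omega> in Q. real_cond_exp Q G (indicator {\<omega>\<in>space Q. N \<omega> = k}) \<omega> = poisson_weight (a \<omega>) k)"
proof -
  interpret prob_space Q by (rule Q)
  interpret finite_measure_subalgebra Q G by unfold_locales (rule sub)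
  have [measurable]: "a \<in> borel_measurable Q" by (rule measurable_from_subalg[OF sub a(1)])
  define I where "I k = (indicator {\<omega>\<in>space Q. N \<omega> = k} :: 'a \<Rightarrow> real)" for k
  have I_meas[measurable]: "I k \<in> borel_measurable Q" for k unfolding I_def by measurable
  have I_int: "integrable Q (I k)" for k
    by (rule integrable_const_bound[where B=1]) (auto simp: I_def indicator_def)
  have p_int: "integrable Q (\<lambda>\<omega>. poisson_weight (a \<omega>) k)" for k
    by (rule integrable_const_bound[where B=1])
      (auto intro!: AE_I2 simp: poisson_weight_nonneg a(2) poisson_weight_le_1)
  have I_nn: "(\<integral>\<^sup>+\<omega>\<in>A. indicator {k} (N \<omega>) \<partial>Q) = ennreal (LINT \<omega>:A|Q. I k \<omega>)"
    if A: "A \<in> sets Q" for A k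
  proof -
    have "(\<integral>\<^sup>+\<omega>\<in>A. indicator {k} (N \<omega>) \<partial>Q) = (\<integral>\<^sup>+\<omega>. ennreal (indicator A \<omega> *\<^sub>R I k \<omega>) \<partial>Q)"
      by (intro nn_integral_cong) (auto simp: I_def indicator_def)
    also have "\<dots> = ennreal (LINT \<omega>:A|Q. I k \<omega>)"
      unfolding set_lebesgue_integral_def using integrable_mult_indicator[OF A I_int[of k]]
      by (intro nn_integral_eq_integral) (auto simp: I_def)
    finally show ?thesis .
  qed
  have p_nn: "(\<integral>\<^sup>+\<omega>\<in>A. ennreal (poisson_weight (a \<omega>) k) \<partial>Q) = ennreal (LINT \<omega>:A|Q. poisson_weight (a \<omega>) k)"
    if A: "A \<in> sets Q" for A k
  proof -
    have "(\<integral>\<^sup>+\<omega>\<in>A. ennreal (poisson_weight (a \<omega>) k) \<partial>Q) = (\<integral>\<^sup>+\<omega>. ennreal (indicator A \<omega> *\<^sub>R poisson_weight (a \<omega>) k) \<partial>Q)"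
      by (intro nn_integral_cong) (auto simp: indicator_def)
    also have "\<dots> = ennreal (LINT \<omega>:A|Q. poisson_weight (a \<omega>) k)"
      unfolding set_lebesgue_integral_def using integrable_mult_indicator[OF A p_int[of k]]
      by (intro nn_integral_eq_integral) (auto intro!: AE_I2 simp: poisson_weight_nonneg a(2))
    finally show ?thesis .
  qed
  have I_pos: "0 \<le> (LINT \<omega>:A|Q. I k \<omega>)" for A k
    unfolding set_lebesgue_integral_def by (intro Bochner_Integration.integral_nonneg) (simp add: I_def)
  have p_pos: "0 \<le> (LINT \<omega>:A|Q. poisson_weight (a \<omega>) k)" for A k
    unfolding set_lebesgue_integral_def
    by (intro Bochner_Integration.integral_nonneg) (simp add: poisson_weight_nonneg a(2))
  have sets: "A \<in> sets G \<Longrightarrow> A \<in> sets Q" for A using sub by (auto simp: subalgebra_def)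
  show ?thesis
  proof
    assume cp: "cond_poisson Q G N a"
    show "\<forall>k. AE \<omega> in Q. real_cond_exp Q G (indicator {\<omega>\<in>space Q. N \<omega> = k}) \<omega> = poisson_weight (a \<omega>) k"
    proof
      fix k
      have "(LINT \<omega>:A|Q. I k \<omega>) = (LINT \<omega>:A|Q. poisson_weight (a \<omega>) k)" if A: "A \<in> sets G" for A
      proof -
        have "(\<lambda>x. indicator A x :: ennreal) \<in> borel_measurable G" using A by measurable
        with cp have "(\<integral>\<^sup>+\<omega>. indicator A \<omega> * indicator {k} (N \<omega>) \<partial>Q) =
            (\<integral>\<^sup>+\<omega>. indicator A \<omega> * ennreal (poisson_weight (a \<omega>) k) \<partial>Q)"
          unfolding cond_poisson_def by blast
        then show ?thesis
          using I_nn[OF sets[OF A], of k] p_nn[OF sets[OF A], of k] I_pos[of A k] p_pos[of A k]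
          by (simp add: mult.commute)
      qed
      then show "AE \<omega> in Q. real_cond_exp Q G (indicator {\<omega>\<in>space Q. N \<omega> = k}) \<omega> = poisson_weight (a \<omega>) k"
        unfolding I_def[symmetric]
        by (intro real_cond_exp_charact I_int p_int) (auto intro!: poisson_weight_measurable a(1))
    qed
  next
    assume ce: "\<forall>k. AE \<omega> in Q. real_cond_exp Q G (indicator {\<omega>\<in>space Q. N \<omega> = k}) \<omega> = poisson_weight (a \<omega>) k"
    show "cond_poisson Q G N a"
      unfolding cond_poisson_def
    proof (intro allI ballI)
      fix k Z assume Z: "(Z::'a \<Rightarrow> ennreal) \<in> borel_measurable G"
      show "(\<integral>\<^sup>+\<omega>. Z \<omega> * indicator {k} (N \<omega>) \<partial>Q) = (\<integral>\<^sup>+\<omega>. Z \<omega> * ennreal (poisson_weight (a \<omega>) k) \<partial>Q)"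
      proof (rule nn_integral_eq_from_subalgebra_sets[OF sub _ _ _ Z])
        fix A assume A: "A \<in> sets G"
        have [measurable]: "A \<in> sets Q" by (rule sets[OF A])
        have "(LINT \<omega>:A|Q. I k \<omega>) = (LINT \<omega>:A|Q. real_cond_exp Q G (I k) \<omega>)"
          by (rule real_cond_exp_intA[OF I_int A])
        also have "\<dots> = (LINT \<omega>:A|Q. poisson_weight (a \<omega>) k)"
          unfolding set_lebesgue_integral_def using ce[rule_format, of k]
          by (intro integral_cong_AE) (auto simp: I_def)
        finally show "(\<integral>\<^sup>+\<omega>\<in>A. indicator {k} (N \<omega>) \<partial>Q) = (\<integral>\<^sup>+\<omega>\<in>A. ennreal (poisson_weight (a \<omega>) k) \<partial>Q)"
          using I_nn[OF sets[OF A], of k] p_nn[OF sets[OF A], of k] by simp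
      qed auto
    qed
  qed
qed

lemma cond_poissonD:
  "cond_poisson Q G N a \<Longrightarrow> Z \<in> borel_measurable G \<Longrightarrow>
    (\<integral>\<^sup>+\<omega>. Z \<omega> * indicator {k} (N \<omega>) \<partial>Q) = (\<integral>\<^sup>+\<omega>. Z \<omega> * ennreal (poisson_weight (a \<omega>) k) \<partial>Q)"
  unfolding cond_poisson_def by blast

lemma cond_poisson_cong:
  assumes "\<And>\<omega>. \<omega> \<in> space Q \<Longrightarrow> N \<omega> = N' \<omega>" "\<And>\<omega>. \<omega> \<in> space Q \<Longrightarrow> a \<omega> = a' \<omega>"
  shows "cond_poisson Q G N a = cond_poisson Q G N' a'"
proof -
  have "(\<integral>\<^sup>+\<omega>. Z \<omega> * indicator {k} (N \<omega>) \<partial>Q) = (\<integral>\<^sup>+\<omega>. Z \<omega> * indicator {k} (N' \<omega>) \<partial>Q)"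
       "(\<integral>\<^sup>+\<omega>. Z \<omega> * ennreal (poisson_weight (a \<omega>) k) \<partial>Q) = (\<integral>\<^sup>+\<omega>. Z \<omega> * ennreal (poisson_weight (a' \<omega>) k) \<partial>Q)"
    for Z k using assms by (auto intro!: nn_integral_cong)
  then show ?thesis unfolding cond_poisson_def by simp
qed

lemma cond_poisson_zero:
  assumes "\<And>\<omega>. \<omega> \<in> space Q \<Longrightarrow> N \<omega> = 0" "\<And>\<omega>. \<omega> \<in> space Q \<Longrightarrow> a \<omega> = 0"
  shows "cond_poisson Q G N a"
  unfolding cond_poisson_def
  by (auto intro!: nn_integral_cong simp: assms poisson_weight_def indicator_def power_0_left)

text \<open>
  Sum the defining identity over the values of \<open>N\<close>; this allows a random index in \<open>Z\<close>.
\<close>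

lemma cond_poisson_nn_integral:
  assumes cp: "cond_poisson Q G N a" and sub: "subalgebra Q G"
    and N[measurable]: "N \<in> measurable Q (count_space UNIV)"
    and a: "a \<in> borel_measurable G"
    and Z: "\<And>k. Z k \<in> borel_measurable G"
  shows "(\<integral>\<^sup>+\<omega>. Z (N \<omega>) \<omega> \<partial>Q) = (\<integral>\<^sup>+\<omega>. (\<Sum>k. Z k \<omega> * ennreal (poisson_weight (a \<omega>) k)) \<partial>Q)"
proof -
  have [measurable]: "Z k \<in> borel_measurable Q" "a \<in> borel_measurable Q" for k
    using measurable_from_subalg[OF sub Z] measurable_from_subalg[OF sub a] by auto
  have "(\<integral>\<^sup>+\<omega>. Z (N \<omega>) \<omega> \<partial>Q) = (\<integral>\<^sup>+\<omega>. (\<Sum>k. Z k \<omega> * indicator {k} (N \<omega>)) \<partial>Q)"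
  proof (intro nn_integral_cong)
    fix \<omega>
    have "(\<lambda>k. Z k \<omega> * indicator {k} (N \<omega>)) = (\<lambda>k. if k = N \<omega> then Z k \<omega> else 0)"
      by (auto simp: indicator_def fun_eq_iff)
    then show "Z (N \<omega>) \<omega> = (\<Sum>k. Z k \<omega> * indicator {k} (N \<omega>))"
      using sums_single[of "N \<omega>" "\<lambda>k. Z k \<omega>"] by (simp add: sums_iff)
  qed
  also have "\<dots> = (\<Sum>k. \<integral>\<^sup>+\<omega>. Z k \<omega> * indicator {k} (N \<omega>) \<partial>Q)"
    by (intro nn_integral_suminf) simp
  also have "\<dots> = (\<Sum>k. \<integral>\<^sup>+\<omega>. Z k \<omega> * ennreal (poisson_weight (a \<omega>) k) \<partial>Q)"
    using cond_poissonD[OF cp Z] by simp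
  also have "\<dots> = (\<integral>\<^sup>+\<omega>. (\<Sum>k. Z k \<omega> * ennreal (poisson_weight (a \<omega>) k)) \<partial>Q)"
    by (intro nn_integral_suminf[symmetric]) simp
  finally show ?thesis .
qed

lemma suminf_poisson_weight_generating:
  assumes "0 \<le> c" "0 \<le> a"
  shows "(\<Sum>k. ennreal (c ^ k) * ennreal (poisson_weight a k)) = ennreal (exp ((c - 1) * a))"
proof -
  have "(\<lambda>k. ennreal (c ^ k * poisson_weight a k)) sums ennreal (exp ((c - 1) * a))"
    using poisson_weight_generating_sums assms by (subst sums_ennreal) (auto simp: poisson_weight_nonneg)
  then show ?thesis using assms by (simp add: sums_iff ennreal_mult poisson_weight_nonneg)
qed

lemma cond_poisson_generating:
  assumes cp: "cond_poisson Q G N a" and sub: "subalgebra Q G"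
    and N: "N \<in> measurable Q (count_space UNIV)"
    and a[measurable]: "a \<in> borel_measurable G" and a0: "\<And>\<omega>. \<omega> \<in> space Q \<Longrightarrow> 0 \<le> a \<omega>"
    and c[measurable]: "c \<in> borel_measurable G" and c0: "\<And>\<omega>. \<omega> \<in> space Q \<Longrightarrow> 0 \<le> c \<omega>"
    and Z[measurable]: "Z \<in> borel_measurable G"
  shows "(\<integral>\<^sup>+\<omega>. Z \<omega> * ennreal (c \<omega> ^ N \<omega>) \<partial>Q) = (\<integral>\<^sup>+\<omega>. Z \<omega> * ennreal (exp ((c \<omega> - 1) * a \<omega>)) \<partial>Q)"
proof -
  have "(\<integral>\<^sup>+\<omega>. Z \<omega> * ennreal (c \<omega> ^ N \<omega>) \<partial>Q) =
      (\<integral>\<^sup>+\<omega>. (\<Sum>k. (Z \<omega> * ennreal (c \<omega> ^ k)) * ennreal (poisson_weight (a \<omega>) k)) \<partial>Q)"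
    by (rule cond_poisson_nn_integral[OF cp sub N a]) measurable
  also have "\<dots> = (\<integral>\<^sup>+\<omega>. Z \<omega> * ennreal (exp ((c \<omega> - 1) * a \<omega>)) \<partial>Q)"
    by (intro nn_integral_cong) (simp add: mult.assoc suminf_poisson_weight_generating a0 c0)
  finally show ?thesis .
qed

text \<open>
  Conditioning first at the later time and then at the earlier one turns the law of the sum into
  the convolution of two Poisson laws. This lets the Cox property be verified on subintervals.
\<close>

lemma cond_poisson_paste:
  assumes cp1: "cond_poisson Q G N1 a" and cp2: "cond_poisson Q H N2 b"
    and subG: "subalgebra Q G" and subH: "subalgebra Q H" and GH: "subalgebra H G"
    and N1[measurable]: "N1 \<in> measurable H (count_space UNIV)"
    and N2: "N2 \<in> measurable Q (count_space UNIV)"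
    and a: "a \<in> borel_measurable G" "\<And>\<omega>. \<omega> \<in> space Q \<Longrightarrow> 0 \<le> a \<omega>"
    and b: "b \<in> borel_measurable G" "\<And>\<omega>. \<omega> \<in> space Q \<Longrightarrow> 0 \<le> b \<omega>"
  shows "cond_poisson Q G (\<lambda>\<omega>. N1 \<omega> + N2 \<omega>) (\<lambda>\<omega>. a \<omega> + b \<omega>)"
  unfolding cond_poisson_def
proof (intro allI ballI)
  fix k Z assume Z[measurable]: "(Z::'a \<Rightarrow> ennreal) \<in> borel_measurable G"
  note [measurable] = a(1) b(1)
  have ZH[measurable]: "Z \<in> borel_measurable H" by (rule measurable_from_subalg[OF GH Z])
  have bH: "b \<in> borel_measurable H" by (rule measurable_from_subalg[OF GH b(1)])
  have [measurable]: "Z \<in> borel_measurable Q" "b \<in> borel_measurable Q" "a \<in> borel_measurable Q"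
    using measurable_from_subalg[OF subG] Z a(1) b(1) by blast+
  have [measurable]: "N1 \<in> measurable Q (count_space UNIV)" by (rule measurable_from_subalg[OF subH N1])
  note N2[measurable]
  have ind: "indicator {k} (N1 \<omega> + N2 \<omega>) = (\<Sum>j\<le>k. indicator {j} (N1 \<omega>) * (indicator {k - j} (N2 \<omega>) :: ennreal))" for \<omega>
  proof -
    have "(\<Sum>j\<le>k. indicator {j} (N1 \<omega>) * (indicator {k - j} (N2 \<omega>) :: ennreal)) =
        (\<Sum>j\<le>k. if j = N1 \<omega> then indicator {k - N1 \<omega>} (N2 \<omega>) else 0)"
      by (intro sum.cong refl) (auto simp: indicator_def)
    also have "\<dots> = indicator {k} (N1 \<omega> + N2 \<omega>)"
      by (auto simp: indicator_def)
    finally show ?thesis by simp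
  qed
  have "(\<integral>\<^sup>+\<omega>. Z \<omega> * indicator {k} (N1 \<omega> + N2 \<omega>) \<partial>Q) =
      (\<integral>\<^sup>+\<omega>. (\<Sum>j\<le>k. (Z \<omega> * indicator {j} (N1 \<omega>)) * indicator {k - j} (N2 \<omega>)) \<partial>Q)"
    by (simp only: ind sum_distrib_left mult.assoc)
  also have "\<dots> = (\<Sum>j\<le>k. \<integral>\<^sup>+\<omega>. (Z \<omega> * indicator {j} (N1 \<omega>)) * indicator {k - j} (N2 \<omega>) \<partial>Q)"
    by (intro nn_integral_sum) measurable
  also have "\<dots> = (\<Sum>j\<le>k. \<integral>\<^sup>+\<omega>. (Z \<omega> * indicator {j} (N1 \<omega>)) * ennreal (poisson_weight (b \<omega>) (k - j)) \<partial>Q)"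
    by (intro sum.cong refl cond_poissonD[OF cp2]) measurable
  also have "\<dots> = (\<Sum>j\<le>k. \<integral>\<^sup>+\<omega>. (Z \<omega> * ennreal (poisson_weight (b \<omega>) (k - j))) * indicator {j} (N1 \<omega>) \<partial>Q)"
    by (simp add: ac_simps)
  also have "\<dots> = (\<Sum>j\<le>k. \<integral>\<^sup>+\<omega>. (Z \<omega> * ennreal (poisson_weight (b \<omega>) (k - j))) * ennreal (poisson_weight (a \<omega>) j) \<partial>Q)"
    by (intro sum.cong refl cond_poissonD[OF cp1]) measurable
  also have "\<dots> = (\<integral>\<^sup>+\<omega>. (\<Sum>j\<le>k. (Z \<omega> * ennreal (poisson_weight (b \<omega>) (k - j))) * ennreal (poisson_weight (a \<omega>) j)) \<partial>Q)"
    by (intro nn_integral_sum[symmetric]) measurable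
  also have "\<dots> = (\<integral>\<^sup>+\<omega>. Z \<omega> * ennreal (poisson_weight (a \<omega> + b \<omega>) k) \<partial>Q)"
  proof (intro nn_integral_cong)
    fix \<omega> assume \<omega>: "\<omega> \<in> space Q"
    have "(\<Sum>j\<le>k. (Z \<omega> * ennreal (poisson_weight (b \<omega>) (k - j))) * ennreal (poisson_weight (a \<omega>) j)) =
        Z \<omega> * (\<Sum>j\<le>k. ennreal (poisson_weight (a \<omega>) j * poisson_weight (b \<omega>) (k - j)))"
      by (simp add: sum_distrib_left ennreal_mult poisson_weight_nonneg a b \<omega> ac_simps)
    also have "\<dots> = Z \<omega> * ennreal (poisson_weight (a \<omega> + b \<omega>) k)"
      using \<omega> by (subst sum_ennreal) (auto simp: poisson_weight_nonneg a b poisson_weight_convolution)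
    finally show "(\<Sum>j\<le>k. (Z \<omega> * ennreal (poisson_weight (b \<omega>) (k - j))) * ennreal (poisson_weight (a \<omega>) j)) =
      Z \<omega> * ennreal (poisson_weight (a \<omega> + b \<omega>) k)" .
  qed
  finally show "(\<integral>\<^sup>+\<omega>. Z \<omega> * indicator {k} (N1 \<omega> + N2 \<omega>) \<partial>Q) =
      (\<integral>\<^sup>+\<omega>. Z \<omega> * ennreal (poisson_weight (a \<omega> + b \<omega>) k) \<partial>Q)" .
qed

section \<open>Integrals over intervals\<close>

lemma set_integral_Icc_diff:
  fixes f :: "real \<Rightarrow> real"
  assumes f: "set_integrable lborel {0..T} f" and "0 \<le> s" "s \<le> t" "t \<le> T"
  shows "(LINT r:{s..t}|lborel. f r) = (LINT r:{0..t}|lborel. f r) - (LINT r:{0..s}|lborel. f r)"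
proof -
  have "AE r in lborel. r \<noteq> s" by (rule AE_lborel_singleton)
  then have "AE r in lborel. \<not> (r \<in> {0..s} \<and> r \<in> {s..t})" by eventually_elim auto
  then have "(LINT r:{0..s} \<union> {s..t}|lborel. f r) = (LINT r:{0..s}|lborel. f r) + (LINT r:{s..t}|lborel. f r)"
    using assms by (intro set_integral_Un_AE) (auto intro!: set_integrable_subset[OF f])
  moreover have "{0..s} \<union> {s..t} = {0..t}" using assms by auto
  ultimately show ?thesis by simp
qed

lemma set_integral_Ioc_diff:
  fixes f :: "real \<Rightarrow> real"
  assumes f: "set_integrable lborel {0..T} f" and "0 \<le> s" "s \<le> t" "t \<le> T"
  shows "(LINT r:{s<..t}|lborel. f r) = (LINT r:{0..t}|lborel. f r) - (LINT r:{0..s}|lborel. f r)"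
proof -
  have "(LINT r:{0..s} \<union> {s<..t}|lborel. f r) = (LINT r:{0..s}|lborel. f r) + (LINT r:{s<..t}|lborel. f r)"
    using assms by (intro set_integral_Un) (auto intro!: set_integrable_subset[OF f])
  moreover have "{0..s} \<union> {s<..t} = {0..t}" using assms by auto
  ultimately show ?thesis by simp
qed

text \<open>
  A process that is jointly measurable on \<open>[0, T]\<close> is continued to all times by freezing it
  outside, which keeps the Fubini arguments on the whole line.
\<close>

lemma measurable_clamp:
  fixes T :: real and f :: "real \<Rightarrow> 'a \<Rightarrow> real"
  assumes T: "0 \<le> T" and G: "subalgebra M G"
    and f: "case_prod f \<in> borel_measurable (restrict_space borel {0..T} \<Otimes>\<^sub>M G)"
  shows "(\<lambda>p. f (max 0 (min T (fst p))) (snd p)) \<in> borel_measurable (borel \<Otimes>\<^sub>M M)"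
proof -
  have cl: "(\<lambda>r. max 0 (min T r)) \<in> measurable borel (restrict_space borel {0..T})"
    using T by (intro measurable_restrict_space2) auto
  have id: "(\<lambda>\<omega>. \<omega>) \<in> measurable M G"
    using G by (auto simp: subalgebra_def measurable_def)
  have "(\<lambda>p. (max 0 (min T (fst p)), snd p)) \<in> measurable (borel \<Otimes>\<^sub>M M) (restrict_space borel {0..T} \<Otimes>\<^sub>M G)"
    by (intro measurable_Pair measurable_compose[OF measurable_fst cl] measurable_compose[OF measurable_snd id])
  from measurable_compose[OF this f] show ?thesis by simp
qed

text \<open>
  Needed to write the positive part of a function as its negative part plus a Stieltjes measure.
\<close>

lemma exists_sum_measure:
  assumes "sets N = sets M"
  obtains S where "sets S = sets M" "\<And>A. A \<in> sets M \<Longrightarrow> emeasure S A = emeasure M A + emeasure N A"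
proof
  let ?m = "\<lambda>A. emeasure M A + emeasure N A"
  let ?S = "measure_of (space M) (sets M) ?m"
  show "sets ?S = sets M" by simp
  fix A assume A: "A \<in> sets M"
  show "emeasure ?S A = ?m A"
  proof (rule emeasure_measure_of_sigma[OF sets.sigma_algebra_axioms _ _ A])
    show "positive (sets M) ?m" by (simp add: positive_def)
    show "countably_additive (sets M) ?m"
    proof (rule countably_additiveI)
      fix B :: "nat \<Rightarrow> _" assume B: "range B \<subseteq> sets M" "disjoint_family B"
      have "(\<Sum>i. ?m (B i)) = (\<Sum>i. emeasure M (B i)) + (\<Sum>i. emeasure N (B i))"
        by (rule suminf_add[symmetric]) auto
      also have "\<dots> = ?m (\<Union>i. B i)"
        using B assms by (simp add: suminf_emeasure)
      finally show "(\<Sum>i. ?m (B i)) = ?m (\<Union>i. B i)" .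
    qed
  qed
qed

text \<open>
  The primitive of \<open>p\<close> is nondecreasing and right-continuous, so it has a Stieltjes measure. The
  measure with density \<open>max 0 p\<close> equals that measure plus the one with density \<open>max 0 (- p)\<close>,
  because they agree on half-open intervals. On the set where \<open>p\<close> is negative the former
  vanishes, hence so does the latter.
\<close>

lemma AE_nonneg_if_integral_Ioc_nonneg:
  fixes p :: "real \<Rightarrow> real"
  assumes p: "integrable lborel p"
    and nonneg: "\<And>a b. a \<le> b \<Longrightarrow> 0 \<le> (LINT r:{a<..b}|lborel. p r)"
  shows "AE r in lborel. 0 \<le> p r"
proof -
  have [measurable]: "p \<in> borel_measurable borel" using p by auto
  define N where "N q = density lborel (\<lambda>r. ennreal (q r))" for q :: "real \<Rightarrow> real"
  have fin_int: "(\<integral>\<^sup>+r. ennreal (q r) \<partial>lborel) < \<infinity>" if "integrable lborel q" for q :: "real \<Rightarrow> real"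
  proof -
    have "(\<integral>\<^sup>+r. ennreal (q r) \<partial>lborel) \<le> (\<integral>\<^sup>+r. ennreal (norm (q r)) \<partial>lborel)"
      by (intro nn_integral_mono ennreal_leI) auto
    also have "\<dots> < \<infinity>" using that by (simp add: integrable_iff_bounded)
    finally show ?thesis .
  qed
  have N_meas: "measure (N q) {a<..b} = (LINT r:{a<..b}|lborel. max 0 (q r))"
    and N_fin: "finite_borel_measure (N q)" if q: "integrable lborel q" for q a b
  proof -
    have [measurable]: "q \<in> borel_measurable borel" using q by auto
    have "emeasure (N q) (space (N q)) = (\<integral>\<^sup>+r. ennreal (q r) \<partial>lborel)"
      unfolding N_def by (subst emeasure_density) auto
    then have "finite_measure (N q)" using fin_int[OF q] by (intro finite_measureI) auto
    then show "finite_borel_measure (N q)"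
      by (simp add: finite_borel_measure_def finite_borel_measure_axioms_def N_def)
    have "emeasure (N q) {a<..b} = (\<integral>\<^sup>+r. ennreal (indicator {a<..b} r *\<^sub>R max 0 (q r)) \<partial>lborel)"
      unfolding N_def by (subst emeasure_density) (auto intro!: nn_integral_cong simp: indicator_def max_def ennreal_neg)
    also have "\<dots> = ennreal (LINT r:{a<..b}|lborel. max 0 (q r))"
      unfolding set_lebesgue_integral_def using q
      by (intro nn_integral_eq_integral integrable_mult_indicator) auto
    finally show "measure (N q) {a<..b} = (LINT r:{a<..b}|lborel. max 0 (q r))"
      unfolding measure_def set_lebesgue_integral_def
      by (simp add: Bochner_Integration.integral_nonneg)
  qed
  have np: "integrable lborel (\<lambda>r. - p r)" using p by simp
  interpret P: finite_borel_measure "N p" by (rule N_fin[OF p])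
  interpret Q: finite_borel_measure "N (\<lambda>r. - p r)" by (rule N_fin[OF np])
  let ?Q = "N (\<lambda>r. - p r)"
  define U where "U x = cdf (N p) x - cdf ?Q x" for x
  have U_diff: "U b - U a = (LINT r:{a<..b}|lborel. p r)" if "a \<le> b" for a b
  proof (cases "a = b")
    case False
    then have "a < b" using that by simp
    then have "U b - U a = measure (N p) {a<..b} - measure ?Q {a<..b}"
      using P.cdf_diff_eq[of a b] Q.cdf_diff_eq[of a b] by (simp add: U_def)
    also have "\<dots> = (LINT r:{a<..b}|lborel. max 0 (p r) - max 0 (- p r))"
    proof -
      have "set_integrable lborel {a<..b} (\<lambda>r. max 0 (p r))" "set_integrable lborel {a<..b} (\<lambda>r. max 0 (- p r))"
        unfolding set_integrable_def using p by (intro integrable_mult_indicator integrable_max; simp)+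
      then show ?thesis unfolding N_meas[OF p] N_meas[OF np] by (rule set_integral_diff(2)[symmetric])
    qed
    also have "\<dots> = (LINT r:{a<..b}|lborel. p r)"
      unfolding set_lebesgue_integral_def by (intro Bochner_Integration.integral_cong) (auto simp: max_def)
    finally show ?thesis .
  qed (simp add: set_lebesgue_integral_def)
  have U_mono: "U a \<le> U b" if "a \<le> b" for a b
    using U_diff[OF that] nonneg[OF that] by simp
  have U_cont: "continuous (at_right a) U" for a
    unfolding U_def by (intro continuous_diff P.cdf_is_right_cont Q.cdf_is_right_cont)
  obtain S where S: "sets S = sets ?Q"
    "\<And>A. A \<in> sets ?Q \<Longrightarrow> emeasure S A = emeasure ?Q A + emeasure (interval_measure U) A"
    by (rule exists_sum_measure[of "interval_measure U" ?Q]) (auto simp: N_def)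
  have "N p = S"
  proof (rule measure_eqI_generator_eq[where \<Omega>=UNIV and E="range (\<lambda>(a, b). {a<..b::real})" and A="\<lambda>n. {- real n<..real n}"])
    show "Int_stable (range (\<lambda>(a, b). {a<..b::real}))"
      by (auto simp: Int_stable_def)
    show "sets (N p) = sigma_sets UNIV (range (\<lambda>(a, b). {a<..b::real}))"
         "sets S = sigma_sets UNIV (range (\<lambda>(a, b). {a<..b::real}))"
      using arg_cong[OF borel_sigma_sets_Ioc, of sets] by (simp_all add: N_def S(1))
    fix X assume "X \<in> range (\<lambda>(a, b). {a<..b::real})"
    then obtain a b where X: "X = {a<..b}" by auto
    show "emeasure (N p) X = emeasure S X"
    proof (cases "a \<le> b")
      case True
      have "emeasure S X = ennreal (cdf ?Q b - cdf ?Q a) + ennreal (U b - U a)"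
        using True by (simp add: X S(2) N_def[symmetric] Q.sets_M Q.emeasure_Ioc emeasure_interval_measure_Ioc U_mono U_cont)
      also have "\<dots> = ennreal (cdf (N p) b - cdf (N p) a)"
        using True U_mono[OF True] Q.cdf_nondecreasing[of a b]
        by (subst ennreal_plus[symmetric]) (auto simp: U_def)
      finally show ?thesis using True by (simp add: X P.emeasure_Ioc)
    qed (simp add: X)
  qed (auto simp: UN_Ioc_eq_UNIV P.emeasure_finite)
  define B where "B = {r. p r < 0}"
  have [measurable]: "B \<in> sets borel" unfolding B_def by measurable
  have "emeasure (N p) B = 0"
    unfolding N_def by (subst emeasure_density) (auto simp: B_def indicator_def ennreal_neg nn_integral_0_iff_AE)
  then have "emeasure ?Q B = 0" using S(2)[of B] \<open>N p = S\<close> by (simp add: Q.sets_M)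
  then have "AE r in lborel. ennreal (- p r) * indicator B r = 0"
    unfolding N_def by (subst (asm) emeasure_density) (auto simp: nn_integral_0_iff_AE)
  then show ?thesis
    by eventually_elim (auto simp: B_def indicator_def ennreal_eq_0_iff split: if_splits)
qed

lemma nn_integral_Icc_if_integral_Ioc_nonneg:
  fixes f :: "real \<Rightarrow> real"
  assumes f: "set_integrable lborel {0..T} f"
    and nonneg: "\<And>s t. 0 \<le> s \<Longrightarrow> s \<le> t \<Longrightarrow> t \<le> T \<Longrightarrow> 0 \<le> (LINT r:{s<..t}|lborel. f r)"
    and st: "0 \<le> s" "s \<le> t" "t \<le> T"
  shows "(\<integral>\<^sup>+r\<in>{s..t}. ennreal (f r) \<partial>lborel) = ennreal (LINT r:{s..t}|lborel. f r)"
proof -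
  let ?p = "\<lambda>r. indicator {0..T} r *\<^sub>R f r"
  have "AE r in lborel. 0 \<le> ?p r"
  proof (rule AE_nonneg_if_integral_Ioc_nonneg)
    show "integrable lborel ?p" using f by (simp add: set_integrable_def)
    fix a b :: real assume "a \<le> b"
    have ae: "AE r in lborel. r \<noteq> 0" by (rule AE_lborel_singleton)
    have [measurable]: "?p \<in> borel_measurable borel" using f by (auto simp: set_integrable_def)
    have "(LINT r:{a<..b}|lborel. ?p r) = (LINT r:{max a 0<..max (max a 0) (min b T)}|lborel. ?p r)"
      unfolding set_lebesgue_integral_def
    proof (rule integral_cong_AE)
      show "AE r in lborel. indicator {a<..b} r *\<^sub>R ?p r = indicator {max a 0<..max (max a 0) (min b T)} r *\<^sub>R ?p r"
        using ae by eventually_elim (auto simp: indicator_def)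
    qed measurable
    also have "\<dots> = (LINT r:{max a 0<..max (max a 0) (min b T)}|lborel. f r)"
      unfolding set_lebesgue_integral_def by (intro Bochner_Integration.integral_cong) (auto simp: indicator_def)
    also have "\<dots> \<ge> 0"
    proof (cases "max a 0 \<le> min b T")
      case True
      then show ?thesis by (intro nonneg) auto
    next
      case False
      then have "max (max a 0) (min b T) = max a 0" using False by linarith
      then show ?thesis by (simp add: set_lebesgue_integral_def)
    qed
    finally show "0 \<le> (LINT r:{a<..b}|lborel. ?p r)" .
  qed
  then have ae: "AE r in lborel. 0 \<le> indicator {s..t} r *\<^sub>R f r"
    by eventually_elim (use st in \<open>auto simp: indicator_def split: if_splits\<close>)
  have "(\<integral>\<^sup>+r\<in>{s..t}. ennreal (f r) \<partial>lborel) = (\<integral>\<^sup>+r. ennreal (indicator {s..t} r *\<^sub>R f r) \<partial>lborel)"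
    by (intro nn_integral_cong) (auto simp: indicator_def)
  also have "\<dots> = ennreal (LINT r:{s..t}|lborel. f r)"
    unfolding set_lebesgue_integral_def
    using set_integrable_subset[OF f, of "{s..t}"] st
    by (intro nn_integral_eq_integral ae) (auto simp: set_integrable_def)
  finally show ?thesis .
qed

lemma nn_integral_inverse_at_0:
  assumes "0 < d"
  shows "(\<integral>\<^sup>+x\<in>{0<..d}. ennreal (1 / x) \<partial>lborel) = \<infinity>"
proof -
  have ge: "ennreal (real n) \<le> (\<integral>\<^sup>+x\<in>{0<..d}. ennreal (1 / x) \<partial>lborel)" for n
  proof -
    let ?a = "d * exp (- real n)"
    have a: "0 < ?a" "?a \<le> d" using assms by auto
    have "(\<integral>\<^sup>+x. ennreal (1 / x) * indicator {?a..d} x \<partial>lborel) = ennreal (ln d - ln ?a)"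
      using a by (intro nn_integral_FTC_Icc) (auto intro!: derivative_eq_intros)
    moreover have "ln d - ln ?a = real n" using assms by (simp add: ln_mult)
    moreover have "(\<integral>\<^sup>+x. ennreal (1 / x) * indicator {?a..d} x \<partial>lborel) \<le> (\<integral>\<^sup>+x\<in>{0<..d}. ennreal (1 / x) \<partial>lborel)"
      using a by (intro nn_integral_mono) (auto simp: indicator_def)
    ultimately show ?thesis by simp
  qed
  show ?thesis
  proof (rule ccontr)
    assume "\<not> ?thesis"
    then obtain x where "0 \<le> x" "(\<integral>\<^sup>+x\<in>{0<..d}. ennreal (1 / x) \<partial>lborel) = ennreal x"
      by (cases "(\<integral>\<^sup>+x\<in>{0<..d}. ennreal (1 / x) \<partial>lborel)") auto
    moreover obtain n where "x < real n" using reals_Archimedean2 by blast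
    ultimately show False using ge[of n] by (simp add: ennreal_le_iff)
  qed
qed

text \<open>
  At \<open>t = r + x\<close> with small \<open>x\<close>, the inner integral over \<open>s\<close> in \<open>[r - x, r]\<close> alone is at
  least \<open>x (2 x) powr (- q)\<close>, which is bounded below by a multiple of \<open>1 / x\<close> when \<open>q \<ge> 2\<close>.
\<close>

lemma fractional_kernel_infinite:
  fixes q :: real
  assumes q: "2 \<le> q" and r: "0 < r" "r < T"
  shows "(\<integral>\<^sup>+t\<in>{r..T}. (\<integral>\<^sup>+s\<in>{0..r}. ennreal (1 / (t - s) powr q) \<partial>lborel) \<partial>lborel) = \<infinity>"
proof -
  define d where "d = Min {1, r, T - r}"
  have d: "0 < d" "d \<le> 1" "d \<le> r" "d \<le> T - r" using r by (auto simp: d_def)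
  have inner: "ennreal (2 powr - q) * ennreal (1 / x) \<le> (\<integral>\<^sup>+s\<in>{0..r}. ennreal (1 / (r + x - s) powr q) \<partial>lborel)"
    if x: "0 < x" "x \<le> d" for x
  proof -
    have "2 powr - q * (1 / x) \<le> x * (1 / (2 * x) powr q)"
    proof -
      have "x powr q \<le> x powr 2" using x d q by (intro powr_mono') auto
      then have "1 / x \<le> x / x powr q"
        using x by (simp add: field_simps powr_numeral power2_eq_square)
      then have "2 powr - q * (1 / x) \<le> 2 powr - q * (x / x powr q)" by (intro mult_left_mono) auto
      also have "\<dots> = x * (1 / (2 * x) powr q)"
        using x by (simp add: powr_mult powr_minus field_simps)
      finally show ?thesis .
    qed
    then have "ennreal (2 powr - q) * ennreal (1 / x) \<le> ennreal (x * (1 / (2 * x) powr q))"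
      by (subst ennreal_mult[symmetric]) (use x in \<open>auto intro!: ennreal_leI\<close>)
    also have "\<dots> = (\<integral>\<^sup>+s\<in>{r - x..r}. ennreal (1 / (2 * x) powr q) \<partial>lborel)"
      using x by (subst nn_integral_cmult_indicator) (auto simp: ennreal_mult[symmetric] mult.commute)
    also have "\<dots> \<le> (\<integral>\<^sup>+s\<in>{0..r}. ennreal (1 / (r + x - s) powr q) \<partial>lborel)"
    proof (intro nn_integral_mono)
      fix s
      have "1 / (2 * x) powr q \<le> 1 / (r + x - s) powr q" if "s \<in> {r - x..r}"
        using that x q by (intro divide_left_mono powr_mono2 mult_pos_pos) auto
      then show "ennreal (1 / (2 * x) powr q) * indicator {r - x..r} s \<le>
          ennreal (1 / (r + x - s) powr q) * indicator {0..r} s"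
        using x d by (auto simp: indicator_def intro!: ennreal_leI)
    qed
    finally show ?thesis .
  qed
  have "\<infinity> = ennreal (2 powr - q) * (\<integral>\<^sup>+x\<in>{0<..d}. ennreal (1 / x) \<partial>lborel)"
    unfolding nn_integral_inverse_at_0[OF d(1)] by (simp add: ennreal_mult_top)
  also have "\<dots> = (\<integral>\<^sup>+x. ennreal (2 powr - q) * (ennreal (1 / x) * indicator {0<..d} x) \<partial>lborel)"
    by (rule nn_integral_cmult[symmetric]) simp
  also have "\<dots> \<le> (\<integral>\<^sup>+x. (\<integral>\<^sup>+s\<in>{0..r}. ennreal (1 / (r + x - s) powr q) \<partial>lborel) * indicator {r..T} (r + x) \<partial>lborel)"
    using inner d by (intro nn_integral_mono) (auto simp: indicator_def mult.assoc[symmetric])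
  also have "\<dots> = (\<integral>\<^sup>+t. (\<integral>\<^sup>+s\<in>{0..r}. ennreal (1 / (t - s) powr q) \<partial>lborel) * indicator {r..T} t \<partial>lborel)"
    by (subst nn_integral_real_affine[where c=1 and t=r]) (auto simp: add.commute)
  finally show ?thesis by (simp add: top_unique)
qed

text \<open>
  The Cauchy-Schwarz inequality, read off from the nonnegative variance of \<open>g\<close> on the interval.
\<close>

lemma square_integral_Ioc_le:
  fixes g :: "real \<Rightarrow> real"
  assumes g: "set_integrable lborel {a<..b} g" and g2: "set_integrable lborel {a<..b} (\<lambda>r. (g r)\<^sup>2)"
    and ab: "a < b"
  shows "(LINT r:{a<..b}|lborel. g r)\<^sup>2 \<le> (b - a) * (LINT r:{a<..b}|lborel. (g r)\<^sup>2)"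
proof -
  define m where "m = (LINT r:{a<..b}|lborel. g r) / (b - a)"
  have one: "set_integrable lborel {a<..b} (\<lambda>_. c :: real)" for c
    unfolding set_integrable_def by (intro integrable_scaleR_left integrable_real_indicator) (use ab in auto)
  have m: "(LINT r:{a<..b}|lborel. g r) = m * (b - a)" using ab by (simp add: m_def)
  have "0 \<le> (LINT r:{a<..b}|lborel. (g r - m)\<^sup>2)"
    unfolding set_lebesgue_integral_def by (intro Bochner_Integration.integral_nonneg) auto
  also have "\<dots> = (LINT r:{a<..b}|lborel. ((g r)\<^sup>2 - 2 * m * g r) + m\<^sup>2)"
    by (intro set_lebesgue_integral_cong) (auto simp: power2_eq_square algebra_simps)
  also have "\<dots> = (LINT r:{a<..b}|lborel. (g r)\<^sup>2) - 2 * m * (m * (b - a)) + m\<^sup>2 * (b - a)"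
  proof -
    have mg: "set_integrable lborel {a<..b} (\<lambda>r. 2 * m * g r)" using g by simp
    have "(LINT r:{a<..b}|lborel. ((g r)\<^sup>2 - 2 * m * g r) + m\<^sup>2) =
        (LINT r:{a<..b}|lborel. (g r)\<^sup>2) - (LINT r:{a<..b}|lborel. 2 * m * g r) + (LINT r:{a<..b}|lborel. m\<^sup>2)"
      by (simp only: set_integral_add(2)[OF set_integral_diff(1)[OF g2 mg] one] set_integral_diff(2)[OF g2 mg])
    moreover have "(LINT r:{a<..b}|lborel. m\<^sup>2) = m\<^sup>2 * (b - a)"
      using ab by (simp add: set_lebesgue_integral_def)
    ultimately show ?thesis by (simp only: set_integral_mult_right m)
  qed
  finally have "m\<^sup>2 * (b - a) \<le> (LINT r:{a<..b}|lborel. (g r)\<^sup>2)"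
    by (simp add: power2_eq_square)
  then have "(b - a) * (m\<^sup>2 * (b - a)) \<le> (b - a) * (LINT r:{a<..b}|lborel. (g r)\<^sup>2)"
    using ab by (intro mult_left_mono) auto
  then show ?thesis unfolding m by (simp add: power2_eq_square ac_simps)
qed

text \<open>
  Cauchy-Schwarz on each of \<open>n\<close> equal pieces gives \<open>(\<Delta>h)\<^sup>2 \<le> T / n * \<integral> g\<^sup>2\<close> over that piece.
\<close>

lemma H1_norm_sq_ge_increments:
  assumes T: "0 < T" and n: "0 < n"
  defines "\<tau> \<equiv> \<lambda>i. real i * T / real n"
  shows "ennreal (real n / T) * (\<Sum>i<n. ennreal ((h (\<tau> (Suc i)) - h (\<tau> i))\<^sup>2)) \<le> H1_norm_sq T h"
  unfolding H1_norm_sq_def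
proof (rule Inf_greatest, clarify)
  fix g assume g[measurable]: "g \<in> borel_measurable borel"
    and g2: "set_integrable lborel {0..T} (\<lambda>s. (g s)\<^sup>2)"
    and h: "\<forall>t\<in>{0..T}. h t = (LINT s:{0..t}|lborel. g s)"
  \<comment> \<open>On a bounded interval square integrability implies integrability, as \<open>|g| \<le> 1 + g\<^sup>2\<close>.\<close>
  have g1: "set_integrable lborel {0..T} g"
    unfolding set_integrable_def
  proof (rule Bochner_Integration.integrable_bound)
    show "integrable lborel (\<lambda>r. indicator {0..T} r *\<^sub>R (1 + (g r)\<^sup>2))"
      using g2 T unfolding set_integrable_def scaleR_add_right
      by (intro Bochner_Integration.integrable_add integrable_scaleR_left integrable_real_indicator) auto
    have "\<bar>g r\<bar> \<le> 1 + (g r)\<^sup>2" for r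
    proof -
      have "0 \<le> (\<bar>g r\<bar> - 1)\<^sup>2 + \<bar>g r\<bar>" by simp
      then show ?thesis by (simp add: power2_eq_square algebra_simps)
    qed
    then show "AE r in lborel. norm (indicator {0..T} r *\<^sub>R g r) \<le> norm (indicator {0..T} r *\<^sub>R (1 + (g r)\<^sup>2))"
      by (intro AE_I2) (auto simp: indicator_def)
  qed measurable
  define S where "S t = (LINT s:{0..t}|lborel. (g s)\<^sup>2)" for t
  have \<tau>: "0 \<le> \<tau> i" "\<tau> i < \<tau> (Suc i)" "i < n \<Longrightarrow> \<tau> (Suc i) \<le> T" for i
    using T n by (auto simp: \<tau>_def divide_simps mult_mono)
  have inc: "(h (\<tau> (Suc i)) - h (\<tau> i))\<^sup>2 \<le> T / n * (S (\<tau> (Suc i)) - S (\<tau> i))" if i: "i < n" for i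
  proof -
    note t = \<tau>(1,2)[of i] \<tau>(3)[OF i]
    have "h (\<tau> (Suc i)) - h (\<tau> i) = (LINT r:{\<tau> i<..\<tau> (Suc i)}|lborel. g r)"
      using h t by (subst set_integral_Ioc_diff[OF g1]) auto
    then have "(h (\<tau> (Suc i)) - h (\<tau> i))\<^sup>2 \<le> (\<tau> (Suc i) - \<tau> i) * (LINT r:{\<tau> i<..\<tau> (Suc i)}|lborel. (g r)\<^sup>2)"
      using t by (simp only:) (intro square_integral_Ioc_le set_integrable_subset[OF g1] set_integrable_subset[OF g2]; auto)
    also have "(LINT r:{\<tau> i<..\<tau> (Suc i)}|lborel. (g r)\<^sup>2) = S (\<tau> (Suc i)) - S (\<tau> i)"
      unfolding S_def using t by (intro set_integral_Ioc_diff[OF g2]) auto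
    also have "\<tau> (Suc i) - \<tau> i = T / n" by (simp add: \<tau>_def add_divide_distrib distrib_right)
    finally show ?thesis .
  qed
  have S0: "0 \<le> S 0"
    unfolding S_def set_lebesgue_integral_def by (intro Bochner_Integration.integral_nonneg) auto
  have "(\<Sum>i<n. (h (\<tau> (Suc i)) - h (\<tau> i))\<^sup>2) \<le> (\<Sum>i<n. T / n * (S (\<tau> (Suc i)) - S (\<tau> i)))"
    by (intro sum_mono inc) auto
  also have "\<dots> = T / n * (S (\<tau> n) - S (\<tau> 0))"
    unfolding sum_distrib_left[symmetric] using sum_lessThan_telescope[of "\<lambda>i. S (\<tau> i)" n] by simp
  also have "\<dots> \<le> T / n * S T"
    using S0 T n by (intro mult_left_mono) (auto simp: \<tau>_def)
  finally have "real n / T * (\<Sum>i<n. (h (\<tau> (Suc i)) - h (\<tau> i))\<^sup>2) \<le> real n / T * (T / n * S T)"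
    using T by (intro mult_left_mono) auto
  then have le: "real n / T * (\<Sum>i<n. (h (\<tau> (Suc i)) - h (\<tau> i))\<^sup>2) \<le> S T"
    using T n by simp
  have "(\<integral>\<^sup>+s\<in>{0..T}. ennreal ((g s)\<^sup>2) \<partial>lborel) = (\<integral>\<^sup>+s. ennreal (indicator {0..T} s *\<^sub>R (g s)\<^sup>2) \<partial>lborel)"
    by (intro nn_integral_cong) (auto simp: indicator_def)
  also have "\<dots> = ennreal (S T)"
    unfolding S_def set_lebesgue_integral_def using g2
    by (intro nn_integral_eq_integral) (auto simp: set_integrable_def)
  finally show "ennreal (real n / T) * (\<Sum>i<n. ennreal ((h (\<tau> (Suc i)) - h (\<tau> i))\<^sup>2)) \<le>
      (\<integral>\<^sup>+s\<in>{0..T}. ennreal ((g s)\<^sup>2) \<partial>lborel)"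
    using le T by (simp add: sum_ennreal ennreal_mult[symmetric] sum_nonneg ennreal_leI)
qed

section \<open>The Poisson process and its jump times\<close>

locale poisson_model =
  fixes M :: "'a measure" and T :: real and F :: "real \<Rightarrow> 'a measure" and X :: "real \<Rightarrow> 'a \<Rightarrow> nat"
  assumes T_pos: "0 < T" and filtered: "filtered_prob_space M T F" and poisson: "poisson_process M T F X"
begin

lemma prob_space_M: "prob_space M"
  using filtered by (simp add: filtered_prob_space_def)

lemma subalgebra_F: "t \<in> {0..T} \<Longrightarrow> subalgebra M (F t)"
  using filtered by (auto simp: filtered_prob_space_def)

lemma subalgebra_F_F: "0 \<le> s \<Longrightarrow> s \<le> t \<Longrightarrow> t \<le> T \<Longrightarrow> subalgebra (F t) (F s)"
  using filtered by (auto simp: filtered_prob_space_def subalgebra_def)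

lemma measurable_F_mono: "f \<in> measurable (F s) N \<Longrightarrow> 0 \<le> s \<Longrightarrow> s \<le> t \<Longrightarrow> t \<le> T \<Longrightarrow> f \<in> measurable (F t) N"
  using measurable_from_subalg[OF subalgebra_F_F] by blast

lemma measurable_F_M: "f \<in> measurable (F t) N \<Longrightarrow> t \<in> {0..T} \<Longrightarrow> f \<in> measurable M N"
  using measurable_from_subalg[OF subalgebra_F] by blast

lemma X_measurable_F: "0 \<le> s \<Longrightarrow> s \<le> t \<Longrightarrow> t \<le> T \<Longrightarrow> X s \<in> measurable (F t) (count_space UNIV)"
  using poisson measurable_F_mono[of "X s" s] by (auto simp: poisson_process_def)

lemma X_measurable: "t \<in> {0..T} \<Longrightarrow> X t \<in> measurable M (count_space UNIV)"
  using measurable_F_M[OF X_measurable_F[of t t]] by auto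

lemma increment_measurable_F:
  assumes "0 \<le> s" "s \<le> t" "t \<le> r" "r \<le> T"
  shows "(\<lambda>\<omega>. X t \<omega> - X s \<omega>) \<in> measurable (F r) (count_space UNIV)"
proof -
  have [measurable]: "X t \<in> measurable (F r) (count_space UNIV)" "X s \<in> measurable (F r) (count_space UNIV)"
    using assms X_measurable_F by auto
  show ?thesis by measurable
qed

lemma X_0: "\<omega> \<in> space M \<Longrightarrow> X 0 \<omega> = 0"
  using poisson by (auto simp: poisson_process_def)

lemma X_mono: "\<omega> \<in> space M \<Longrightarrow> 0 \<le> s \<Longrightarrow> s \<le> t \<Longrightarrow> t \<le> T \<Longrightarrow> X s \<omega> \<le> X t \<omega>"
  using poisson by (auto simp: poisson_process_def mono_on_def)

text \<open>
  The reference process has unit rate: its clock is time itself.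
\<close>

lemma cond_poisson_M:
  assumes st: "0 \<le> s" "s < t" "t \<le> T"
  shows "cond_poisson M (F s) (\<lambda>\<omega>. X t \<omega> - X s \<omega>) (\<lambda>_. t - s)"
  unfolding cond_poisson_def
proof (intro allI ballI)
  interpret prob_space M by (rule prob_space_M)
  fix k Z assume Z: "(Z :: 'a \<Rightarrow> ennreal) \<in> borel_measurable (F s)"
  let ?N = "\<lambda>\<omega>. X t \<omega> - X s \<omega>"
  have sub: "subalgebra M (F s)" using st by (intro subalgebra_F) auto
  have N[measurable]: "?N \<in> measurable M (count_space UNIV)"
    using measurable_F_M[OF increment_measurable_F[of s t t]] st by auto
  have distr: "distr M (count_space UNIV) ?N = measure_pmf (poisson_pmf (t - s))"
    and ind: "indep_set (sets (F s)) (range (\<lambda>B. ?N -` B \<inter> space M))"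
    using poisson st unfolding poisson_process_def by blast+
  have pk: "emeasure M (?N -` {k} \<inter> space M) = ennreal (poisson_weight (t - s) k)"
  proof -
    have "emeasure M (?N -` {k} \<inter> space M) = emeasure (distr M (count_space UNIV) ?N) {k}"
      by (subst emeasure_distr) auto
    then show ?thesis using st by (simp add: distr emeasure_pmf_single poisson_weight_def)
  qed
  show "(\<integral>\<^sup>+\<omega>. Z \<omega> * indicator {k} (?N \<omega>) \<partial>M) = (\<integral>\<^sup>+\<omega>. Z \<omega> * ennreal (poisson_weight (t - s) k) \<partial>M)"
  proof (rule nn_integral_eq_from_subalgebra_sets[OF sub _ _ _ Z])
    fix A assume A: "A \<in> sets (F s)"
    then have [measurable]: "A \<in> sets M" using sub by (auto simp: subalgebra_def)
    have "(\<integral>\<^sup>+\<omega>\<in>A. indicator {k} (?N \<omega>) \<partial>M) = (\<integral>\<^sup>+\<omega>. indicator (A \<inter> (?N -` {k} \<inter> space M)) \<omega> \<partial>M)"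
      by (intro nn_integral_cong) (auto simp: indicator_def)
    also have "\<dots> = emeasure M (A \<inter> (?N -` {k} \<inter> space M))" by (subst nn_integral_indicator) auto
    also have "\<dots> = emeasure M A * emeasure M (?N -` {k} \<inter> space M)"
      using indep_setD[OF ind A, of "?N -` {k} \<inter> space M"]
      by (auto simp: emeasure_eq_measure ennreal_mult)
    also have "\<dots> = (\<integral>\<^sup>+\<omega>\<in>A. ennreal (poisson_weight (t - s) k) \<partial>M)"
      by (simp add: pk nn_integral_cmult_indicator mult.commute[of "emeasure M A"])
    finally show "(\<integral>\<^sup>+\<omega>\<in>A. indicator {k} (?N \<omega>) \<partial>M) = (\<integral>\<^sup>+\<omega>\<in>A. ennreal (poisson_weight (t - s) k) \<partial>M)" .
  qed auto
qed

text \<open>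
  Right-continuity makes the infimum defining the jump time a minimum.
\<close>

lemma jump_time_le_iff:
  assumes \<omega>: "\<omega> \<in> space M" and k: "k \<le> X T \<omega>" and t: "t \<in> {0..T}"
  shows "jump_time T X k \<omega> \<le> t \<longleftrightarrow> k \<le> X t \<omega>"
    and "jump_time T X k \<omega> \<in> {0..T}"
proof -
  let ?S = "{t\<in>{0..T}. k \<le> X t \<omega>}" and ?J = "jump_time T X k \<omega>"
  have TS: "T \<in> ?S" using k T_pos by auto
  have bdd: "bdd_below ?S" by (rule bdd_belowI[of _ 0]) auto
  have "0 \<le> ?J" unfolding jump_time_def using TS by (intro cInf_greatest) auto
  moreover have "?J \<le> T" unfolding jump_time_def by (rule cInf_lower[OF TS bdd])
  ultimately show J: "?J \<in> {0..T}" by auto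
  have JS: "k \<le> X ?J \<omega>"
  proof (cases "?J = T")
    case False
    with J have "?J \<in> {0..<T}" by auto
    then have "continuous (at_right ?J) (\<lambda>s. X s \<omega>)"
      using poisson \<omega> by (auto simp: poisson_process_def)
    then have "eventually (\<lambda>s. X s \<omega> = X ?J \<omega>) (at_right ?J)"
      by (simp add: continuous_within tendsto_discrete)
    then obtain b where b: "?J < b" "\<And>s. ?J < s \<Longrightarrow> s < b \<Longrightarrow> X s \<omega> = X ?J \<omega>"
      unfolding eventually_at_right_field by blast
    have "Inf ?S < b" using b(1) by (simp add: jump_time_def)
    then obtain s where s: "s \<in> ?S" "s < b" using cInf_lessD[of ?S b] TS by blast
    have "?J \<le> s" unfolding jump_time_def by (rule cInf_lower[OF s(1) bdd])
    then show ?thesis using b(2)[of s] s by (cases "s = ?J") auto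
  qed (use k in simp)
  show "?J \<le> t \<longleftrightarrow> k \<le> X t \<omega>"
  proof
    assume "?J \<le> t"
    then show "k \<le> X t \<omega>" using X_mono[OF \<omega>, of ?J t] J t JS by auto
  next
    assume "k \<le> X t \<omega>"
    then show "?J \<le> t" unfolding jump_time_def using t by (intro cInf_lower bdd) auto
  qed
qed

text \<open>
  A factor \<open>c\<close> on the intensity in \<open>(s, t]\<close> multiplies the density by \<open>c\<close> once for each jump
  in that interval. Counting by \<open>k \<le> X\<close> also covers several jumps at the same time.
\<close>

lemma prod_jump_times_power:
  fixes c :: real
  assumes \<omega>: "\<omega> \<in> space M" and st: "0 \<le> s" "s \<le> t" "t \<le> T"
  shows "(\<Prod>k=1..X T \<omega>. if jump_time T X k \<omega> \<in> {s<..t} then c else 1) = c ^ (X t \<omega> - X s \<omega>)"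
proof -
  have eq: "{k\<in>{1..X T \<omega>}. jump_time T X k \<omega> \<in> {s<..t}} = {X s \<omega><..X t \<omega>}"
  proof -
    have "jump_time T X k \<omega> \<le> t \<longleftrightarrow> k \<le> X t \<omega>" "jump_time T X k \<omega> \<le> s \<longleftrightarrow> k \<le> X s \<omega>" if "k \<le> X T \<omega>" for k
      using jump_time_le_iff(1)[OF \<omega> that] st by auto
    moreover have "X t \<omega> \<le> X T \<omega>" using X_mono[OF \<omega>, of t T] st by auto
    ultimately show ?thesis by (auto simp: not_le[symmetric])
  qed
  have "(\<Prod>k=1..X T \<omega>. if jump_time T X k \<omega> \<in> {s<..t} then c else 1) =
      (\<Prod>k\<in>{k\<in>{1..X T \<omega>}. jump_time T X k \<omega> \<in> {s<..t}}. c)"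
    by (rule prod.inter_filter[symmetric]) simp
  then show ?thesis unfolding eq by simp
qed

lemma girsanov_density_measurable:
  assumes v: "case_prod v \<in> borel_measurable (restrict_space borel {0..T} \<Otimes>\<^sub>M F 0)"
  shows "girsanov_density T X v \<in> borel_measurable M"
proof -
  have vt: "(\<lambda>p. v (max 0 (min T (fst p))) (snd p)) \<in> borel_measurable (borel \<Otimes>\<^sub>M M)"
    using T_pos by (intro measurable_clamp[OF _ subalgebra_F v]) auto
  \<comment> \<open>Outside the event of at least \<open>k\<close> jumps the infimum is over the empty set, so a value in \<open>[0, T]\<close> is put there.\<close>
  define J where "J k \<omega> = (if k \<le> X T \<omega> then jump_time T X k \<omega> else T)" for k \<omega>
  have XT[measurable]: "X T \<in> measurable M (count_space UNIV)" using X_measurable T_pos by auto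
  have J[measurable]: "J k \<in> borel_measurable M" for k
    unfolding borel_measurable_iff_le
  proof
    fix t
    consider "t < 0" | "0 \<le> t" "t < T" | "T \<le> t" by linarith
    then show "{\<omega> \<in> space M. J k \<omega> \<le> t} \<in> sets M"
    proof cases
      case 1
      have "{\<omega> \<in> space M. J k \<omega> \<le> t} = {}"
        using 1 jump_time_le_iff(2)[of _ k T] T_pos by (fastforce simp: J_def split: if_splits)
      then show ?thesis by (metis sets.empty_sets)
    next
      case 2
      have [measurable]: "X t \<in> measurable M (count_space UNIV)" using X_measurable 2 by auto
      have "{\<omega> \<in> space M. J k \<omega> \<le> t} = {\<omega> \<in> space M. k \<le> X t \<omega>}"
        using 2 jump_time_le_iff(1)[of _ k t] X_mono[of _ t T] by (fastforce simp: J_def split: if_splits)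
      also have "\<dots> \<in> sets M" by measurable
      finally show ?thesis .
    next
      case 3
      have "{\<omega> \<in> space M. J k \<omega> \<le> t} = space M"
        using 3 jump_time_le_iff(2)[of _ k T] T_pos by (fastforce simp: J_def split: if_splits)
      then show ?thesis by simp
    qed
  qed
  have vJ: "(\<lambda>\<omega>. v (max 0 (min T (J k \<omega>))) \<omega>) \<in> borel_measurable M" for k
    using measurable_compose[OF measurable_Pair[OF J[of k] measurable_ident] vt] by (simp add: id_def)
  have prod_meas: "(\<lambda>\<omega>. (\<Prod>k=1..n. v (max 0 (min T (J k \<omega>))) \<omega>)) \<in> borel_measurable M" for n
    using vJ by measurable
  have int_meas: "(\<lambda>\<omega>. LINT s|lborel. indicator {0..T} s *\<^sub>R (v (max 0 (min T s)) \<omega> - 1)) \<in> borel_measurable M"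
  proof -
    have vt': "(\<lambda>(\<omega>, s). indicator {0..T} s *\<^sub>R (v (max 0 (min T s)) \<omega> - 1)) \<in> borel_measurable (M \<Otimes>\<^sub>M lborel)"
    proof -
      have [measurable]: "(\<lambda>p. v (max 0 (min T (snd p))) (fst p)) \<in> borel_measurable (M \<Otimes>\<^sub>M lborel)"
      proof -
        have "(\<lambda>p. (snd p, fst p)) \<in> measurable (M \<Otimes>\<^sub>M lborel) (borel \<Otimes>\<^sub>M M)" by measurable
        from measurable_compose[OF this vt] show ?thesis by simp
      qed
      show ?thesis by (simp add: case_prod_beta)
    qed
    show ?thesis using sigma_finite_measure.borel_measurable_lebesgue_integral[OF sigma_finite_lborel vt'] by simp
  qed
  have "(\<lambda>\<omega>. (\<Prod>k=1..X T \<omega>. v (max 0 (min T (J k \<omega>))) \<omega>) *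
      exp (- (LINT s|lborel. indicator {0..T} s *\<^sub>R (v (max 0 (min T s)) \<omega> - 1)))) \<in> borel_measurable M"
    using measurable_compose_countable[OF prod_meas XT] int_meas by measurable
  also have "?this \<longleftrightarrow> ?thesis"
  proof (rule measurable_cong)
    fix \<omega> assume \<omega>: "\<omega> \<in> space M"
    have "(\<Prod>k=1..X T \<omega>. v (max 0 (min T (J k \<omega>))) \<omega>) = (\<Prod>k=1..X T \<omega>. v (jump_time T X k \<omega>) \<omega>)"
      using jump_time_le_iff(2)[OF \<omega>, of _ T] T_pos by (intro prod.cong) (auto simp: J_def)
    moreover have "(LINT s|lborel. indicator {0..T} s *\<^sub>R (v (max 0 (min T s)) \<omega> - 1)) = (LINT s:{0..T}|lborel. (v s \<omega> - 1))"
      unfolding set_lebesgue_integral_def by (intro Bochner_Integration.integral_cong) (auto simp: indicator_def)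
    ultimately show "(\<Prod>k=1..X T \<omega>. v (max 0 (min T (J k \<omega>))) \<omega>) *
      exp (- (LINT s|lborel. indicator {0..T} s *\<^sub>R (v (max 0 (min T s)) \<omega> - 1))) = girsanov_density T X v \<omega>"
      by (simp add: girsanov_density_def)
  qed
  finally show ?thesis .
qed

end

section \<open>Tilting a Cox process on an interval\<close>

text \<open>
  A Cox process described by its cumulative intensity \<open>U\<close>. This is the property of the measure
  \<open>P\<^sup>u\<close> that the change-of-measure computations use.
\<close>

locale cox_model = poisson_model M T F X
  for M :: "'a measure" and T F X +
  fixes Q :: "'a measure" and U :: "real \<Rightarrow> 'a \<Rightarrow> real"
  assumes prob_Q: "prob_space Q" and sets_Q: "sets Q = sets M"
    and U_measurable: "t \<in> {0..T} \<Longrightarrow> U t \<in> borel_measurable (F 0)"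
    and U_mono: "\<omega> \<in> space M \<Longrightarrow> 0 \<le> s \<Longrightarrow> s \<le> t \<Longrightarrow> t \<le> T \<Longrightarrow> U s \<omega> \<le> U t \<omega>"
    and cox_strict: "0 \<le> s \<Longrightarrow> s < t \<Longrightarrow> t \<le> T \<Longrightarrow>
      cond_poisson Q (F s) (\<lambda>\<omega>. X t \<omega> - X s \<omega>) (\<lambda>\<omega>. U t \<omega> - U s \<omega>)"
begin

lemma space_Q: "space Q = space M"
  by (rule sets_eq_imp_space_eq[OF sets_Q])

lemma measurable_Q: "measurable Q N = measurable M N"
  by (rule measurable_cong_sets[OF sets_Q refl])

lemma subalgebra_Q: "t \<in> {0..T} \<Longrightarrow> subalgebra Q (F t)"
  using subalgebra_F[of t] by (simp add: subalgebra_def sets_Q space_Q)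

lemma cox:
  assumes "0 \<le> s" "s \<le> t" "t \<le> T"
  shows "cond_poisson Q (F s) (\<lambda>\<omega>. X t \<omega> - X s \<omega>) (\<lambda>\<omega>. U t \<omega> - U s \<omega>)"
  using assms cox_strict[of s t] by (cases "s = t") (auto intro: cond_poisson_zero)

lemma U_increment_measurable:
  assumes "0 \<le> s" "s \<le> t" "t \<le> T" "0 \<le> r" "r \<le> T"
  shows "(\<lambda>\<omega>. U t \<omega> - U s \<omega>) \<in> borel_measurable (F r)"
  using assms by (intro measurable_F_mono[of _ 0 _ r] borel_measurable_diff U_measurable) auto

text \<open>
  The likelihood ratio on \<open>(s, t]\<close> for multiplying the intensity by \<open>c\<close>.
\<close>

definition tilt :: "('a \<Rightarrow> real) \<Rightarrow> real \<Rightarrow> real \<Rightarrow> 'a \<Rightarrow> real" where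
  "tilt c s t \<omega> = c \<omega> ^ (X t \<omega> - X s \<omega>) * exp (- ((c \<omega> - 1) * (U t \<omega> - U s \<omega>)))"

text \<open>
  The cumulative intensity after the intensity is multiplied by \<open>c\<close> on \<open>(s0, t0]\<close>.
\<close>

definition tilted_clock :: "('a \<Rightarrow> real) \<Rightarrow> real \<Rightarrow> real \<Rightarrow> real \<Rightarrow> 'a \<Rightarrow> real" where
  "tilted_clock c s0 t0 t \<omega> = U t \<omega> + (c \<omega> - 1) * (U (min t t0) \<omega> - U (min t s0) \<omega>)"

lemma tilt_mult:
  assumes "\<omega> \<in> space M" "0 \<le> s" "s \<le> m" "m \<le> t" "t \<le> T"
  shows "tilt c s t \<omega> = tilt c s m \<omega> * tilt c m t \<omega>"
proof -
  have "X t \<omega> - X s \<omega> = (X m \<omega> - X s \<omega>) + (X t \<omega> - X m \<omega>)"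
    using X_mono[OF assms(1), of s m] X_mono[OF assms(1), of m t] assms by simp
  then have "c \<omega> ^ (X t \<omega> - X s \<omega>) = c \<omega> ^ (X m \<omega> - X s \<omega>) * c \<omega> ^ (X t \<omega> - X m \<omega>)"
    by (simp add: power_add)
  moreover have "exp (- ((c \<omega> - 1) * (U t \<omega> - U s \<omega>))) =
      exp (- ((c \<omega> - 1) * (U m \<omega> - U s \<omega>))) * exp (- ((c \<omega> - 1) * (U t \<omega> - U m \<omega>)))"
    unfolding exp_add[symmetric] by (simp add: algebra_simps)
  ultimately show ?thesis by (simp add: tilt_def)
qed

lemma tilt_nonneg: "0 \<le> c \<omega> \<Longrightarrow> 0 \<le> tilt c s t \<omega>"
  by (simp add: tilt_def)

context
  fixes c :: "'a \<Rightarrow> real"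
  assumes c_measurable: "c \<in> borel_measurable (F 0)"
    and c_nonneg: "\<And>\<omega>. 0 \<le> c \<omega>"
begin

lemma c_measurable_F: "0 \<le> r \<Longrightarrow> r \<le> T \<Longrightarrow> c \<in> borel_measurable (F r)"
  using measurable_F_mono[OF c_measurable, of r] by simp

lemma tilt_measurable:
  assumes "0 \<le> s" "s \<le> t" "t \<le> r" "r \<le> T"
  shows "tilt c s t \<in> borel_measurable (F r)"
proof -
  have [measurable]: "c \<in> borel_measurable (F r)" "(\<lambda>\<omega>. U t \<omega> - U s \<omega>) \<in> borel_measurable (F r)"
    "(\<lambda>\<omega>. X t \<omega> - X s \<omega>) \<in> measurable (F r) (count_space UNIV)"
    using assms by (auto intro!: c_measurable_F U_increment_measurable increment_measurable_F)
  have "(\<lambda>\<omega>. c \<omega> ^ (X t \<omega> - X s \<omega>)) \<in> borel_measurable (F r)"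
    by (rule measurable_compose_countable[where f="\<lambda>n \<omega>. c \<omega> ^ n"]) measurable
  then show ?thesis unfolding tilt_def by measurable
qed

lemma tilt_measurable_M:
  assumes "0 \<le> s" "s \<le> t" "t \<le> T"
  shows "tilt c s t \<in> borel_measurable M"
  using measurable_F_M[OF tilt_measurable[of s t t]] assms by auto

text \<open>
  The generating function of the Poisson law. Power 1 gives that the tilt is a conditional
  density, power 2 gives its second moment \<open>exp ((c - 1)\<^sup>2 a)\<close> for a clock increment \<open>a\<close>.
\<close>

lemma nn_integral_tilt_power:
  assumes st: "0 \<le> s" "s \<le> t" "t \<le> T" and Y: "Y \<in> borel_measurable (F s)"
  shows "(\<integral>\<^sup>+\<omega>. Y \<omega> * ennreal (tilt c s t \<omega> ^ p) \<partial>Q) =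
    (\<integral>\<^sup>+\<omega>. Y \<omega> * ennreal (exp ((c \<omega> ^ p - 1 - real p * (c \<omega> - 1)) * (U t \<omega> - U s \<omega>))) \<partial>Q)"
proof -
  let ?a = "\<lambda>\<omega>. U t \<omega> - U s \<omega>"
  have [measurable]: "c \<in> borel_measurable (F s)" "?a \<in> borel_measurable (F s)" "Y \<in> borel_measurable (F s)"
    using st by (auto intro!: c_measurable_F U_increment_measurable Y)
  have N: "(\<lambda>\<omega>. X t \<omega> - X s \<omega>) \<in> measurable Q (count_space UNIV)"
    unfolding measurable_Q using measurable_F_M[OF increment_measurable_F[of s t t]] st by auto
  have "(\<integral>\<^sup>+\<omega>. Y \<omega> * ennreal (tilt c s t \<omega> ^ p) \<partial>Q) =
     (\<integral>\<^sup>+\<omega>. (Y \<omega> * ennreal (exp (- (real p * (c \<omega> - 1) * ?a \<omega>)))) * ennreal ((c \<omega> ^ p) ^ (X t \<omega> - X s \<omega>)) \<partial>Q)"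
  proof (intro nn_integral_cong)
    fix \<omega>
    have "tilt c s t \<omega> ^ p = exp (- (real p * (c \<omega> - 1) * ?a \<omega>)) * (c \<omega> ^ p) ^ (X t \<omega> - X s \<omega>)"
      by (simp add: tilt_def power_mult_distrib power_mult[symmetric] mult.commute[of _ p] exp_of_nat_mult[symmetric] algebra_simps)
    then show "Y \<omega> * ennreal (tilt c s t \<omega> ^ p) =
      (Y \<omega> * ennreal (exp (- (real p * (c \<omega> - 1) * ?a \<omega>)))) * ennreal ((c \<omega> ^ p) ^ (X t \<omega> - X s \<omega>))"
      by (simp add: ennreal_mult c_nonneg mult.assoc)
  qed
  also have "\<dots> = (\<integral>\<^sup>+\<omega>. (Y \<omega> * ennreal (exp (- (real p * (c \<omega> - 1) * ?a \<omega>)))) * ennreal (exp ((c \<omega> ^ p - 1) * ?a \<omega>)) \<partial>Q)"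
    using st by (intro cond_poisson_generating[OF cox[OF st] subalgebra_Q N])
      (auto simp: c_nonneg space_Q intro!: U_mono)
  also have "\<dots> = (\<integral>\<^sup>+\<omega>. Y \<omega> * ennreal (exp ((c \<omega> ^ p - 1 - real p * (c \<omega> - 1)) * ?a \<omega>)) \<partial>Q)"
    by (intro nn_integral_cong) (simp add: mult.assoc ennreal_mult[symmetric] exp_add[symmetric] algebra_simps)
  finally show ?thesis .
qed

lemma nn_integral_tilt:
  assumes "0 \<le> s" "s \<le> t" "t \<le> T" "Y \<in> borel_measurable (F s)"
  shows "(\<integral>\<^sup>+\<omega>. Y \<omega> * ennreal (tilt c s t \<omega>) \<partial>Q) = (\<integral>\<^sup>+\<omega>. Y \<omega> \<partial>Q)"
  using nn_integral_tilt_power[OF assms, of 1] by simp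

context
  fixes s0 t0 :: real
  assumes s0t0: "0 \<le> s0" "s0 \<le> t0" "t0 \<le> T"
begin

abbreviation tilted :: "'a measure" where
  "tilted \<equiv> density Q (\<lambda>\<omega>. ennreal (tilt c s0 t0 \<omega>))"

lemma tilt_measurable_Q [measurable]: "(\<lambda>\<omega>. ennreal (tilt c s0 t0 \<omega>)) \<in> borel_measurable Q"
  unfolding measurable_Q using tilt_measurable_M[OF s0t0] by measurable

lemma measurable_F_Q: "f \<in> measurable (F r) N \<Longrightarrow> 0 \<le> r \<Longrightarrow> r \<le> T \<Longrightarrow> f \<in> measurable Q N"
  unfolding measurable_Q by (rule measurable_F_M[of f r N]) auto

lemma prob_space_tilted: "prob_space tilted"
proof (rule prob_spaceI)
  have "emeasure tilted (space tilted) = (\<integral>\<^sup>+\<omega>. 1 * ennreal (tilt c s0 t0 \<omega>) \<partial>Q)"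
    by (subst emeasure_density) (auto intro!: nn_integral_cong)
  also have "\<dots> = (\<integral>\<^sup>+\<omega>. 1 \<partial>Q)" using s0t0 by (intro nn_integral_tilt) auto
  finally show "emeasure tilted (space tilted) = 1"
    using prob_space.emeasure_space_1[OF prob_Q] by simp
qed

lemma nn_integral_tilted:
  "Y \<in> borel_measurable Q \<Longrightarrow> (\<integral>\<^sup>+\<omega>. Y \<omega> \<partial>tilted) = (\<integral>\<^sup>+\<omega>. Y \<omega> * ennreal (tilt c s0 t0 \<omega>) \<partial>Q)"
  by (simp add: nn_integral_density mult.commute)

text \<open>
  Before \<open>s0\<close> everything is known when the tilt starts, so the tilt integrates out.
\<close>

lemma cond_poisson_tilted_before:
  assumes st: "0 \<le> s" "s \<le> t" "t \<le> s0"
  shows "cond_poisson tilted (F s) (\<lambda>\<omega>. X t \<omega> - X s \<omega>) (\<lambda>\<omega>. U t \<omega> - U s \<omega>)"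
  unfolding cond_poisson_def
proof (intro allI ballI)
  fix k Z assume Z[measurable]: "(Z :: 'a \<Rightarrow> ennreal) \<in> borel_measurable (F s)"
  let ?a = "\<lambda>\<omega>. U t \<omega> - U s \<omega>" and ?N = "\<lambda>\<omega>. X t \<omega> - X s \<omega>"
  have [measurable]: "?N \<in> measurable (F s0) (count_space UNIV)" "?a \<in> borel_measurable (F s0)" "Z \<in> borel_measurable (F s0)"
    using st s0t0 Z by (auto intro!: U_increment_measurable increment_measurable_F measurable_F_mono[OF Z])
  have 1: "(\<lambda>\<omega>. Z \<omega> * indicator {k} (?N \<omega>)) \<in> borel_measurable (F s0)"
    and 2: "(\<lambda>\<omega>. Z \<omega> * ennreal (poisson_weight (?a \<omega>) k)) \<in> borel_measurable (F s0)"
    by measurable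
  have "(\<integral>\<^sup>+\<omega>. Z \<omega> * indicator {k} (?N \<omega>) \<partial>tilted) = (\<integral>\<^sup>+\<omega>. Z \<omega> * indicator {k} (?N \<omega>) \<partial>Q)"
    using s0t0 by (subst nn_integral_tilted) (auto intro!: measurable_F_Q[OF 1] nn_integral_tilt 1)
  also have "\<dots> = (\<integral>\<^sup>+\<omega>. Z \<omega> * ennreal (poisson_weight (?a \<omega>) k) \<partial>Q)"
    using st s0t0 by (intro cond_poissonD[OF cox] Z) auto
  also have "\<dots> = (\<integral>\<^sup>+\<omega>. Z \<omega> * ennreal (poisson_weight (?a \<omega>) k) \<partial>tilted)"
    using s0t0 by (subst nn_integral_tilted) (auto intro!: measurable_F_Q[OF 2] nn_integral_tilt[symmetric] 2)
  finally show "(\<integral>\<^sup>+\<omega>. Z \<omega> * indicator {k} (?N \<omega>) \<partial>tilted) =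
      (\<integral>\<^sup>+\<omega>. Z \<omega> * ennreal (poisson_weight (?a \<omega>) k) \<partial>tilted)" .
qed

text \<open>
  After \<open>t0\<close> the tilt is known and can be absorbed into the test function.
\<close>

lemma cond_poisson_tilted_after:
  assumes st: "t0 \<le> s" "s \<le> t" "t \<le> T"
  shows "cond_poisson tilted (F s) (\<lambda>\<omega>. X t \<omega> - X s \<omega>) (\<lambda>\<omega>. U t \<omega> - U s \<omega>)"
  unfolding cond_poisson_def
proof (intro allI ballI)
  fix k Z assume Z[measurable]: "(Z :: 'a \<Rightarrow> ennreal) \<in> borel_measurable (F s)"
  let ?a = "\<lambda>\<omega>. U t \<omega> - U s \<omega>" and ?N = "\<lambda>\<omega>. X t \<omega> - X s \<omega>"
  have [measurable]: "tilt c s0 t0 \<in> borel_measurable (F s)"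
    using st s0t0 by (intro tilt_measurable) auto
  have [measurable]: "?N \<in> measurable Q (count_space UNIV)" "?a \<in> borel_measurable Q" "Z \<in> borel_measurable Q"
    using st s0t0
    by (auto intro!: measurable_F_Q[OF increment_measurable_F[of s t t]]
        measurable_F_Q[OF U_increment_measurable[of s t t]] measurable_F_Q[OF Z])
  have "(\<integral>\<^sup>+\<omega>. Z \<omega> * indicator {k} (?N \<omega>) \<partial>tilted) =
      (\<integral>\<^sup>+\<omega>. (Z \<omega> * ennreal (tilt c s0 t0 \<omega>)) * indicator {k} (?N \<omega>) \<partial>Q)"
    by (subst nn_integral_tilted) (auto simp: ac_simps)
  also have "\<dots> = (\<integral>\<^sup>+\<omega>. (Z \<omega> * ennreal (tilt c s0 t0 \<omega>)) * ennreal (poisson_weight (?a \<omega>) k) \<partial>Q)"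
    using st s0t0 by (intro cond_poissonD[OF cox]) auto
  also have "\<dots> = (\<integral>\<^sup>+\<omega>. Z \<omega> * ennreal (poisson_weight (?a \<omega>) k) \<partial>tilted)"
    by (subst nn_integral_tilted) (auto simp: ac_simps)
  finally show "(\<integral>\<^sup>+\<omega>. Z \<omega> * indicator {k} (?N \<omega>) \<partial>tilted) =
      (\<integral>\<^sup>+\<omega>. Z \<omega> * ennreal (poisson_weight (?a \<omega>) k) \<partial>tilted)" .
qed

text \<open>
  Inside, the tilt splits into past, present and future factors. The past is absorbed into the
  test function, the future integrates out, and the present factor turns the Poisson weight of
  parameter \<open>a\<close> into that of parameter \<open>c a\<close>.
\<close>

lemma cond_poisson_tilted_inside:
  assumes st: "s0 \<le> s" "s \<le> t" "t \<le> t0"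
  shows "cond_poisson tilted (F s) (\<lambda>\<omega>. X t \<omega> - X s \<omega>) (\<lambda>\<omega>. c \<omega> * (U t \<omega> - U s \<omega>))"
  unfolding cond_poisson_def
proof (intro allI ballI)
  fix k Z assume Z[measurable]: "(Z :: 'a \<Rightarrow> ennreal) \<in> borel_measurable (F s)"
  let ?a = "\<lambda>\<omega>. U t \<omega> - U s \<omega>" and ?N = "\<lambda>\<omega>. X t \<omega> - X s \<omega>"
  have bounds: "0 \<le> s" "s \<le> T" "0 \<le> t" "t \<le> T" using st s0t0 by auto
  have [measurable]: "tilt c s0 s \<in> borel_measurable (F s)" "c \<in> borel_measurable (F s)" "?a \<in> borel_measurable (F s)"
    using st s0t0 by (auto intro!: tilt_measurable c_measurable_F U_increment_measurable)
  have [measurable]: "tilt c s0 s \<in> borel_measurable (F t)" "c \<in> borel_measurable (F t)" "?a \<in> borel_measurable (F t)"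
    "?N \<in> measurable (F t) (count_space UNIV)" "Z \<in> borel_measurable (F t)"
    using st s0t0 by (auto intro!: tilt_measurable c_measurable_F U_increment_measurable increment_measurable_F measurable_F_mono[OF Z])
  have ZN: "(\<lambda>\<omega>. Z \<omega> * indicator {k} (?N \<omega>)) \<in> borel_measurable Q"
    by (rule measurable_F_Q[of _ t]) (use bounds in \<open>auto\<close>)
  have Zp: "(\<lambda>\<omega>. Z \<omega> * ennreal (poisson_weight (c \<omega> * ?a \<omega>) k)) \<in> borel_measurable Q"
    by (rule measurable_F_Q[of _ s]) (use bounds in \<open>auto\<close>)
  let ?e = "\<lambda>\<omega>. c \<omega> ^ k * exp (- ((c \<omega> - 1) * ?a \<omega>))"
  have "(\<integral>\<^sup>+\<omega>. Z \<omega> * indicator {k} (?N \<omega>) \<partial>tilted) =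
      (\<integral>\<^sup>+\<omega>. (Z \<omega> * ennreal (tilt c s0 s \<omega>) * ennreal (?e \<omega>) * indicator {k} (?N \<omega>)) * ennreal (tilt c t t0 \<omega>) \<partial>Q)"
  proof (subst nn_integral_tilted[OF ZN], intro nn_integral_cong)
    fix \<omega> assume "\<omega> \<in> space Q"
    then have \<omega>: "\<omega> \<in> space M" by (simp add: space_Q)
    have "tilt c s0 t0 \<omega> = tilt c s0 s \<omega> * (tilt c s t \<omega> * tilt c t t0 \<omega>)"
      using \<omega> st s0t0 by (subst tilt_mult[of \<omega> s0 s t0]) (auto intro!: tilt_mult)
    then have "ennreal (tilt c s0 t0 \<omega>) =
        ennreal (tilt c s0 s \<omega>) * (ennreal (tilt c s t \<omega>) * ennreal (tilt c t t0 \<omega>))"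
      by (simp add: ennreal_mult tilt_nonneg c_nonneg)
    moreover have "tilt c s t \<omega> = ?e \<omega>" if "?N \<omega> = k" using that by (simp add: tilt_def)
    ultimately show "Z \<omega> * indicator {k} (?N \<omega>) * ennreal (tilt c s0 t0 \<omega>) =
        (Z \<omega> * ennreal (tilt c s0 s \<omega>) * ennreal (?e \<omega>) * indicator {k} (?N \<omega>)) * ennreal (tilt c t t0 \<omega>)"
      by (cases "?N \<omega> = k") (auto simp: ac_simps)
  qed
  also have "\<dots> = (\<integral>\<^sup>+\<omega>. Z \<omega> * ennreal (tilt c s0 s \<omega>) * ennreal (?e \<omega>) * indicator {k} (?N \<omega>) \<partial>Q)"
    using st s0t0 bounds by (intro nn_integral_tilt) auto
  also have "\<dots> = (\<integral>\<^sup>+\<omega>. Z \<omega> * ennreal (tilt c s0 s \<omega>) * ennreal (?e \<omega>) * ennreal (poisson_weight (?a \<omega>) k) \<partial>Q)"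
    using st s0t0 bounds by (intro cond_poissonD[OF cox]) auto
  also have "\<dots> = (\<integral>\<^sup>+\<omega>. Z \<omega> * ennreal (tilt c s0 s \<omega>) * ennreal (poisson_weight (c \<omega> * ?a \<omega>) k) \<partial>Q)"
  proof (intro nn_integral_cong)
    fix \<omega> assume "\<omega> \<in> space Q"
    then have "0 \<le> ?a \<omega>" using U_mono[of \<omega> s t] st bounds by (simp add: space_Q)
    moreover have "?e \<omega> * poisson_weight (?a \<omega>) k = poisson_weight (c \<omega> * ?a \<omega>) k"
    proof -
      have "exp (- ((c \<omega> - 1) * ?a \<omega>)) * exp (- ?a \<omega>) = exp (- (c \<omega> * ?a \<omega>))"
        unfolding exp_add[symmetric] by (simp add: algebra_simps)
      then show ?thesis by (simp add: poisson_weight_def power_mult_distrib)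
    qed
    ultimately have "ennreal (?e \<omega>) * ennreal (poisson_weight (?a \<omega>) k) = ennreal (poisson_weight (c \<omega> * ?a \<omega>) k)"
      by (simp add: ennreal_mult[symmetric] poisson_weight_nonneg c_nonneg)
    then show "Z \<omega> * ennreal (tilt c s0 s \<omega>) * ennreal (?e \<omega>) * ennreal (poisson_weight (?a \<omega>) k) =
       Z \<omega> * ennreal (tilt c s0 s \<omega>) * ennreal (poisson_weight (c \<omega> * ?a \<omega>) k)"
      by (simp add: mult.assoc)
  qed
  also have "\<dots> = (\<integral>\<^sup>+\<omega>. (Z \<omega> * ennreal (tilt c s0 s \<omega>) * ennreal (poisson_weight (c \<omega> * ?a \<omega>) k)) * ennreal (tilt c s t0 \<omega>) \<partial>Q)"
    using st s0t0 bounds by (intro nn_integral_tilt[symmetric]) auto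
  also have "\<dots> = (\<integral>\<^sup>+\<omega>. Z \<omega> * ennreal (poisson_weight (c \<omega> * ?a \<omega>) k) \<partial>tilted)"
  proof (subst nn_integral_tilted[OF Zp], intro nn_integral_cong)
    fix \<omega> assume "\<omega> \<in> space Q"
    then have "tilt c s0 t0 \<omega> = tilt c s0 s \<omega> * tilt c s t0 \<omega>"
      using st s0t0 by (intro tilt_mult) (auto simp: space_Q)
    then show "(Z \<omega> * ennreal (tilt c s0 s \<omega>) * ennreal (poisson_weight (c \<omega> * ?a \<omega>) k)) * ennreal (tilt c s t0 \<omega>) =
        Z \<omega> * ennreal (poisson_weight (c \<omega> * ?a \<omega>) k) * ennreal (tilt c s0 t0 \<omega>)"
      by (simp add: ennreal_mult tilt_nonneg c_nonneg ac_simps)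
  qed
  finally show "(\<integral>\<^sup>+\<omega>. Z \<omega> * indicator {k} (?N \<omega>) \<partial>tilted) =
      (\<integral>\<^sup>+\<omega>. Z \<omega> * ennreal (poisson_weight (c \<omega> * ?a \<omega>) k) \<partial>tilted)" .
qed

lemma tilted_clock_measurable:
  "t \<in> {0..T} \<Longrightarrow> tilted_clock c s0 t0 t \<in> borel_measurable (F 0)"
proof -
  assume "t \<in> {0..T}"
  then have [measurable]: "U t \<in> borel_measurable (F 0)" "U (min t t0) \<in> borel_measurable (F 0)"
     "U (min t s0) \<in> borel_measurable (F 0)"
    using s0t0 by (auto intro!: U_measurable)
  note c_measurable[measurable]
  show ?thesis unfolding tilted_clock_def by measurable
qed

lemma tilted_clock_increment:
  shows "t \<le> s0 \<Longrightarrow> s \<le> t \<Longrightarrow> tilted_clock c s0 t0 t \<omega> - tilted_clock c s0 t0 s \<omega> = U t \<omega> - U s \<omega>"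
    and "t0 \<le> s \<Longrightarrow> s \<le> t \<Longrightarrow> tilted_clock c s0 t0 t \<omega> - tilted_clock c s0 t0 s \<omega> = U t \<omega> - U s \<omega>"
    and "s0 \<le> s \<Longrightarrow> s \<le> t \<Longrightarrow> t \<le> t0 \<Longrightarrow> tilted_clock c s0 t0 t \<omega> - tilted_clock c s0 t0 s \<omega> = c \<omega> * (U t \<omega> - U s \<omega>)"
proof -
  show "t \<le> s0 \<Longrightarrow> s \<le> t \<Longrightarrow> tilted_clock c s0 t0 t \<omega> - tilted_clock c s0 t0 s \<omega> = U t \<omega> - U s \<omega>"
    and "t0 \<le> s \<Longrightarrow> s \<le> t \<Longrightarrow> tilted_clock c s0 t0 t \<omega> - tilted_clock c s0 t0 s \<omega> = U t \<omega> - U s \<omega>"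
    using s0t0 by (auto simp: tilted_clock_def min_absorb1 min_absorb2)
  assume "s0 \<le> s" "s \<le> t" "t \<le> t0"
  then have "min t s0 = s0" "min s s0 = s0" "min t t0 = t" "min s t0 = s" by auto
  then show "tilted_clock c s0 t0 t \<omega> - tilted_clock c s0 t0 s \<omega> = c \<omega> * (U t \<omega> - U s \<omega>)"
    by (simp add: tilted_clock_def algebra_simps)
qed

lemma tilted_clock_mono:
  assumes \<omega>: "\<omega> \<in> space M" and st: "0 \<le> s" "s \<le> t" "t \<le> T"
  shows "tilted_clock c s0 t0 s \<omega> \<le> tilted_clock c s0 t0 t \<omega>"
proof -
  have pos: "0 \<le> tilted_clock c s0 t0 t \<omega> - tilted_clock c s0 t0 s \<omega>"
    if "0 \<le> s" "s \<le> t" "t \<le> T" "t \<le> s0 \<or> t0 \<le> s \<or> (s0 \<le> s \<and> t \<le> t0)" for s t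
    using that(4)
  proof (elim disjE conjE)
    assume "t \<le> s0"
    then show ?thesis using tilted_clock_increment(1)[of t s] U_mono[OF \<omega>, of s t] that by simp
  next
    assume "t0 \<le> s"
    then show ?thesis using tilted_clock_increment(2)[of s t] U_mono[OF \<omega>, of s t] that by simp
  next
    assume "s0 \<le> s" "t \<le> t0"
    then show ?thesis using tilted_clock_increment(3)[of s t] U_mono[OF \<omega>, of s t] that c_nonneg[of \<omega>] by simp
  qed
  define p where "p = max s (min t s0)"
  define q where "q = max s (min t t0)"
  have "s \<le> p" "p \<le> q" "q \<le> t" using st s0t0 by (auto simp: p_def q_def)
  moreover have "p \<le> s0 \<or> s = p" "(s0 \<le> p \<and> q \<le> t0) \<or> p = q" "t0 \<le> q \<or> q = t"
    using st s0t0 by (auto simp: p_def q_def)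
  ultimately show ?thesis using pos[of s p] pos[of p q] pos[of q t] st by auto
qed

text \<open>
  An arbitrary interval is cut at \<open>s0\<close> and \<open>t0\<close> into at most three pieces of the kinds above.
\<close>

lemma cond_poisson_tilted:
  assumes st: "0 \<le> s" "s \<le> t" "t \<le> T"
  shows "cond_poisson tilted (F s) (\<lambda>\<omega>. X t \<omega> - X s \<omega>) (\<lambda>\<omega>. tilted_clock c s0 t0 t \<omega> - tilted_clock c s0 t0 s \<omega>)"
proof -
  let ?V = "tilted_clock c s0 t0"
  have sub: "subalgebra tilted (F r)" if "0 \<le> r" "r \<le> T" for r
    using subalgebra_Q[of r] that by (simp add: subalgebra_def)
  have piece: "cond_poisson tilted (F s) (\<lambda>\<omega>. X t \<omega> - X s \<omega>) (\<lambda>\<omega>. ?V t \<omega> - ?V s \<omega>)"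
    if "0 \<le> s" "s \<le> t" "t \<le> T" "t \<le> s0 \<or> t0 \<le> s \<or> (s0 \<le> s \<and> t \<le> t0) \<or> s = t" for s t
  proof -
    consider "t \<le> s0" | "t0 \<le> s" | "s0 \<le> s" "t \<le> t0" | "s = t" using \<open>t \<le> s0 \<or> _\<close> by auto
    then show ?thesis
    proof cases
      case 1
      with that show ?thesis using cond_poisson_tilted_before[of s t]
        by (subst cond_poisson_cong[OF refl tilted_clock_increment(1)]) (auto simp: space_Q)
    next
      case 2
      with that show ?thesis using cond_poisson_tilted_after[of s t]
        by (subst cond_poisson_cong[OF refl tilted_clock_increment(2)]) (auto simp: space_Q)
    next
      case 3
      with that show ?thesis using cond_poisson_tilted_inside[of s t]
        by (subst cond_poisson_cong[OF refl tilted_clock_increment(3)]) (auto simp: space_Q)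
    next
      case 4
      then show ?thesis by (auto intro: cond_poisson_zero)
    qed
  qed
  have paste: "cond_poisson tilted (F s) (\<lambda>\<omega>. X t \<omega> - X s \<omega>) (\<lambda>\<omega>. ?V t \<omega> - ?V s \<omega>)"
    if "0 \<le> s" "s \<le> m" "m \<le> t" "t \<le> T"
      and "cond_poisson tilted (F s) (\<lambda>\<omega>. X m \<omega> - X s \<omega>) (\<lambda>\<omega>. ?V m \<omega> - ?V s \<omega>)"
      and "cond_poisson tilted (F m) (\<lambda>\<omega>. X t \<omega> - X m \<omega>) (\<lambda>\<omega>. ?V t \<omega> - ?V m \<omega>)" for s m t
  proof -
    have V: "(\<lambda>\<omega>. ?V q \<omega> - ?V p \<omega>) \<in> borel_measurable (F s)" if "p \<in> {0..T}" "q \<in> {0..T}" for p q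
      using that \<open>0 \<le> s\<close> \<open>s \<le> m\<close> \<open>m \<le> t\<close> \<open>t \<le> T\<close>
      by (intro measurable_F_mono[of _ 0 _ s] borel_measurable_diff tilted_clock_measurable) auto
    \<comment> \<open>Monotonicity of \<open>X\<close> makes the truncated differences add up.\<close>
    have "cond_poisson tilted (F s) (\<lambda>\<omega>. (X m \<omega> - X s \<omega>) + (X t \<omega> - X m \<omega>))
      (\<lambda>\<omega>. (?V m \<omega> - ?V s \<omega>) + (?V t \<omega> - ?V m \<omega>))"
    proof (rule cond_poisson_paste[OF that(5,6)])
      show "(\<lambda>\<omega>. X t \<omega> - X m \<omega>) \<in> measurable tilted (count_space UNIV)"
        using that by (simp add: measurable_F_Q[OF increment_measurable_F[of m t t]])
    qed (use that in \<open>auto intro!: sub subalgebra_F_F increment_measurable_F V tilted_clock_mono simp: space_Q\<close>)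
    also have "?this \<longleftrightarrow> ?thesis"
      using that X_mono[of _ s m] X_mono[of _ m t] by (intro cond_poisson_cong) (auto simp: space_Q)
    finally show ?thesis .
  qed
  define p where "p = max s (min t s0)"
  define q where "q = max s (min t t0)"
  have pq: "s \<le> p" "p \<le> q" "q \<le> t" using st s0t0 by (auto simp: p_def q_def)
  have cases: "p \<le> s0 \<or> s = p" "(s0 \<le> p \<and> q \<le> t0) \<or> p = q" "t0 \<le> q \<or> q = t"
    using st s0t0 by (auto simp: p_def q_def)
  have "cond_poisson tilted (F p) (\<lambda>\<omega>. X t \<omega> - X p \<omega>) (\<lambda>\<omega>. ?V t \<omega> - ?V p \<omega>)"
    using pq cases st by (intro paste[of p q t] piece) auto
  from paste[OF _ _ _ _ piece this, of s] show ?thesis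
    using pq cases st by auto
qed

end
end
end

section \<open>Tilting a parameter\<close>

context poisson_model
begin

lemma cox_process_iff_cond_poisson:
  assumes Q: "prob_space Q" and sets: "sets Q = sets M"
    and V: "\<And>t. t \<in> {0..T} \<Longrightarrow> V t \<in> borel_measurable (F 0)"
    and V_mono: "\<And>s t \<omega>. \<omega> \<in> space M \<Longrightarrow> 0 \<le> s \<Longrightarrow> s \<le> t \<Longrightarrow> t \<le> T \<Longrightarrow> V s \<omega> \<le> V t \<omega>"
    and V_int: "\<And>s t \<omega>. \<omega> \<in> space M \<Longrightarrow> 0 \<le> s \<Longrightarrow> s \<le> t \<Longrightarrow> t \<le> T \<Longrightarrow>
      (LINT r:{s..t}|lborel. v r \<omega>) = V t \<omega> - V s \<omega>"
  shows "cox_process Q T F X v \<longleftrightarrow> (\<forall>s t. 0 \<le> s \<and> s < t \<and> t \<le> T \<longrightarrow>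
      cond_poisson Q (F s) (\<lambda>\<omega>. X t \<omega> - X s \<omega>) (\<lambda>\<omega>. V t \<omega> - V s \<omega>))"
proof -
  have space: "space Q = space M" by (rule sets_eq_imp_space_eq[OF sets])
  have "cond_poisson Q (F s) (\<lambda>\<omega>. X t \<omega> - X s \<omega>) (\<lambda>\<omega>. V t \<omega> - V s \<omega>) \<longleftrightarrow>
     (\<forall>k. AE \<omega> in Q. real_cond_exp Q (F s) (indicator {\<omega>\<in>space Q. X t \<omega> - X s \<omega> = k}) \<omega> =
           (LINT r:{s..t}|lborel. v r \<omega>) ^ k / fact k * exp (- (LINT r:{s..t}|lborel. v r \<omega>)))"
    if st: "0 \<le> s" "s < t" "t \<le> T" for s t
  proof -
    have "subalgebra Q (F s)" using subalgebra_F[of s] st by (simp add: subalgebra_def sets space)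
    moreover have "(\<lambda>\<omega>. X t \<omega> - X s \<omega>) \<in> measurable Q (count_space UNIV)"
      using measurable_F_M[OF increment_measurable_F[of s t t]] st
      by (simp add: measurable_cong_sets[OF sets refl])
    moreover have "(\<lambda>\<omega>. V t \<omega> - V s \<omega>) \<in> borel_measurable (F s)"
      using st by (intro measurable_F_mono[of _ 0 _ s] borel_measurable_diff V) auto
    moreover have "0 \<le> V t \<omega> - V s \<omega>" if "\<omega> \<in> space Q" for \<omega>
      using V_mono[of \<omega> s t] st that by (simp add: space)
    ultimately have "cond_poisson Q (F s) (\<lambda>\<omega>. X t \<omega> - X s \<omega>) (\<lambda>\<omega>. V t \<omega> - V s \<omega>) \<longleftrightarrow>
      (\<forall>k. AE \<omega> in Q. real_cond_exp Q (F s) (indicator {\<omega>\<in>space Q. X t \<omega> - X s \<omega> = k}) \<omega> =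
        poisson_weight (V t \<omega> - V s \<omega>) k)"
      by (intro cond_poisson_iff_cond_exp[OF Q])
    also have "\<dots> \<longleftrightarrow> (\<forall>k. AE \<omega> in Q. real_cond_exp Q (F s) (indicator {\<omega>\<in>space Q. X t \<omega> - X s \<omega> = k}) \<omega> =
           (LINT r:{s..t}|lborel. v r \<omega>) ^ k / fact k * exp (- (LINT r:{s..t}|lborel. v r \<omega>)))"
      using st by (intro arg_cong[where f=All] ext AE_cong)
        (simp add: poisson_weight_def V_int space)
    finally show ?thesis .
  qed
  then show ?thesis unfolding cox_process_def by blast
qed

end

locale girsanov_model = poisson_model M T F X
  for M :: "'a measure" and T F X +
  fixes u v :: "real \<Rightarrow> 'a \<Rightarrow> real"
  assumes uv: "(u, v) \<in> Theta M T F X"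
begin

abbreviation P :: "'a measure" where "P \<equiv> girsanov_measure M T X v"

lemma u_measurable: "t \<in> {0..T} \<Longrightarrow> u t \<in> borel_measurable (F 0)"
  and v_measurable: "case_prod v \<in> borel_measurable (restrict_space borel {0..T} \<Otimes>\<^sub>M F 0)"
  and v_integrable: "\<omega> \<in> space M \<Longrightarrow> set_integrable lborel {0..T} (\<lambda>s. v s \<omega>)"
  and u_eq: "\<omega> \<in> space M \<Longrightarrow> t \<in> {0..T} \<Longrightarrow> u t \<omega> = (LINT s:{0..t}|lborel. v s \<omega>)"
  and u_strict_mono: "\<omega> \<in> space M \<Longrightarrow> strict_mono_on {0..T} (\<lambda>t. u t \<omega>)"
  and prob_space_P: "prob_space P"
  and cox_P: "cox_process P T F X v"
  and u_integrable_M: "t \<in> {0..T} \<Longrightarrow> integrable M (u t)"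
  using uv by (auto simp: Theta_def)

lemma u_less: "\<omega> \<in> space M \<Longrightarrow> 0 \<le> s \<Longrightarrow> s < t \<Longrightarrow> t \<le> T \<Longrightarrow> u s \<omega> < u t \<omega>"
  using u_strict_mono[of \<omega>] by (auto simp: strict_mono_on_def)

lemma u_le: "\<omega> \<in> space M \<Longrightarrow> 0 \<le> s \<Longrightarrow> s \<le> t \<Longrightarrow> t \<le> T \<Longrightarrow> u s \<omega> \<le> u t \<omega>"
  using u_less[of \<omega> s t] by (cases "s = t") auto

lemma u_0: "\<omega> \<in> space M \<Longrightarrow> u 0 \<omega> = 0"
proof -
  assume "\<omega> \<in> space M"
  then have "u 0 \<omega> = (LINT s:{0..0}|lborel. v s \<omega>)" using T_pos by (intro u_eq) auto
  also have "\<dots> = (LINT s:{0<..0}|lborel. v s \<omega>)"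
    using set_integral_Icc_diff[of T "\<lambda>s. v s \<omega>" 0 0] set_integral_Ioc_diff[of T "\<lambda>s. v s \<omega>" 0 0]
      v_integrable[OF \<open>\<omega> \<in> space M\<close>] T_pos by simp
  finally show ?thesis by (simp add: set_lebesgue_integral_def)
qed

lemma v_integral: "\<omega> \<in> space M \<Longrightarrow> 0 \<le> s \<Longrightarrow> s \<le> t \<Longrightarrow> t \<le> T \<Longrightarrow>
    (LINT r:{s..t}|lborel. v r \<omega>) = u t \<omega> - u s \<omega>"
  using set_integral_Icc_diff[OF v_integrable, of \<omega> s t] by (simp add: u_eq)

sublocale cox_model M T F X "girsanov_measure M T X v" u
proof (intro cox_model.intro cox_model_axioms.intro)
  have sets: "sets P = sets M" by (simp add: girsanov_measure_def)
  show "poisson_model M T F X" by (rule poisson_model_axioms)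
  show "prob_space P" by (rule prob_space_P)
  show "sets P = sets M" by (rule sets)
  show "cond_poisson P (F s) (\<lambda>\<omega>. X t \<omega> - X s \<omega>) (\<lambda>\<omega>. u t \<omega> - u s \<omega>)"
    if "0 \<le> s" "s < t" "t \<le> T" for s t
    using cox_process_iff_cond_poisson[OF prob_space_P sets u_measurable u_le v_integral] cox_P that
    by blast
qed (auto intro: u_measurable u_le)

lemma girsanov_measurable [measurable]: "girsanov_density T X v \<in> borel_measurable M"
  by (rule girsanov_density_measurable[OF v_measurable])

lemma integral_density_exponent:
  assumes f: "set_integrable lborel {0..T} f"
  shows "(LINT s:{0..T}|lborel. (f s - 1 :: real)) = (LINT s:{0..T}|lborel. f s) - T"
proof -
  have "set_integrable lborel {0..T} (\<lambda>s. 1::real)"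
    unfolding set_integrable_def by (intro integrable_scaleR_left integrable_real_indicator) (auto simp: emeasure_lborel_Icc_eq)
  then have "(LINT s:{0..T}|lborel. (f s - 1 :: real)) = (LINT s:{0..T}|lborel. f s) - (LINT s:{0..T}|lborel. 1)"
    by (rule set_integral_diff(2)[OF f])
  then show ?thesis using T_pos by (simp add: set_lebesgue_integral_def)
qed

text \<open>
  Girsanov's change of measure does not alter what is known at time 0. On the event of no jump
  the density is \<open>exp (T - u\<^sub>T)\<close>. Computing the integral of a variable known at time 0 over this
  event, once with the Poisson and once with the Cox property, shows that \<open>P\<close> and \<open>M\<close> agree after
  multiplication by \<open>exp (- u\<^sub>T)\<close>, which is positive.
\<close>

lemma nn_integral_P_F0:
  assumes Z: "Z \<in> borel_measurable (F 0)"
  shows "(\<integral>\<^sup>+\<omega>. Z \<omega> \<partial>P) = (\<integral>\<^sup>+\<omega>. Z \<omega> \<partial>M)"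
proof -
  have T: "0 \<in> {0..T}" "T \<in> {0..T}" using T_pos by auto
  note [measurable] = u_measurable[OF T(1)] u_measurable[OF T(2)] Z
  define Y where "Y \<omega> = Z \<omega> * ennreal (exp (u T \<omega>))" for \<omega>
  have Y[measurable]: "Y \<in> borel_measurable (F 0)" unfolding Y_def by measurable
  have YM[measurable]: "Y \<in> borel_measurable M" by (rule measurable_F_M[OF Y T(1)])
  have [measurable]: "X T \<in> measurable M (count_space UNIV)" "X 0 \<in> measurable M (count_space UNIV)"
    using X_measurable T by auto
  have "(\<integral>\<^sup>+\<omega>. Z \<omega> \<partial>P) = (\<integral>\<^sup>+\<omega>. Y \<omega> * ennreal (poisson_weight (u T \<omega> - u 0 \<omega>) 0) \<partial>P)"
    by (intro nn_integral_cong)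
      (simp add: Y_def poisson_weight_def u_0 space_Q mult.assoc ennreal_mult[symmetric] exp_add[symmetric])
  also have "\<dots> = (\<integral>\<^sup>+\<omega>. Y \<omega> * indicator {0} (X T \<omega> - X 0 \<omega>) \<partial>P)"
    using T_pos by (intro cond_poissonD[OF cox, symmetric]) auto
  also have "\<dots> = (\<integral>\<^sup>+\<omega>. ennreal (girsanov_density T X v \<omega>) * (Y \<omega> * indicator {0} (X T \<omega> - X 0 \<omega>)) \<partial>M)"
    unfolding girsanov_measure_def by (rule nn_integral_density) measurable
  also have "\<dots> = (\<integral>\<^sup>+\<omega>. (Y \<omega> * ennreal (exp (T - u T \<omega>))) * indicator {0} (X T \<omega> - X 0 \<omega>) \<partial>M)"
  proof (intro nn_integral_cong)
    fix \<omega> assume \<omega>: "\<omega> \<in> space M"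
    have "girsanov_density T X v \<omega> = exp (T - u T \<omega>)" if "X T \<omega> - X 0 \<omega> = 0"
      using that \<omega> integral_density_exponent[OF v_integrable[OF \<omega>]] u_eq[OF \<omega> T(2)]
      by (simp add: girsanov_density_def X_0)
    then show "ennreal (girsanov_density T X v \<omega>) * (Y \<omega> * indicator {0} (X T \<omega> - X 0 \<omega>)) =
       (Y \<omega> * ennreal (exp (T - u T \<omega>))) * indicator {0} (X T \<omega> - X 0 \<omega>)"
      by (cases "X T \<omega> - X 0 \<omega> = 0") (auto simp: mult.commute)
  qed
  also have "\<dots> = (\<integral>\<^sup>+\<omega>. (Y \<omega> * ennreal (exp (T - u T \<omega>))) * ennreal (poisson_weight (T - 0) 0) \<partial>M)"
    using T_pos by (intro cond_poissonD[OF cond_poisson_M]) auto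
  also have "\<dots> = (\<integral>\<^sup>+\<omega>. Z \<omega> \<partial>M)"
    by (intro nn_integral_cong)
      (simp add: Y_def poisson_weight_def mult.assoc ennreal_mult[symmetric] exp_add[symmetric])
  finally show ?thesis .
qed

lemma P_integral_F0:
  fixes Z :: "'a \<Rightarrow> real"
  assumes Z: "Z \<in> borel_measurable (F 0)"
  shows "integrable P Z \<longleftrightarrow> integrable M Z" and "(LINT \<omega>|P. Z \<omega>) = (LINT \<omega>|M. Z \<omega>)"
proof -
  have ZM: "Z \<in> borel_measurable M" using measurable_F_M[OF Z] T_pos by auto
  note [measurable] = Z
  have sub: "subalgebra P (F 0)" "subalgebra M (F 0)" using subalgebra_F subalgebra_Q T_pos by auto
  have "(\<integral>\<^sup>+\<omega>. ennreal (norm (Z \<omega>)) \<partial>P) = (\<integral>\<^sup>+\<omega>. ennreal (norm (Z \<omega>)) \<partial>M)"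
    by (rule nn_integral_P_F0) measurable
  then show "integrable P Z \<longleftrightarrow> integrable M Z"
    using ZM by (simp add: integrable_iff_bounded measurable_Q)
  have "restr_to_subalg P (F 0) = restr_to_subalg M (F 0)"
  proof (rule measure_eqI)
    fix A assume "A \<in> sets (restr_to_subalg P (F 0))"
    then have A: "A \<in> sets (F 0)" by (simp add: sets_restr_to_subalg[OF sub(1)])
    have AM: "A \<in> sets M" using A sub(2) by (auto simp: subalgebra_def)
    have "(\<integral>\<^sup>+\<omega>. indicator A \<omega> \<partial>P) = (\<integral>\<^sup>+\<omega>. indicator A \<omega> \<partial>M)"
      using A by (intro nn_integral_P_F0) simp
    then have "emeasure P A = emeasure M A"
      using AM by (simp add: sets_Q)
    then show "emeasure (restr_to_subalg P (F 0)) A = emeasure (restr_to_subalg M (F 0)) A"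
      by (simp add: emeasure_restr_to_subalg[OF sub(1) A] emeasure_restr_to_subalg[OF sub(2) A])
  qed (simp add: sets_restr_to_subalg[OF sub(1)] sets_restr_to_subalg[OF sub(2)])
  then show "(LINT \<omega>|P. Z \<omega>) = (LINT \<omega>|M. Z \<omega>)"
    using integral_subalgebra2[OF sub(1) Z] integral_subalgebra2[OF sub(2) Z] by metis
qed

context
  fixes c :: "'a \<Rightarrow> real" and C s0 t0 :: real
  assumes c[measurable]: "c \<in> borel_measurable (F 0)"
    and c_ge_1: "\<And>\<omega>. 1 \<le> c \<omega>" and c_le: "\<And>\<omega>. c \<omega> \<le> C"
    and st0: "0 \<le> s0" "s0 \<le> t0" "t0 \<le> T"
begin

definition tilted_rate :: "real \<Rightarrow> 'a \<Rightarrow> real" where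
  "tilted_rate r \<omega> = v r \<omega> * (if r \<in> {s0<..t0} then c \<omega> else 1)"

lemma c_nonneg': "0 \<le> c \<omega>"
  using c_ge_1[of \<omega>] by simp

lemma tilted_rate_integral:
  assumes \<omega>: "\<omega> \<in> space M"
  shows "set_integrable lborel {0..T} (\<lambda>r. tilted_rate r \<omega>)"
    and "t \<in> {0..T} \<Longrightarrow> (LINT r:{0..t}|lborel. tilted_rate r \<omega>) = tilted_clock c s0 t0 t \<omega>"
proof -
  have eq: "tilted_rate r \<omega> = v r \<omega> + (c \<omega> - 1) * (indicator {s0<..t0} r * v r \<omega>)" for r
    by (auto simp: tilted_rate_def indicator_def algebra_simps)
  have int2: "set_integrable lborel {0..T} (\<lambda>r. indicator {s0<..t0} r * v r \<omega>)"
    using integrable_mult_indicator[of "{s0<..t0}" lborel, OF _ v_integrable[OF \<omega>, unfolded set_integrable_def]]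
    by (simp add: set_integrable_def mult.left_commute)
  show "set_integrable lborel {0..T} (\<lambda>r. tilted_rate r \<omega>)"
    unfolding eq using v_integrable[OF \<omega>] int2 by (intro set_integral_add set_integrable_mult_right) auto
  assume t: "t \<in> {0..T}"
  have sub: "set_integrable lborel {0..t} f" if "set_integrable lborel {0..T} f" for f :: "real \<Rightarrow> real"
    using t by (intro set_integrable_subset[OF that]) auto
  have ind: "(LINT r:{0..t}|lborel. indicator {s0<..t0} r * v r \<omega>) = u (min t t0) \<omega> - u (min t s0) \<omega>"
  proof -
    have "(LINT r:{0..t}|lborel. indicator {s0<..t0} r * v r \<omega>) = (LINT r:{min t s0<..min t t0}|lborel. v r \<omega>)"
      unfolding set_lebesgue_integral_def using st0
      by (intro Bochner_Integration.integral_cong) (auto simp: indicator_def)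
    also have "\<dots> = u (min t t0) \<omega> - u (min t s0) \<omega>"
      using st0 t by (subst set_integral_Ioc_diff[OF v_integrable[OF \<omega>]]) (auto simp: u_eq \<omega>)
    finally show ?thesis .
  qed
  have "(LINT r:{0..t}|lborel. tilted_rate r \<omega>) = (LINT r:{0..t}|lborel. v r \<omega>) +
      (LINT r:{0..t}|lborel. (c \<omega> - 1) * (indicator {s0<..t0} r * v r \<omega>))"
    unfolding eq using sub[OF v_integrable[OF \<omega>]] sub[OF int2]
    by (intro set_integral_add set_integrable_mult_right) auto
  then show "(LINT r:{0..t}|lborel. tilted_rate r \<omega>) = tilted_clock c s0 t0 t \<omega>"
    by (simp add: ind u_eq[OF \<omega> t, symmetric] tilted_clock_def)
qed

text \<open>
  The product over the jumps contributes \<open>c ^ N\<close> and the exponential \<open>exp (- (c - 1) a)\<close>.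
\<close>

lemma girsanov_density_tilted:
  assumes \<omega>: "\<omega> \<in> space M"
  shows "girsanov_density T X tilted_rate \<omega> = girsanov_density T X v \<omega> * tilt c s0 t0 \<omega>"
proof -
  have T: "T \<in> {0..T}" using T_pos by auto
  have "(\<Prod>k=1..X T \<omega>. tilted_rate (jump_time T X k \<omega>) \<omega>) =
      (\<Prod>k=1..X T \<omega>. v (jump_time T X k \<omega>) \<omega>) * c \<omega> ^ (X t0 \<omega> - X s0 \<omega>)"
    unfolding tilted_rate_def prod.distrib prod_jump_times_power[OF \<omega> st0] ..
  moreover have "exp (- (LINT s:{0..T}|lborel. (tilted_rate s \<omega> - 1))) =
      exp (- (LINT s:{0..T}|lborel. (v s \<omega> - 1))) * exp (- ((c \<omega> - 1) * (u t0 \<omega> - u s0 \<omega>)))"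
    using st0 integral_density_exponent[OF v_integrable[OF \<omega>]] tilted_rate_integral(2)[OF \<omega> T]
      integral_density_exponent[OF tilted_rate_integral(1)[OF \<omega>]] u_eq[OF \<omega> T]
    by (simp add: exp_add[symmetric] tilted_clock_def)
  ultimately show ?thesis by (simp add: girsanov_density_def tilt_def)
qed

lemma girsanov_measure_tilted:
  "girsanov_measure M T X tilted_rate = density P (\<lambda>\<omega>. ennreal (tilt c s0 t0 \<omega>))"
proof -
  have [measurable]: "tilt c s0 t0 \<in> borel_measurable M"
    by (rule tilt_measurable_M[OF c c_nonneg' st0])
  have "density P (\<lambda>\<omega>. ennreal (tilt c s0 t0 \<omega>)) =
      density M (\<lambda>\<omega>. ennreal (girsanov_density T X v \<omega>) * ennreal (tilt c s0 t0 \<omega>))"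
    unfolding girsanov_measure_def by (rule density_density_eq) measurable
  also have "\<dots> = girsanov_measure M T X tilted_rate"
    unfolding girsanov_measure_def
  proof (rule density_cong)
    have "AE \<omega> in M. ennreal (girsanov_density T X v \<omega>) * ennreal (tilt c s0 t0 \<omega>) =
        ennreal (girsanov_density T X tilted_rate \<omega>)"
      by (intro AE_I2) (simp add: girsanov_density_tilted ennreal_mult'' tilt_nonneg c_nonneg')
    then show "AE \<omega> in M. ennreal (girsanov_density T X v \<omega>) * ennreal (tilt c s0 t0 \<omega>) =
        ennreal (girsanov_density T X tilted_rate \<omega>)" .
    have "(\<lambda>\<omega>. girsanov_density T X v \<omega> * tilt c s0 t0 \<omega>) \<in> borel_measurable M" by measurable
    then have "girsanov_density T X tilted_rate \<in> borel_measurable M"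
      by (subst measurable_cong[OF girsanov_density_tilted]) auto
    then show "(\<lambda>\<omega>. ennreal (girsanov_density T X tilted_rate \<omega>)) \<in> borel_measurable M" by measurable
  qed measurable
  finally show ?thesis ..
qed

text \<open>
  The lower bound \<open>c \<ge> 1\<close> keeps the clock strictly increasing and the upper bound keeps it
  integrable.
\<close>

lemma tilted_in_Theta: "(tilted_clock c s0 t0, tilted_rate) \<in> Theta M T F X"
proof -
  note tc = c c_nonneg' st0
  have [measurable]: "t \<in> {0..T} \<Longrightarrow> tilted_clock c s0 t0 t \<in> borel_measurable (F 0)" for t
    by (rule tilted_clock_measurable[OF tc])
  have rate_meas: "case_prod tilted_rate \<in> borel_measurable (restrict_space borel {0..T} \<Otimes>\<^sub>M F 0)"
  proof -
    have [measurable]: "(\<lambda>p. v (fst p) (snd p)) \<in> borel_measurable (restrict_space borel {0..T} \<Otimes>\<^sub>M F 0)"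
      using v_measurable by (simp add: case_prod_beta')
    have [measurable]: "(\<lambda>r. indicator {s0<..t0} r :: real) \<in> borel_measurable (restrict_space borel {0..T})"
      by (intro measurable_restrict_space1) simp
    have "(\<lambda>p. v (fst p) (snd p) * (1 + (c (snd p) - 1) * indicator {s0<..t0} (fst p)))
        \<in> borel_measurable (restrict_space borel {0..T} \<Otimes>\<^sub>M F 0)"
      by measurable
    also have "(\<lambda>p. v (fst p) (snd p) * (1 + (c (snd p) - 1) * indicator {s0<..t0} (fst p))) = case_prod tilted_rate"
      by (auto simp: tilted_rate_def fun_eq_iff indicator_def)
    finally show ?thesis .
  qed
  have mono: "strict_mono_on {0..T} (\<lambda>t. tilted_clock c s0 t0 t \<omega>)" if \<omega>: "\<omega> \<in> space M" for \<omega>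
  proof (rule strict_mono_onI)
    fix s t assume st: "s \<in> {0..T}" "t \<in> {0..T}" "s < t"
    have "u (min s t0) \<omega> - u (min s s0) \<omega> \<le> u (min t t0) \<omega> - u (min t s0) \<omega>"
    proof -
      consider "t \<le> s0" | "s \<le> s0" "s0 \<le> t" | "s0 \<le> s" by linarith
      then show ?thesis
      proof cases
        case 1
        with st st0 show ?thesis by (simp add: min_absorb1)
      next
        case 2
        with st st0 show ?thesis using u_le[OF \<omega>, of s0 "min t t0"] by (simp add: min_absorb1 min_absorb2)
      next
        case 3
        with st st0 show ?thesis using u_le[OF \<omega>, of "min s t0" "min t t0"]
          by (simp add: min_absorb2)
      qed
    qed
    then have "(c \<omega> - 1) * (u (min s t0) \<omega> - u (min s s0) \<omega>) \<le> (c \<omega> - 1) * (u (min t t0) \<omega> - u (min t s0) \<omega>)"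
      using c_ge_1[of \<omega>] by (intro mult_left_mono) auto
    then show "tilted_clock c s0 t0 s \<omega> < tilted_clock c s0 t0 t \<omega>"
      using u_less[OF \<omega>, of s t] st by (simp add: tilted_clock_def)
  qed
  have prob: "prob_space (girsanov_measure M T X tilted_rate)"
    unfolding girsanov_measure_tilted by (rule prob_space_tilted[OF tc])
  have "(LINT r:{s..t}|lborel. tilted_rate r \<omega>) = tilted_clock c s0 t0 t \<omega> - tilted_clock c s0 t0 s \<omega>"
    if "\<omega> \<in> space M" "0 \<le> s" "s \<le> t" "t \<le> T" for s t \<omega>
    using set_integral_Icc_diff[OF tilted_rate_integral(1), of \<omega> s t] that
    by (simp add: tilted_rate_integral(2))
  then have cox: "cox_process (girsanov_measure M T X tilted_rate) T F X tilted_rate"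
    by (subst cox_process_iff_cond_poisson[OF prob _ tilted_clock_measurable[OF tc] tilted_clock_mono[OF tc]])
      (auto simp: girsanov_measure_tilted sets_Q intro!: cond_poisson_tilted[OF tc])
  have int: "integrable M (tilted_clock c s0 t0 t)" if t: "t \<in> {0..T}" for t
  proof -
    have [measurable]: "c \<in> borel_measurable M" using measurable_F_M[OF c] T_pos by auto
    have "integrable M (\<lambda>\<omega>. u (min t t0) \<omega> - u (min t s0) \<omega>)"
      using t st0 by (intro Bochner_Integration.integrable_diff u_integrable_M) auto
    then have "integrable M (\<lambda>\<omega>. C * (u (min t t0) \<omega> - u (min t s0) \<omega>))"
      by (intro integrable_mult_right)
    then have "integrable M (\<lambda>\<omega>. (c \<omega> - 1) * (u (min t t0) \<omega> - u (min t s0) \<omega>))"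
    proof (rule Bochner_Integration.integrable_bound)
      show "AE \<omega> in M. norm ((c \<omega> - 1) * (u (min t t0) \<omega> - u (min t s0) \<omega>)) \<le>
          norm (C * (u (min t t0) \<omega> - u (min t s0) \<omega>))"
      proof (intro AE_I2)
        fix \<omega>
        have "\<bar>c \<omega> - 1\<bar> \<le> \<bar>C\<bar>" using c_ge_1[of \<omega>] c_le[of \<omega>] by linarith
        then show "norm ((c \<omega> - 1) * (u (min t t0) \<omega> - u (min t s0) \<omega>)) \<le>
          norm (C * (u (min t t0) \<omega> - u (min t s0) \<omega>))"
          by (simp add: abs_mult mult_right_mono)
      qed
    next
      have "u (min t t0) \<in> borel_measurable M" "u (min t s0) \<in> borel_measurable M"
        using t st0 by (auto intro!: borel_measurable_integrable u_integrable_M)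
      then show "(\<lambda>\<omega>. (c \<omega> - 1) * (u (min t t0) \<omega> - u (min t s0) \<omega>)) \<in> borel_measurable M" by measurable
    qed
    then show ?thesis
      unfolding tilted_clock_def using u_integrable_M[OF t] by (intro Bochner_Integration.integrable_add)
  qed
  show ?thesis
    unfolding Theta_def
    using rate_meas mono prob cox int tilted_rate_integral tilted_clock_measurable[OF tc] by auto
qed

end
end

section \<open>The variance of an increment of an unbiased estimator\<close>

lemma integrable_if_nn_integral_eq:
  fixes f g :: "'a \<Rightarrow> real"
  assumes f: "f \<in> borel_measurable Q" "\<And>\<omega>. \<omega> \<in> space Q \<Longrightarrow> 0 \<le> f \<omega>"
    and g: "integrable Q g" "\<And>\<omega>. \<omega> \<in> space Q \<Longrightarrow> 0 \<le> g \<omega>"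
    and eq: "(\<integral>\<^sup>+\<omega>. ennreal (f \<omega>) \<partial>Q) = (\<integral>\<^sup>+\<omega>. ennreal (g \<omega>) \<partial>Q)"
  shows "integrable Q f" and "(LINT \<omega>|Q. f \<omega>) = (LINT \<omega>|Q. g \<omega>)"
proof -
  have g': "(\<integral>\<^sup>+\<omega>. ennreal (g \<omega>) \<partial>Q) = ennreal (LINT \<omega>|Q. g \<omega>)"
    using g by (intro nn_integral_eq_integral) auto
  show "integrable Q f"
    using f(2) by (intro integrableI_nn_integral_finite[OF f(1) AE_I2 eq[unfolded g']])
  show "(LINT \<omega>|Q. f \<omega>) = (LINT \<omega>|Q. g \<omega>)"
    using f g by (subst (1 2) integral_eq_nn_integral) (auto simp: eq)
qed

lemma ennreal_integral_le_nn_integral: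
  fixes f :: "'a \<Rightarrow> real"
  assumes "integrable Q f"
  shows "ennreal (LINT \<omega>|Q. f \<omega>) \<le> (\<integral>\<^sup>+\<omega>. ennreal (f \<omega>) \<partial>Q)"
proof -
  have "(LINT \<omega>|Q. f \<omega>) \<le> enn2real (\<integral>\<^sup>+\<omega>. ennreal (f \<omega>) \<partial>Q)"
    using real_lebesgue_integral_def[OF assms] by simp
  then have "ennreal (LINT \<omega>|Q. f \<omega>) \<le> ennreal (enn2real (\<integral>\<^sup>+\<omega>. ennreal (f \<omega>) \<partial>Q))"
    by (rule ennreal_leI)
  then show ?thesis by (rule order_trans) (simp add: ennreal_enn2real_if)
qed

locale unbiased_model = girsanov_model M T F X u v
  for M :: "'a measure" and T F X u v +
  fixes \<xi> :: "real \<Rightarrow> 'a \<Rightarrow> real"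
  assumes estimator: "estimator M T \<xi>" and unbiased: "unbiased M T F X \<xi>"
begin

lemma unbiasedD:
  assumes "(u', v') \<in> Theta M T F X" "t \<in> {0..T}"
  shows "integrable (girsanov_measure M T X v') (\<xi> t)"
    and "(LINT \<omega>|girsanov_measure M T X v'. \<xi> t \<omega>) = (LINT \<omega>|M. u' t \<omega>)"
  using unbiased assms unfolding unbiased_def by blast+

text \<open>
  The finite-difference Cramer-Rao bound for one perturbation, with step \<open>\<epsilon>\<close> and the clock
  increment truncated at \<open>K\<close>.
\<close>

lemma increment_bound_truncated:
  fixes \<epsilon> K :: real
  assumes st: "0 \<le> s" "s \<le> t" "t \<le> T" and \<epsilon>: "0 < \<epsilon>"
  defines "b \<equiv> \<lambda>\<omega>. indicator {..K} (u t \<omega> - u s \<omega>) * (u t \<omega> - u s \<omega>)"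
  shows "ennreal ((2 - exp (\<epsilon>\<^sup>2 * K)) * (LINT \<omega>|P. b \<omega>)) \<le>
    (\<integral>\<^sup>+\<omega>. ennreal (((\<xi> t \<omega> - u t \<omega>) - (\<xi> s \<omega> - u s \<omega>))\<^sup>2) \<partial>P)"
proof -
  interpret prob_space P by (rule prob_space_P)
  define a where "a \<omega> = u t \<omega> - u s \<omega>" for \<omega>
  define c where "c \<omega> = 1 + \<epsilon> * indicator {..K} (a \<omega>)" for \<omega>
  have t: "s \<in> {0..T}" "t \<in> {0..T}" using st by auto
  have a0: "a \<in> borel_measurable (F 0)"
    unfolding a_def using t by (intro borel_measurable_diff u_measurable)
  have c0: "c \<in> borel_measurable (F 0)"
    using a0 unfolding c_def by measurable
  have c_ge_1: "1 \<le> c \<omega>" and c_nonneg: "0 \<le> c \<omega>" and c_le: "c \<omega> \<le> 1 + \<epsilon>" for \<omega>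
    using \<epsilon> by (auto simp: c_def indicator_def)
  note tc = c0 c_nonneg
  let ?R = "tilt c s t" and ?rate = "tilted_rate c s t"
  have a_nonneg: "0 \<le> a \<omega>" if "\<omega> \<in> space P" for \<omega>
    using u_le[of \<omega> s t] st that by (simp add: a_def space_Q)
  have b_eq: "b \<omega> = indicator {..K} (a \<omega>) * a \<omega>" for \<omega> by (simp add: b_def a_def)
  have b_bounds: "0 \<le> b \<omega>" "b \<omega> \<le> a \<omega>" "b \<omega> \<le> \<bar>K\<bar>" if "\<omega> \<in> space P" for \<omega>
    using a_nonneg[OF that] by (auto simp: b_eq indicator_def)
  have a_s: "a \<in> borel_measurable (F s)" using measurable_F_mono[OF a0, of s] st by simp
  have [measurable]: "a \<in> borel_measurable P" "c \<in> borel_measurable P" "?R \<in> borel_measurable P"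
    using measurable_F_M[OF a0] measurable_F_M[OF c0] T_pos tilt_measurable_M[OF tc st]
    by (auto simp: measurable_Q)
  have b_meas[measurable]: "b \<in> borel_measurable P" unfolding b_eq by measurable
  have a_int_M: "integrable M a" unfolding a_def using t by (intro Bochner_Integration.integrable_diff u_integrable_M)
  have a_int: "integrable P a" using a_int_M P_integral_F0(1)[OF a0] by simp
  have b_int: "integrable P b"
    using b_bounds order_trans[OF b_bounds(2) abs_ge_self]
    by (intro Bochner_Integration.integrable_bound[OF a_int]) (auto intro!: AE_I2)
  have R_pos: "0 \<le> ?R \<omega>" for \<omega> by (rule tilt_nonneg[OF c_nonneg])

  have R_int: "integrable P (\<lambda>\<omega>. Y \<omega> * ?R \<omega>)" "(LINT \<omega>|P. Y \<omega> * ?R \<omega>) = (LINT \<omega>|P. Y \<omega>)"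
    if Y: "Y \<in> borel_measurable (F s)" "\<And>\<omega>. \<omega> \<in> space P \<Longrightarrow> 0 \<le> Y \<omega>" "integrable P Y" for Y
  proof -
    have Y': "(\<lambda>\<omega>. ennreal (Y \<omega>)) \<in> borel_measurable (F s)" using Y(1) by measurable
    have [measurable]: "Y \<in> borel_measurable P" using Y by auto
    have "(\<integral>\<^sup>+\<omega>. ennreal (Y \<omega> * ?R \<omega>) \<partial>P) = (\<integral>\<^sup>+\<omega>. ennreal (Y \<omega>) * ennreal (?R \<omega>) \<partial>P)"
      by (intro nn_integral_cong) (simp add: ennreal_mult'' R_pos)
    also have "\<dots> = (\<integral>\<^sup>+\<omega>. ennreal (Y \<omega>) \<partial>P)" by (rule nn_integral_tilt[OF tc st Y'])
    finally have eq: "(\<integral>\<^sup>+\<omega>. ennreal (Y \<omega> * ?R \<omega>) \<partial>P) = (\<integral>\<^sup>+\<omega>. ennreal (Y \<omega>) \<partial>P)" .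
    have YR: "(\<lambda>\<omega>. Y \<omega> * ?R \<omega>) \<in> borel_measurable P" "\<And>\<omega>. \<omega> \<in> space P \<Longrightarrow> 0 \<le> Y \<omega> * ?R \<omega>"
      using Y(2) R_pos by (measurable, simp)
    show "integrable P (\<lambda>\<omega>. Y \<omega> * ?R \<omega>)" "(LINT \<omega>|P. Y \<omega> * ?R \<omega>) = (LINT \<omega>|P. Y \<omega>)"
      by (rule integrable_if_nn_integral_eq[OF YR Y(3,2) eq]; assumption)+
  qed
  have R_int_1: "integrable P ?R" "(LINT \<omega>|P. ?R \<omega>) = 1"
  proof -
    have one: "(\<lambda>_. 1 :: real) \<in> borel_measurable (F s)" "integrable P (\<lambda>_. 1 :: real)" by auto
    show "integrable P ?R" using R_int(1)[OF one(1) _ one(2)] by simp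
    have "(LINT \<omega>|P. 1 * ?R \<omega>) = (LINT \<omega>|P. 1)" by (rule R_int(2)[OF one(1) _ one(2)]) simp
    then show "(LINT \<omega>|P. ?R \<omega>) = 1" by (simp add: prob_space)
  qed

  have exp_b_int: "integrable P (\<lambda>\<omega>. exp (\<epsilon>\<^sup>2 * b \<omega>))"
    using b_bounds by (intro integrable_const_bound[where B="exp (\<epsilon>\<^sup>2 * \<bar>K\<bar>)"] AE_I2) (auto intro!: mult_left_mono)
  \<comment> \<open>As \<open>c - 1\<close> is \<open>\<epsilon>\<close> or \<open>0\<close>, the exponent \<open>(c - 1)\<^sup>2 a\<close> of the second moment is \<open>\<epsilon>\<^sup>2 b\<close>, which is bounded.\<close>
  have sq_eq: "(\<integral>\<^sup>+\<omega>. ennreal ((?R \<omega>)\<^sup>2) \<partial>P) = (\<integral>\<^sup>+\<omega>. ennreal (exp (\<epsilon>\<^sup>2 * b \<omega>)) \<partial>P)"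
  proof -
    have "(\<integral>\<^sup>+\<omega>. 1 * ennreal ((?R \<omega>)\<^sup>2) \<partial>P) =
        (\<integral>\<^sup>+\<omega>. 1 * ennreal (exp (((c \<omega>)\<^sup>2 - 1 - real 2 * (c \<omega> - 1)) * (u t \<omega> - u s \<omega>))) \<partial>P)"
      by (rule nn_integral_tilt_power[OF tc st]) simp
    also have "\<dots> = (\<integral>\<^sup>+\<omega>. ennreal (exp (\<epsilon>\<^sup>2 * b \<omega>)) \<partial>P)"
      by (intro nn_integral_cong)
        (auto simp: b_eq c_def a_def indicator_def power2_eq_square algebra_simps)
    finally show ?thesis by simp
  qed
  have sq_int: "integrable P (\<lambda>\<omega>. (?R \<omega>)\<^sup>2)" "(LINT \<omega>|P. (?R \<omega>)\<^sup>2) = (LINT \<omega>|P. exp (\<epsilon>\<^sup>2 * b \<omega>))"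
    by (auto intro!: integrable_if_nn_integral_eq[OF _ _ exp_b_int _ sq_eq])

  define w where "w \<omega> = ?R \<omega> - 1" for \<omega>
  have w_sq: "(w \<omega>)\<^sup>2 = (?R \<omega>)\<^sup>2 - 2 * ?R \<omega> + 1" for \<omega>
    by (simp add: w_def power2_eq_square algebra_simps)
  have w_int: "integrable P (\<lambda>\<omega>. (w \<omega>)\<^sup>2)"
    unfolding w_sq using sq_int R_int_1 by auto
  have w_le: "(LINT \<omega>|P. (w \<omega>)\<^sup>2) \<le> \<epsilon>\<^sup>2 * exp (\<epsilon>\<^sup>2 * K) * (LINT \<omega>|P. b \<omega>)"
  proof -
    have "(LINT \<omega>|P. (w \<omega>)\<^sup>2) = (LINT \<omega>|P. exp (\<epsilon>\<^sup>2 * b \<omega>) - 1)"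
      unfolding w_sq using sq_int R_int_1 exp_b_int by (simp add: prob_space)
    also have "\<dots> \<le> (LINT \<omega>|P. \<epsilon>\<^sup>2 * exp (\<epsilon>\<^sup>2 * K) * b \<omega>)"
    proof (rule integral_mono)
      show "integrable P (\<lambda>\<omega>. exp (\<epsilon>\<^sup>2 * b \<omega>) - 1)" using exp_b_int by auto
      show "integrable P (\<lambda>\<omega>. \<epsilon>\<^sup>2 * exp (\<epsilon>\<^sup>2 * K) * b \<omega>)" using b_int by (intro integrable_mult_right)
      fix \<omega> assume \<omega>: "\<omega> \<in> space P"
      show "exp (\<epsilon>\<^sup>2 * b \<omega>) - 1 \<le> \<epsilon>\<^sup>2 * exp (\<epsilon>\<^sup>2 * K) * b \<omega>"
      proof (cases "a \<omega> \<le> K")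
        case True
        define x where "x = \<epsilon>\<^sup>2 * b \<omega>"
        have x: "0 \<le> x" "x \<le> \<epsilon>\<^sup>2 * K"
          using b_bounds[OF \<omega>] True by (auto simp: x_def b_eq intro!: mult_left_mono)
        have "exp x * (1 - x) \<le> exp x * exp (- x)"
          using exp_ge_add_one_self[of "- x"] by (intro mult_left_mono) auto
        then have "exp x - 1 \<le> x * exp x" by (simp add: exp_add[symmetric] algebra_simps)
        also have "\<dots> \<le> x * exp (\<epsilon>\<^sup>2 * K)" using x by (intro mult_left_mono) auto
        finally show ?thesis by (simp add: x_def ac_simps)
      qed (simp add: b_eq)
    qed
    finally show ?thesis using b_int by simp
  qed

  define D where "D \<omega> = \<xi> t \<omega> - \<xi> s \<omega>" for \<omega>
  have D_int: "integrable P D" "(LINT \<omega>|P. D \<omega>) = (LINT \<omega>|M. a \<omega>)"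
    unfolding D_def a_def
    using unbiasedD[OF uv] t u_integrable_M by auto
  have rate: "(tilted_clock c s t, ?rate) \<in> Theta M T F X"
    and dens: "girsanov_measure M T X ?rate = density P (\<lambda>\<omega>. ennreal (?R \<omega>))"
    using tilted_in_Theta[OF c0 c_ge_1 c_le st] girsanov_measure_tilted[OF c0 c_ge_1 c_le st] by auto
  have D_tilted: "integrable (density P (\<lambda>\<omega>. ennreal (?R \<omega>))) D"
    "(LINT \<omega>|density P (\<lambda>\<omega>. ennreal (?R \<omega>)). D \<omega>) = (LINT \<omega>|M. tilted_clock c s t t \<omega> - tilted_clock c s t s \<omega>)"
  proof -
    have "integrable M (tilted_clock c s t r)" if "r \<in> {0..T}" for r
      using rate that by (auto simp: Theta_def)
    then show "(LINT \<omega>|density P (\<lambda>\<omega>. ennreal (?R \<omega>)). D \<omega>) = (LINT \<omega>|M. tilted_clock c s t t \<omega> - tilted_clock c s t s \<omega>)"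
      unfolding D_def using unbiasedD[OF rate] t by (simp add: dens)
    show "integrable (density P (\<lambda>\<omega>. ennreal (?R \<omega>))) D"
      unfolding D_def using unbiasedD(1)[OF rate] t by (simp add: dens)
  qed
  have [measurable]: "D \<in> borel_measurable P" using D_int by auto
  have RD_int: "integrable P (\<lambda>\<omega>. ?R \<omega> * D \<omega>)"
    using D_tilted(1) R_pos by (subst (asm) integrable_density) auto
  have ca_int: "(LINT \<omega>|M. c \<omega> * a \<omega>) = (LINT \<omega>|P. a \<omega>) + \<epsilon> * (LINT \<omega>|P. b \<omega>)"
  proof -
    have "(\<lambda>\<omega>. c \<omega> * a \<omega>) \<in> borel_measurable (F 0)" using a0 c0 by measurable
    then have "(LINT \<omega>|M. c \<omega> * a \<omega>) = (LINT \<omega>|P. c \<omega> * a \<omega>)"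
      by (rule P_integral_F0(2)[symmetric])
    also have "\<dots> = (LINT \<omega>|P. a \<omega> + \<epsilon> * b \<omega>)"
      by (intro Bochner_Integration.integral_cong) (auto simp: c_def b_eq algebra_simps)
    finally show ?thesis using a_int b_int by simp
  qed
  \<comment> \<open>Unbiasedness at the perturbed parameter; the perturbed clock gains \<open>c a\<close> on \<open>(s, t]\<close>.\<close>
  have RD: "(LINT \<omega>|P. ?R \<omega> * D \<omega>) = (LINT \<omega>|P. a \<omega>) + \<epsilon> * (LINT \<omega>|P. b \<omega>)"
  proof -
    have "(LINT \<omega>|P. ?R \<omega> * D \<omega>) = (LINT \<omega>|density P (\<lambda>\<omega>. ennreal (?R \<omega>)). D \<omega>)"
      using R_pos by (subst integral_density) auto
    also have "\<dots> = (LINT \<omega>|M. c \<omega> * a \<omega>)"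
      unfolding D_tilted(2) using tilted_clock_increment(3)[OF tc st, of s t] st
      by (simp add: a_def)
    finally show ?thesis by (simp add: ca_int)
  qed
  \<comment> \<open>The clock is known at time 0, so its increment has the same mean under both laws.\<close>
  have Ra: "integrable P (\<lambda>\<omega>. a \<omega> * ?R \<omega>)" "(LINT \<omega>|P. a \<omega> * ?R \<omega>) = (LINT \<omega>|P. a \<omega>)"
    using R_int[OF a_s a_nonneg a_int] by auto

  define h where "h \<omega> = D \<omega> - a \<omega>" for \<omega>
  have hw: "h \<omega> * w \<omega> = ?R \<omega> * D \<omega> - D \<omega> - a \<omega> * ?R \<omega> + a \<omega>" for \<omega>
    by (simp add: h_def w_def algebra_simps)
  have hw_int: "integrable P (\<lambda>\<omega>. h \<omega> * w \<omega>)"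
    unfolding hw using RD_int D_int Ra a_int by auto
  have hw_eq: "(LINT \<omega>|P. h \<omega> * w \<omega>) = \<epsilon> * (LINT \<omega>|P. b \<omega>)"
    unfolding hw using RD_int D_int Ra a_int RD P_integral_F0(2)[OF a0] by simp
  \<comment> \<open>\<open>f \<le> h\<^sup>2\<close>, because the difference is the square of \<open>h - w / \<epsilon>\<close>.\<close>
  define f where "f \<omega> = (2 / \<epsilon>) * (h \<omega> * w \<omega>) - (1 / \<epsilon>\<^sup>2) * (w \<omega>)\<^sup>2" for \<omega>
  have f_int: "integrable P f" unfolding f_def using hw_int w_int by auto
  have "(2 - exp (\<epsilon>\<^sup>2 * K)) * (LINT \<omega>|P. b \<omega>) \<le> (LINT \<omega>|P. f \<omega>)"
  proof -
    have "(LINT \<omega>|P. f \<omega>) = (2 / \<epsilon>) * (\<epsilon> * (LINT \<omega>|P. b \<omega>)) - (1 / \<epsilon>\<^sup>2) * (LINT \<omega>|P. (w \<omega>)\<^sup>2)"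
      unfolding f_def using hw_int w_int
      by (subst Bochner_Integration.integral_diff) (auto simp: hw_eq)
    moreover have "(1 / \<epsilon>\<^sup>2) * (LINT \<omega>|P. (w \<omega>)\<^sup>2) \<le> (1 / \<epsilon>\<^sup>2) * (\<epsilon>\<^sup>2 * exp (\<epsilon>\<^sup>2 * K) * (LINT \<omega>|P. b \<omega>))"
      by (rule mult_left_mono[OF w_le]) simp
    ultimately show ?thesis using \<epsilon> by (simp add: algebra_simps)
  qed
  then have "ennreal ((2 - exp (\<epsilon>\<^sup>2 * K)) * (LINT \<omega>|P. b \<omega>)) \<le> ennreal (LINT \<omega>|P. f \<omega>)"
    by (rule ennreal_leI)
  also have "\<dots> \<le> (\<integral>\<^sup>+\<omega>. ennreal (f \<omega>) \<partial>P)"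
    using f_int by (rule ennreal_integral_le_nn_integral)
  also have "\<dots> \<le> (\<integral>\<^sup>+\<omega>. ennreal (((\<xi> t \<omega> - u t \<omega>) - (\<xi> s \<omega> - u s \<omega>))\<^sup>2) \<partial>P)"
  proof (intro nn_integral_mono ennreal_leI)
    fix \<omega>
    have "0 \<le> (h \<omega> - w \<omega> / \<epsilon>)\<^sup>2" by simp
    also have "\<dots> = (h \<omega>)\<^sup>2 - f \<omega>"
      using \<epsilon> by (simp add: f_def power2_eq_square field_simps)
    finally show "f \<omega> \<le> ((\<xi> t \<omega> - u t \<omega>) - (\<xi> s \<omega> - u s \<omega>))\<^sup>2"
      by (simp add: h_def D_def a_def algebra_simps)
  qed
  finally show ?thesis .
qed

text \<open>
  Let the step tend to 0 and the truncation level to infinity together: with \<open>\<epsilon> = 1 / (n + 1)\<close>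
  and \<open>K = n + 1\<close> the product \<open>\<epsilon>\<^sup>2 K\<close> tends to 0.
\<close>

lemma increment_bound:
  assumes st: "0 \<le> s" "s \<le> t" "t \<le> T"
  shows "(\<integral>\<^sup>+\<omega>. ennreal (u t \<omega> - u s \<omega>) \<partial>P) \<le>
    (\<integral>\<^sup>+\<omega>. ennreal (((\<xi> t \<omega> - u t \<omega>) - (\<xi> s \<omega> - u s \<omega>))\<^sup>2) \<partial>P)"
proof -
  define a where "a \<omega> = u t \<omega> - u s \<omega>" for \<omega>
  define b where "b n \<omega> = indicator {..real (Suc n)} (a \<omega>) * a \<omega>" for n \<omega>
  have t: "s \<in> {0..T}" "t \<in> {0..T}" using st by auto
  have a0: "a \<in> borel_measurable (F 0)"
    unfolding a_def using t by (intro borel_measurable_diff u_measurable)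
  have a_int: "integrable P a"
    unfolding P_integral_F0(1)[OF a0] unfolding a_def using t
    by (intro Bochner_Integration.integrable_diff u_integrable_M)
  then have [measurable]: "a \<in> borel_measurable P" by auto
  have a_nonneg: "0 \<le> a \<omega>" if "\<omega> \<in> space P" for \<omega>
    using u_le[of \<omega> s t] st that by (simp add: a_def space_Q)
  have "(\<lambda>n. LINT \<omega>|P. b n \<omega>) \<longlonglongrightarrow> (LINT \<omega>|P. a \<omega>)"
  proof (rule integral_dominated_convergence[where w=a])
    show "AE \<omega> in P. (\<lambda>n. b n \<omega>) \<longlonglongrightarrow> a \<omega>"
    proof (intro AE_I2 tendsto_eventually)
      fix \<omega>
      have "eventually (\<lambda>n. a \<omega> \<le> real (Suc n)) sequentially"
        by (rule eventually_sequentiallyI[of "nat \<lceil>a \<omega>\<rceil>"]) linarith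
      then show "eventually (\<lambda>n. b n \<omega> = a \<omega>) sequentially"
        by eventually_elim (simp add: b_def)
    qed
    show "AE \<omega> in P. norm (b n \<omega>) \<le> a \<omega>" for n
      using a_nonneg by (intro AE_I2) (auto simp: b_def indicator_def)
  qed (use a_int in \<open>auto simp: b_def\<close>)
  moreover have "(\<lambda>n. 2 - exp ((1 / real (Suc n))\<^sup>2 * real (Suc n))) \<longlonglongrightarrow> 2 - exp 0"
  proof -
    have "(1 / real (Suc n))\<^sup>2 * real (Suc n) = inverse (real (Suc n))" for n
      by (simp add: power2_eq_square divide_inverse del: of_nat_Suc)
    then show ?thesis
      by (simp only:) (intro tendsto_intros LIMSEQ_inverse_real_of_nat)
  qed
  ultimately have "(\<lambda>n. ennreal ((2 - exp ((1 / real (Suc n))\<^sup>2 * real (Suc n))) * (LINT \<omega>|P. b n \<omega>))) \<longlonglongrightarrow>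
      ennreal ((2 - exp 0) * (LINT \<omega>|P. a \<omega>))"
    by (intro tendsto_ennrealI tendsto_mult)
  moreover have "ennreal ((2 - exp ((1 / real (Suc n))\<^sup>2 * real (Suc n))) * (LINT \<omega>|P. b n \<omega>)) \<le>
    (\<integral>\<^sup>+\<omega>. ennreal (((\<xi> t \<omega> - u t \<omega>) - (\<xi> s \<omega> - u s \<omega>))\<^sup>2) \<partial>P)" for n
    unfolding b_def a_def using st by (intro increment_bound_truncated) auto
  ultimately have "ennreal (LINT \<omega>|P. a \<omega>) \<le> (\<integral>\<^sup>+\<omega>. ennreal (((\<xi> t \<omega> - u t \<omega>) - (\<xi> s \<omega> - u s \<omega>))\<^sup>2) \<partial>P)"
    by (intro LIMSEQ_le_const2[of _ "ennreal (LINT \<omega>|P. a \<omega>)"]) auto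
  moreover have "(\<integral>\<^sup>+\<omega>. ennreal (a \<omega>) \<partial>P) = ennreal (LINT \<omega>|P. a \<omega>)"
    using a_int a_nonneg by (intro nn_integral_eq_integral) auto
  ultimately show ?thesis by (simp add: a_def)
qed

end

section \<open>Lower bounds for the risks\<close>

context unbiased_model
begin

abbreviation clip :: "real \<Rightarrow> real" where "clip r \<equiv> max 0 (min T r)"

lemma sets_pair_P: "sets (N \<Otimes>\<^sub>M P) = sets (N \<Otimes>\<^sub>M M)"
  by (intro sets_pair_measure_cong refl sets_Q)

text \<open>
  The clock is nondecreasing, so its rate is almost everywhere nonnegative and replacing it by its
  positive part changes no integral.
\<close>

lemma nn_integral_rate:
  assumes \<omega>: "\<omega> \<in> space M" and st: "0 \<le> s" "s \<le> t" "t \<le> T"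
  shows "(\<integral>\<^sup>+r\<in>{s..t}. ennreal (v r \<omega>) \<partial>lborel) = ennreal (u t \<omega> - u s \<omega>)"
proof -
  have "0 \<le> (LINT r:{s<..t}|lborel. v r \<omega>)" if "0 \<le> s" "s \<le> t" "t \<le> T" for s t
    using set_integral_Ioc_diff[OF v_integrable[OF \<omega>] that] u_le[OF \<omega> that] that by (simp add: u_eq[OF \<omega>])
  from nn_integral_Icc_if_integral_Ioc_nonneg[OF v_integrable[OF \<omega>] this st]
  show ?thesis using v_integral[OF \<omega> st] by simp
qed

lemma v_clamp_measurable [measurable]:
  "(\<lambda>p. v (clip (fst p)) (snd p)) \<in> borel_measurable (borel \<Otimes>\<^sub>M M)"
  using T_pos by (intro measurable_clamp[OF _ subalgebra_F v_measurable]) auto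

lemma \<xi>_clamp_measurable [measurable]:
  "(\<lambda>p. \<xi> (clip (fst p)) (snd p)) \<in> borel_measurable (borel \<Otimes>\<^sub>M M)"
  using T_pos estimator unfolding estimator_def
  by (intro measurable_clamp[of T M M]) (auto simp: subalgebra_def)

lemma u_clamp_measurable [measurable]:
  "(\<lambda>p. u (clip (fst p)) (snd p)) \<in> borel_measurable (borel \<Otimes>\<^sub>M M)"
proof -
  have vm: "(\<lambda>q. v (clip (snd q)) (snd (fst q))) \<in> borel_measurable ((borel \<Otimes>\<^sub>M M) \<Otimes>\<^sub>M lborel)"
  proof -
    have "(\<lambda>q. (snd q, snd (fst q))) \<in> measurable ((borel \<Otimes>\<^sub>M M) \<Otimes>\<^sub>M lborel) (borel \<Otimes>\<^sub>M M)" by measurable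
    from measurable_compose[OF this v_clamp_measurable] show ?thesis by simp
  qed
  have "(\<lambda>(p, s). (if 0 \<le> s \<and> s \<le> clip (fst p) then v (clip s) (snd p) else 0)) \<in>
      borel_measurable ((borel \<Otimes>\<^sub>M M) \<Otimes>\<^sub>M lborel)"
    unfolding case_prod_beta using vm by measurable
  from sigma_finite_measure.borel_measurable_lebesgue_integral[OF sigma_finite_lborel this]
  have "(\<lambda>p. LINT s|lborel. (if 0 \<le> s \<and> s \<le> clip (fst p) then v (clip s) (snd p) else 0)) \<in> borel_measurable (borel \<Otimes>\<^sub>M M)"
    by simp
  also have "?this \<longleftrightarrow> ?thesis"
  proof (rule measurable_cong)
    fix p :: "real \<times> 'a" assume "p \<in> space (borel \<Otimes>\<^sub>M M)"
    then have "snd p \<in> space M" by (auto simp: space_pair_measure)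
    moreover have "(LINT s|lborel. (if 0 \<le> s \<and> s \<le> clip (fst p) then v (clip s) (snd p) else 0)) =
        (LINT s:{0..clip (fst p)}|lborel. v s (snd p))"
      unfolding set_lebesgue_integral_def
      by (intro Bochner_Integration.integral_cong) (use T_pos in \<open>auto simp: indicator_def\<close>)
    ultimately show "(LINT s|lborel. (if 0 \<le> s \<and> s \<le> clip (fst p) then v (clip s) (snd p) else 0)) = u (clip (fst p)) (snd p)"
      using T_pos by (subst u_eq) auto
  qed
  finally show ?thesis .
qed

definition mean_rate :: "real \<Rightarrow> ennreal" where
  "mean_rate r = (\<integral>\<^sup>+\<omega>. ennreal (v (clip r) \<omega>) \<partial>P)"

lemma sigma_finite_P: "sigma_finite_measure P"
  using prob_space_P by (simp add: prob_space_imp_sigma_finite)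

lemma mean_rate_measurable [measurable]: "mean_rate \<in> borel_measurable borel"
proof -
  have "(\<lambda>(r, \<omega>). ennreal (v (clip r) \<omega>)) \<in> borel_measurable (borel \<Otimes>\<^sub>M P)"
    unfolding measurable_cong_sets[OF sets_pair_P refl] by (simp add: case_prod_beta)
  then show ?thesis
    unfolding mean_rate_def by (rule sigma_finite_measure.borel_measurable_nn_integral[OF sigma_finite_P])
qed

lemma nn_integral_mean_rate:
  assumes st: "0 \<le> s" "s \<le> t" "t \<le> T"
  shows "(\<integral>\<^sup>+r\<in>{s..t}. mean_rate r \<partial>lborel) = (\<integral>\<^sup>+\<omega>. ennreal (u t \<omega> - u s \<omega>) \<partial>P)"
proof -
  interpret pair_sigma_finite lborel P
    by (intro pair_sigma_finite.intro sigma_finite_lborel sigma_finite_P)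
  have m: "(\<lambda>(r, \<omega>). ennreal (v (clip r) \<omega>) * indicator {s..t} r) \<in> borel_measurable (lborel \<Otimes>\<^sub>M P)"
  proof -
    have sets: "sets (lborel \<Otimes>\<^sub>M P) = sets (borel \<Otimes>\<^sub>M M)" by (intro sets_pair_measure_cong sets_lborel sets_Q)
    show ?thesis unfolding measurable_cong_sets[OF sets refl] case_prod_beta by measurable
  qed
  have v_P: "(\<lambda>\<omega>. ennreal (v (clip r) \<omega>)) \<in> borel_measurable P" for r
    unfolding measurable_Q using measurable_compose[OF measurable_Pair1' v_clamp_measurable, of r] by simp
  have "(\<integral>\<^sup>+r\<in>{s..t}. mean_rate r \<partial>lborel) =
      (\<integral>\<^sup>+r. (\<integral>\<^sup>+\<omega>. ennreal (v (clip r) \<omega>) * indicator {s..t} r \<partial>P) \<partial>lborel)"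
    unfolding mean_rate_def by (intro nn_integral_cong nn_integral_multc[symmetric] v_P)
  also have "\<dots> = (\<integral>\<^sup>+\<omega>. (\<integral>\<^sup>+r. ennreal (v (clip r) \<omega>) * indicator {s..t} r \<partial>lborel) \<partial>P)"
    by (rule Fubini'[OF m, symmetric])
  also have "\<dots> = (\<integral>\<^sup>+\<omega>. ennreal (u t \<omega> - u s \<omega>) \<partial>P)"
  proof (intro nn_integral_cong)
    fix \<omega> assume "\<omega> \<in> space P"
    then have "\<omega> \<in> space M" by (simp add: space_Q)
    moreover have "(\<integral>\<^sup>+r. ennreal (v (clip r) \<omega>) * indicator {s..t} r \<partial>lborel) = (\<integral>\<^sup>+r\<in>{s..t}. ennreal (v r \<omega>) \<partial>lborel)"
      using st by (intro nn_integral_cong) (auto simp: indicator_def)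
    ultimately show "(\<integral>\<^sup>+r. ennreal (v (clip r) \<omega>) * indicator {s..t} r \<partial>lborel) = ennreal (u t \<omega> - u s \<omega>)"
      using nn_integral_rate st by simp
  qed
  finally show ?thesis .
qed

lemma mean_total_pos: "0 < (\<integral>\<^sup>+\<omega>. ennreal (u T \<omega>) \<partial>P)"
proof -
  interpret prob_space P by (rule prob_space_P)
  have [measurable]: "u T \<in> borel_measurable P"
    unfolding measurable_Q using measurable_F_M[OF u_measurable] T_pos by auto
  have pos: "0 < u T \<omega>" if "\<omega> \<in> space P" for \<omega>
    using u_less[of \<omega> 0 T] u_0[of \<omega>] that T_pos by (simp add: space_Q)
  have "(\<integral>\<^sup>+\<omega>. ennreal (u T \<omega>) \<partial>P) \<noteq> 0"
  proof
    assume "(\<integral>\<^sup>+\<omega>. ennreal (u T \<omega>) \<partial>P) = 0"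
    then have "AE \<omega> in P. ennreal (u T \<omega>) = 0" by (subst (asm) nn_integral_0_iff_AE) auto
    then have "AE \<omega> in P. False" using AE_space by eventually_elim (use pos in \<open>force simp: ennreal_eq_0_iff\<close>)
    then show False by simp
  qed
  then show ?thesis by (simp add: zero_less_iff_neq_zero)
qed

lemma increment_bound_abs:
  assumes "s \<in> {0..T}" "t \<in> {0..T}"
  shows "(\<integral>\<^sup>+\<omega>. ennreal \<bar>u t \<omega> - u s \<omega>\<bar> \<partial>P) \<le>
    (\<integral>\<^sup>+\<omega>. ennreal (((\<xi> t \<omega> - u t \<omega>) - (\<xi> s \<omega> - u s \<omega>))\<^sup>2) \<partial>P)"
proof -
  have *: "(\<integral>\<^sup>+\<omega>. ennreal \<bar>u t \<omega> - u s \<omega>\<bar> \<partial>P) \<le>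
    (\<integral>\<^sup>+\<omega>. ennreal (((\<xi> t \<omega> - u t \<omega>) - (\<xi> s \<omega> - u s \<omega>))\<^sup>2) \<partial>P)" if st: "0 \<le> s" "s \<le> t" "t \<le> T" for s t
  proof -
    have "(\<integral>\<^sup>+\<omega>. ennreal \<bar>u t \<omega> - u s \<omega>\<bar> \<partial>P) = (\<integral>\<^sup>+\<omega>. ennreal (u t \<omega> - u s \<omega>) \<partial>P)"
      using u_le[OF _ st] by (intro nn_integral_cong) (simp add: space_Q)
    then show ?thesis using increment_bound[OF st] by simp
  qed
  show ?thesis
  proof (cases "s \<le> t")
    case True
    then show ?thesis using *[of s t] assms by auto
  next
    case False
    then show ?thesis using *[of t s] assms by (simp add: abs_minus_commute power2_commute)
  qed
qed

text \<open>
  By Tonelli's theorem the risk is the double integral of the mean squared increments, each of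
  which is bounded by \<open>increment_bound\<close>.
\<close>

lemma risk_W_ge_increments:
  "(\<integral>\<^sup>+s. (\<integral>\<^sup>+t. indicator {0..T} s * indicator {0..T} t *
      (ennreal (1 / \<bar>t - s\<bar> powr (2 * \<alpha> + 1)) * (\<integral>\<^sup>+\<omega>. ennreal \<bar>u t \<omega> - u s \<omega>\<bar> \<partial>P)) \<partial>lborel) \<partial>lborel)
    \<le> (\<integral>\<^sup>+\<omega>. W_norm_sq T \<alpha> (\<lambda>t. \<xi> t \<omega> - u t \<omega>) \<partial>P)"
proof -
  interpret pair_sigma_finite lborel P
    by (intro pair_sigma_finite.intro sigma_finite_lborel sigma_finite_P)
  define \<zeta> where "\<zeta> r \<omega> = \<xi> (clip r) \<omega> - u (clip r) \<omega>" for r \<omega>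
  define H where "H s t \<omega> = indicator {0..T} s * indicator {0..T} t *
      ennreal ((\<zeta> t \<omega> - \<zeta> s \<omega>)\<^sup>2 / \<bar>t - s\<bar> powr (2 * \<alpha> + 1))" for s t \<omega>
  have sets1: "sets (lborel \<Otimes>\<^sub>M P) = sets (borel \<Otimes>\<^sub>M M)" by (intro sets_pair_measure_cong sets_lborel sets_Q)
  have \<zeta>: "(\<lambda>p. \<zeta> (fst p) (snd p)) \<in> borel_measurable (lborel \<Otimes>\<^sub>M P)"
    unfolding measurable_cong_sets[OF sets1 refl] \<zeta>_def by measurable
  have \<zeta>': "(\<lambda>x. \<zeta> (f x) (g x)) \<in> borel_measurable N"
    if "f \<in> measurable N lborel" "g \<in> measurable N P" for f g and N :: "'x measure"
    using measurable_compose[OF measurable_Pair[OF that] \<zeta>] by simp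
  have H_meas: "(\<lambda>x. H (f x) (g x) (k x)) \<in> borel_measurable N"
    if [measurable]: "f \<in> measurable N lborel" "g \<in> measurable N lborel" "k \<in> measurable N P"
    for f g k and N :: "'x measure"
  proof -
    have [measurable]: "(\<lambda>x. \<zeta> (f x) (k x)) \<in> borel_measurable N" "(\<lambda>x. \<zeta> (g x) (k x)) \<in> borel_measurable N"
      by (intro \<zeta>' that)+
    have [measurable]: "f \<in> borel_measurable N" "g \<in> borel_measurable N" using that(1,2) by simp_all
    show ?thesis unfolding H_def by measurable
  qed
  have W: "W_norm_sq T \<alpha> (\<lambda>t. \<xi> t \<omega> - u t \<omega>) = (\<integral>\<^sup>+s. (\<integral>\<^sup>+t. H s t \<omega> \<partial>lborel) \<partial>lborel)"
    if "\<omega> \<in> space P" for \<omega>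
    unfolding W_norm_sq_def
  proof (intro nn_integral_cong)
    fix s
    show "(\<integral>\<^sup>+t\<in>{0..T}. ennreal (\<bar>\<xi> t \<omega> - u t \<omega> - (\<xi> s \<omega> - u s \<omega>)\<bar>\<^sup>2 / \<bar>t - s\<bar> powr (2 * \<alpha> + 1)) \<partial>lborel) *
        indicator {0..T} s = (\<integral>\<^sup>+t. H s t \<omega> \<partial>lborel)"
      by (cases "s \<in> {0..T}") (auto simp: H_def \<zeta>_def indicator_def intro!: nn_integral_cong)
  qed
  have meas1: "(\<lambda>(s, \<omega>). \<integral>\<^sup>+t. H s t \<omega> \<partial>lborel) \<in> borel_measurable (lborel \<Otimes>\<^sub>M P)"
  proof -
    have "(\<lambda>(p, t). H (fst p) t (snd p)) \<in> borel_measurable ((lborel \<Otimes>\<^sub>M P) \<Otimes>\<^sub>M lborel)"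
      unfolding case_prod_beta by (rule H_meas) measurable
    then show ?thesis
      unfolding case_prod_beta
      by (rule sigma_finite_measure.borel_measurable_nn_integral[OF sigma_finite_lborel, unfolded case_prod_beta])
  qed
  have meas2: "(\<lambda>(t, \<omega>). H s t \<omega>) \<in> borel_measurable (lborel \<Otimes>\<^sub>M P)" for s
    unfolding case_prod_beta by (rule H_meas) measurable
  have "(\<integral>\<^sup>+\<omega>. W_norm_sq T \<alpha> (\<lambda>t. \<xi> t \<omega> - u t \<omega>) \<partial>P) =
      (\<integral>\<^sup>+\<omega>. (\<integral>\<^sup>+s. (\<integral>\<^sup>+t. H s t \<omega> \<partial>lborel) \<partial>lborel) \<partial>P)"
    by (intro nn_integral_cong W)
  also have "\<dots> = (\<integral>\<^sup>+s. (\<integral>\<^sup>+\<omega>. (\<integral>\<^sup>+t. H s t \<omega> \<partial>lborel) \<partial>P) \<partial>lborel)"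
    by (rule Fubini'[OF meas1])
  also have "\<dots> = (\<integral>\<^sup>+s. (\<integral>\<^sup>+t. (\<integral>\<^sup>+\<omega>. H s t \<omega> \<partial>P) \<partial>lborel) \<partial>lborel)"
    by (intro nn_integral_cong Fubini'[OF meas2])
  finally have risk: "(\<integral>\<^sup>+\<omega>. W_norm_sq T \<alpha> (\<lambda>t. \<xi> t \<omega> - u t \<omega>) \<partial>P) =
      (\<integral>\<^sup>+s. (\<integral>\<^sup>+t. (\<integral>\<^sup>+\<omega>. H s t \<omega> \<partial>P) \<partial>lborel) \<partial>lborel)" .
  show ?thesis
    unfolding risk
  proof (intro nn_integral_mono)
    fix s t
    show "indicator {0..T} s * indicator {0..T} t *
      (ennreal (1 / \<bar>t - s\<bar> powr (2 * \<alpha> + 1)) * (\<integral>\<^sup>+\<omega>. ennreal \<bar>u t \<omega> - u s \<omega>\<bar> \<partial>P)) \<le> (\<integral>\<^sup>+\<omega>. H s t \<omega> \<partial>P)"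
    proof (cases "s \<in> {0..T} \<and> t \<in> {0..T}")
      case True
      let ?k = "1 / \<bar>t - s\<bar> powr (2 * \<alpha> + 1)" and ?d = "\<lambda>\<omega>. (\<xi> t \<omega> - u t \<omega>) - (\<xi> s \<omega> - u s \<omega>)"
      have clamps: "clip s = s" "clip t = t" using True by auto
      have "(\<lambda>\<omega>. \<zeta> t \<omega>) \<in> borel_measurable P" "(\<lambda>\<omega>. \<zeta> s \<omega>) \<in> borel_measurable P"
        by (intro \<zeta>'; simp)+
      then have [measurable]: "?d \<in> borel_measurable P"
        unfolding \<zeta>_def clamps by (rule borel_measurable_diff)
      have "ennreal ?k * (\<integral>\<^sup>+\<omega>. ennreal \<bar>u t \<omega> - u s \<omega>\<bar> \<partial>P) \<le> ennreal ?k * (\<integral>\<^sup>+\<omega>. ennreal ((?d \<omega>)\<^sup>2) \<partial>P)"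
        using True by (intro mult_left_mono increment_bound_abs) auto
      also have "\<dots> = (\<integral>\<^sup>+\<omega>. ennreal ?k * ennreal ((?d \<omega>)\<^sup>2) \<partial>P)"
        by (rule nn_integral_cmult[symmetric]) measurable
      also have "\<dots> = (\<integral>\<^sup>+\<omega>. H s t \<omega> \<partial>P)"
        using True by (intro nn_integral_cong) (simp add: H_def \<zeta>_def clamps ennreal_mult[symmetric])
      finally show ?thesis using True by simp
    qed (auto simp: indicator_def)
  qed
qed

text \<open>
  The right-hand side is symmetric in \<open>s\<close> and \<open>t\<close>, which accounts for the factor 2. For \<open>s < t\<close>
  the mean increment of the clock is the integral of the mean rate over \<open>r\<close> in \<open>[s, t]\<close>, and the
  integrations over \<open>s\<close>, \<open>t\<close> and \<open>r\<close> are exchanged.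
\<close>

lemma kernel_integral_le_increments:
  "2 * (\<integral>\<^sup>+r\<in>{0..T}. mean_rate r *
      (\<integral>\<^sup>+t\<in>{r..T}. (\<integral>\<^sup>+s\<in>{0..r}. ennreal (1 / (t - s) powr q) \<partial>lborel) \<partial>lborel) \<partial>lborel)
   \<le> (\<integral>\<^sup>+s. (\<integral>\<^sup>+t. indicator {0..T} s * indicator {0..T} t *
      (ennreal (1 / \<bar>t - s\<bar> powr q) * (\<integral>\<^sup>+\<omega>. ennreal \<bar>u t \<omega> - u s \<omega>\<bar> \<partial>P)) \<partial>lborel) \<partial>lborel)"
proof -
  define k where "k s t = ennreal (1 / (t - s) powr q)" for s t
  define J where "J s t r = (if 0 \<le> s \<and> s \<le> r \<and> r \<le> t \<and> t \<le> T then mean_rate r * k s t else 0)" for s t r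
  define B where "B s t = (\<integral>\<^sup>+r. J s t r \<partial>lborel)" for s t
  let ?D = "\<lambda>s t. indicator {0..T} s * indicator {0..T} t *
      (ennreal (1 / \<bar>t - s\<bar> powr q) * (\<integral>\<^sup>+\<omega>. ennreal \<bar>u t \<omega> - u s \<omega>\<bar> \<partial>P))"
  have J_meas: "(\<lambda>x. J (f x) (g x) (h x)) \<in> borel_measurable N"
    if [measurable]: "f \<in> borel_measurable N" "g \<in> borel_measurable N" "h \<in> borel_measurable N"
    for f g h :: "'x \<Rightarrow> real" and N
  proof -
    have [measurable]: "(\<lambda>x. mean_rate (h x)) \<in> borel_measurable N"
      using measurable_compose[OF that(3) mean_rate_measurable] by simp
    show ?thesis unfolding J_def k_def by measurable
  qed
  have B_meas: "(\<lambda>x. B (f x) (g x)) \<in> borel_measurable N"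
    if [measurable]: "f \<in> borel_measurable N" "g \<in> borel_measurable N"
    for f g :: "'x \<Rightarrow> real" and N
  proof -
    have "(\<lambda>(x, r). J (f x) (g x) r) \<in> borel_measurable (N \<Otimes>\<^sub>M lborel)"
      unfolding case_prod_beta by (rule J_meas) measurable
    then show ?thesis
      unfolding B_def by (rule sigma_finite_measure.borel_measurable_nn_integral[OF sigma_finite_lborel])
  qed
  have B_eq: "B s t = k s t * (\<integral>\<^sup>+\<omega>. ennreal (u t \<omega> - u s \<omega>) \<partial>P)" if "0 \<le> s" "s \<le> t" "t \<le> T" for s t
  proof -
    have "B s t = (\<integral>\<^sup>+r. k s t * (mean_rate r * indicator {s..t} r) \<partial>lborel)"
      unfolding B_def J_def using that by (intro nn_integral_cong) (auto simp: indicator_def mult.commute)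
    also have "\<dots> = k s t * (\<integral>\<^sup>+r. mean_rate r * indicator {s..t} r \<partial>lborel)"
      by (rule nn_integral_cmult) measurable
    finally show ?thesis using nn_integral_mean_rate[OF that] by simp
  qed
  \<comment> \<open>On the diagonal the kernel is \<open>1 / 0 = 0\<close>.\<close>
  have B_0: "B s t = 0" if "\<not> (0 \<le> s \<and> s < t \<and> t \<le> T)" for s t
  proof (cases "s = t")
    case True
    then have "J s t r = 0" for r by (simp add: J_def k_def)
    then show ?thesis by (simp add: B_def)
  next
    case False
    then have "J s t r = 0" for r using that by (auto simp: J_def)
    then show ?thesis by (simp add: B_def)
  qed
  have D_ge: "B s t + B t s \<le> ?D s t" for s t
  proof -
    consider "0 \<le> s \<and> s < t \<and> t \<le> T" | "0 \<le> t \<and> t < s \<and> s \<le> T"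
      | "\<not> (0 \<le> s \<and> s < t \<and> t \<le> T)" "\<not> (0 \<le> t \<and> t < s \<and> s \<le> T)" by blast
    then show ?thesis
    proof cases
      case 1
      then have "(\<integral>\<^sup>+\<omega>. ennreal \<bar>u t \<omega> - u s \<omega>\<bar> \<partial>P) = (\<integral>\<^sup>+\<omega>. ennreal (u t \<omega> - u s \<omega>) \<partial>P)"
        using u_le[of _ s t] by (intro nn_integral_cong) (simp add: space_Q)
      then show ?thesis using 1 by (simp add: B_0[of t s] B_eq k_def)
    next
      case 2
      then have "(\<integral>\<^sup>+\<omega>. ennreal \<bar>u t \<omega> - u s \<omega>\<bar> \<partial>P) = (\<integral>\<^sup>+\<omega>. ennreal (u s \<omega> - u t \<omega>) \<partial>P)"
        using u_le[of _ t s] by (intro nn_integral_cong) (simp add: space_Q)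
      then show ?thesis using 2 by (simp add: B_0[of s t] B_eq k_def)
    next
      case 3
      then show ?thesis by (simp add: B_0)
    qed
  qed
  have swap_B: "(\<integral>\<^sup>+s. (\<integral>\<^sup>+t. B t s \<partial>lborel) \<partial>lborel) = (\<integral>\<^sup>+s. (\<integral>\<^sup>+t. B s t \<partial>lborel) \<partial>lborel)"
    by (rule lborel_pair.Fubini') (unfold case_prod_beta, rule B_meas, measurable)
  have swap_J: "(\<integral>\<^sup>+s. (\<integral>\<^sup>+t. B s t \<partial>lborel) \<partial>lborel) = (\<integral>\<^sup>+r. (\<integral>\<^sup>+t. (\<integral>\<^sup>+s. J s t r \<partial>lborel) \<partial>lborel) \<partial>lborel)"
  proof -
    have "(\<integral>\<^sup>+s. (\<integral>\<^sup>+t. B s t \<partial>lborel) \<partial>lborel) = (\<integral>\<^sup>+s. (\<integral>\<^sup>+r. (\<integral>\<^sup>+t. J s t r \<partial>lborel) \<partial>lborel) \<partial>lborel)"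
      unfolding B_def
      by (intro nn_integral_cong lborel_pair.Fubini') (unfold case_prod_beta, rule J_meas, measurable)
    also have "\<dots> = (\<integral>\<^sup>+r. (\<integral>\<^sup>+s. (\<integral>\<^sup>+t. J s t r \<partial>lborel) \<partial>lborel) \<partial>lborel)"
    proof (rule lborel_pair.Fubini')
      have "(\<lambda>(p, t). J (snd p) t (fst p)) \<in> borel_measurable ((lborel \<Otimes>\<^sub>M lborel) \<Otimes>\<^sub>M lborel)"
        unfolding case_prod_beta by (rule J_meas) measurable
      then show "(\<lambda>(r, s). \<integral>\<^sup>+t. J s t r \<partial>lborel) \<in> borel_measurable (lborel \<Otimes>\<^sub>M lborel)"
        unfolding case_prod_beta
        by (rule sigma_finite_measure.borel_measurable_nn_integral[OF sigma_finite_lborel, unfolded case_prod_beta])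
    qed
    also have "\<dots> = (\<integral>\<^sup>+r. (\<integral>\<^sup>+t. (\<integral>\<^sup>+s. J s t r \<partial>lborel) \<partial>lborel) \<partial>lborel)"
      by (intro nn_integral_cong lborel_pair.Fubini') (unfold case_prod_beta, rule J_meas, measurable)
    finally show ?thesis .
  qed
  have J_eq: "(\<integral>\<^sup>+t. (\<integral>\<^sup>+s. J s t r \<partial>lborel) \<partial>lborel) =
      mean_rate r * (\<integral>\<^sup>+t\<in>{r..T}. (\<integral>\<^sup>+s\<in>{0..r}. k s t \<partial>lborel) \<partial>lborel) * indicator {0..T} r" for r
  proof (cases "r \<in> {0..T}")
    case True
    have k_meas: "(\<lambda>(t, s). k s t * indicator {0..r} s) \<in> borel_measurable (lborel \<Otimes>\<^sub>M lborel)"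
      unfolding k_def case_prod_beta by measurable
    have inner: "(\<lambda>t. \<integral>\<^sup>+s\<in>{0..r}. k s t \<partial>lborel) \<in> borel_measurable lborel"
      using k_meas by (rule sigma_finite_measure.borel_measurable_nn_integral[OF sigma_finite_lborel])
    have "(\<integral>\<^sup>+s. J s t r \<partial>lborel) = mean_rate r * ((\<integral>\<^sup>+s\<in>{0..r}. k s t \<partial>lborel) * indicator {r..T} t)" for t
    proof -
      have "(\<integral>\<^sup>+s. J s t r \<partial>lborel) = (\<integral>\<^sup>+s. (mean_rate r * indicator {r..T} t) * (k s t * indicator {0..r} s) \<partial>lborel)"
        by (intro nn_integral_cong) (auto simp: J_def indicator_def)
      also have "\<dots> = (mean_rate r * indicator {r..T} t) * (\<integral>\<^sup>+s. k s t * indicator {0..r} s \<partial>lborel)"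
        by (rule nn_integral_cmult) (simp add: k_def)
      finally show ?thesis by (simp add: ac_simps)
    qed
    then have "(\<integral>\<^sup>+t. (\<integral>\<^sup>+s. J s t r \<partial>lborel) \<partial>lborel) =
        mean_rate r * (\<integral>\<^sup>+t\<in>{r..T}. (\<integral>\<^sup>+s\<in>{0..r}. k s t \<partial>lborel) \<partial>lborel)"
      using inner by (simp add: nn_integral_cmult)
    then show ?thesis using True by simp
  next
    case False
    then have "J s t r = 0" for s t by (auto simp: J_def)
    then show ?thesis using False by simp
  qed
  have "2 * (\<integral>\<^sup>+r\<in>{0..T}. mean_rate r *
      (\<integral>\<^sup>+t\<in>{r..T}. (\<integral>\<^sup>+s\<in>{0..r}. k s t \<partial>lborel) \<partial>lborel) \<partial>lborel) =
      (\<integral>\<^sup>+s. (\<integral>\<^sup>+t. B s t \<partial>lborel) \<partial>lborel) + (\<integral>\<^sup>+s. (\<integral>\<^sup>+t. B t s \<partial>lborel) \<partial>lborel)"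
    unfolding swap_B unfolding swap_J J_eq by (simp add: mult_2)
  also have "\<dots> = (\<integral>\<^sup>+s. (\<integral>\<^sup>+t. B s t + B t s \<partial>lborel) \<partial>lborel)"
  proof -
    have i: "(\<lambda>s. \<integral>\<^sup>+t. B s t \<partial>lborel) \<in> borel_measurable lborel" "(\<lambda>s. \<integral>\<^sup>+t. B t s \<partial>lborel) \<in> borel_measurable lborel"
    proof -
      have B1: "(\<lambda>(s, t). B s t) \<in> borel_measurable (lborel \<Otimes>\<^sub>M lborel)"
        and B2: "(\<lambda>(s, t). B t s) \<in> borel_measurable (lborel \<Otimes>\<^sub>M lborel)"
        unfolding case_prod_beta by (rule B_meas; measurable)+
      show "(\<lambda>s. \<integral>\<^sup>+t. B s t \<partial>lborel) \<in> borel_measurable lborel"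
        by (rule sigma_finite_measure.borel_measurable_nn_integral[OF sigma_finite_lborel B1])
      show "(\<lambda>s. \<integral>\<^sup>+t. B t s \<partial>lborel) \<in> borel_measurable lborel"
        by (rule sigma_finite_measure.borel_measurable_nn_integral[OF sigma_finite_lborel B2])
    qed
    have "(\<integral>\<^sup>+t. B s t + B t s \<partial>lborel) = (\<integral>\<^sup>+t. B s t \<partial>lborel) + (\<integral>\<^sup>+t. B t s \<partial>lborel)" for s
      by (rule nn_integral_add) (rule B_meas; measurable)+
    then show ?thesis using i by (simp add: nn_integral_add)
  qed
  also have "\<dots> \<le> (\<integral>\<^sup>+s. (\<integral>\<^sup>+t. ?D s t \<partial>lborel) \<partial>lborel)"
    by (intro nn_integral_mono D_ge)
  finally show ?thesis by (simp add: k_def)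
qed

lemma mean_rate_eq: "r \<in> {0..T} \<Longrightarrow> mean_rate r = (\<integral>\<^sup>+\<omega>. ennreal (v r \<omega>) \<partial>P)"
  by (simp add: mean_rate_def)

lemma risk_W_lower_bound:
  "2 * (\<integral>\<^sup>+r\<in>{0..T}. (\<integral>\<^sup>+\<omega>. ennreal (v r \<omega>) \<partial>P) *
      (\<integral>\<^sup>+t\<in>{r..T}. (\<integral>\<^sup>+s\<in>{0..r}. ennreal (1 / (t - s) powr (2 * \<alpha> + 1)) \<partial>lborel) \<partial>lborel) \<partial>lborel)
   \<le> (\<integral>\<^sup>+\<omega>. W_norm_sq T \<alpha> (\<lambda>t. \<xi> t \<omega> - u t \<omega>) \<partial>P)"
proof -
  have "(\<integral>\<^sup>+r\<in>{0..T}. (\<integral>\<^sup>+\<omega>. ennreal (v r \<omega>) \<partial>P) *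
      (\<integral>\<^sup>+t\<in>{r..T}. (\<integral>\<^sup>+s\<in>{0..r}. ennreal (1 / (t - s) powr (2 * \<alpha> + 1)) \<partial>lborel) \<partial>lborel) \<partial>lborel) =
    (\<integral>\<^sup>+r\<in>{0..T}. mean_rate r *
      (\<integral>\<^sup>+t\<in>{r..T}. (\<integral>\<^sup>+s\<in>{0..r}. ennreal (1 / (t - s) powr (2 * \<alpha> + 1)) \<partial>lborel) \<partial>lborel) \<partial>lborel)"
    by (intro nn_integral_cong) (auto simp: mean_rate_eq indicator_def)
  then show ?thesis using order_trans[OF kernel_integral_le_increments risk_W_ge_increments, of \<alpha>] by simp
qed

lemma risk_W_infinite:
  assumes \<alpha>: "1 / 2 \<le> \<alpha>"
  shows "(\<integral>\<^sup>+\<omega>. W_norm_sq T \<alpha> (\<lambda>t. \<xi> t \<omega> - u t \<omega>) \<partial>P) = \<infinity>"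
proof -
  let ?k = "\<lambda>r. \<integral>\<^sup>+t\<in>{r..T}. (\<integral>\<^sup>+s\<in>{0..r}. ennreal (1 / (t - s) powr (2 * \<alpha> + 1)) \<partial>lborel) \<partial>lborel"
  have "(\<integral>\<^sup>+r\<in>{0..T}. mean_rate r \<partial>lborel) = (\<integral>\<^sup>+\<omega>. ennreal (u T \<omega>) \<partial>P)"
    using T_pos u_0 by (subst nn_integral_mean_rate) (auto simp: space_Q intro!: nn_integral_cong)
  then have pos: "(\<integral>\<^sup>+r\<in>{0..T}. mean_rate r \<partial>lborel) \<noteq> 0" using mean_total_pos by simp
  have twice: "x \<le> 2 * x" for x :: ennreal by (simp add: mult_2)
  have "\<infinity> = \<infinity> * (\<integral>\<^sup>+r\<in>{0..T}. mean_rate r \<partial>lborel)"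
    using pos by (simp add: ennreal_top_mult)
  also have "\<dots> = (\<integral>\<^sup>+r. \<infinity> * (mean_rate r * indicator {0..T} r) \<partial>lborel)"
    by (rule nn_integral_cmult[symmetric]) simp
  also have "\<dots> = (\<integral>\<^sup>+r\<in>{0..T}. (\<integral>\<^sup>+\<omega>. ennreal (v r \<omega>) \<partial>P) * ?k r \<partial>lborel)"
  proof (rule nn_integral_cong_AE)
    have "AE r in lborel. r \<noteq> 0" "AE r in lborel. r \<noteq> T" by (rule AE_lborel_singleton)+
    then show "AE r in lborel. \<infinity> * (mean_rate r * indicator {0..T} r) =
        (\<integral>\<^sup>+\<omega>. ennreal (v r \<omega>) \<partial>P) * ?k r * indicator {0..T} r"
    proof eventually_elim
      fix r assume r: "r \<noteq> 0" "r \<noteq> T"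
      show "\<infinity> * (mean_rate r * indicator {0..T} r) = (\<integral>\<^sup>+\<omega>. ennreal (v r \<omega>) \<partial>P) * ?k r * indicator {0..T} r"
      proof (cases "r \<in> {0..T}")
        case True
        then have "?k r = \<infinity>" using \<alpha> r by (intro fractional_kernel_infinite) auto
        then show ?thesis using True by (simp add: mean_rate_eq mult.commute)
      qed simp
    qed
  qed
  also have "\<dots> \<le> 2 * \<dots>" by (rule twice)
  also have "\<dots> \<le> (\<integral>\<^sup>+\<omega>. W_norm_sq T \<alpha> (\<lambda>t. \<xi> t \<omega> - u t \<omega>) \<partial>P)" by (rule risk_W_lower_bound)
  finally show ?thesis by (simp add: top_unique)
qed

text \<open>
  The risk is bounded below by \<open>n / T\<close> times the mean of \<open>u\<^sub>T\<close> for every \<open>n\<close>.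
\<close>

lemma risk_H1_infinite:
  "(\<integral>\<^sup>+\<omega>. H1_norm_sq T (\<lambda>t. \<xi> t \<omega> - u t \<omega>) \<partial>P) = \<infinity>"
proof -
  let ?m = "\<integral>\<^sup>+\<omega>. ennreal (u T \<omega>) \<partial>P" and ?R = "\<integral>\<^sup>+\<omega>. H1_norm_sq T (\<lambda>t. \<xi> t \<omega> - u t \<omega>) \<partial>P"
  have bound: "ennreal (real n / T) * ?m \<le> ?R" if n: "0 < n" for n
  proof -
    define \<tau> where "\<tau> i = real i * T / real n" for i
    define d where "d i \<omega> = (\<xi> (\<tau> (Suc i)) \<omega> - u (\<tau> (Suc i)) \<omega>) - (\<xi> (\<tau> i) \<omega> - u (\<tau> i) \<omega>)" for i \<omega>
    have \<tau>: "0 \<le> \<tau> i" "\<tau> i \<le> \<tau> (Suc i)" "i < n \<Longrightarrow> \<tau> (Suc i) \<le> T" for i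
      using T_pos n by (auto simp: \<tau>_def divide_simps mult_mono)
    have \<tau>n: "\<tau> n = T" "\<tau> 0 = 0" using n by (auto simp: \<tau>_def)
    have [measurable]: "(\<lambda>\<omega>. \<xi> r \<omega>) \<in> borel_measurable P" "(\<lambda>\<omega>. u r \<omega>) \<in> borel_measurable P" if "r \<in> {0..T}" for r
      using unbiasedD(1)[OF uv that] measurable_F_M[OF u_measurable[OF that]] T_pos
      by (auto simp: measurable_Q)
    have d_meas: "d i \<in> borel_measurable P" if "i < n" for i
      unfolding d_def using \<tau>[of i] that by (intro borel_measurable_diff) auto
    have "?m = (\<integral>\<^sup>+\<omega>. (\<Sum>i<n. ennreal (u (\<tau> (Suc i)) \<omega> - u (\<tau> i) \<omega>)) \<partial>P)"
    proof (intro nn_integral_cong)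
      fix \<omega> assume "\<omega> \<in> space P"
      then have \<omega>: "\<omega> \<in> space M" by (simp add: space_Q)
      have "(\<Sum>i<n. ennreal (u (\<tau> (Suc i)) \<omega> - u (\<tau> i) \<omega>)) = ennreal (\<Sum>i<n. u (\<tau> (Suc i)) \<omega> - u (\<tau> i) \<omega>)"
        using u_le[OF \<omega> \<tau>] by (intro sum_ennreal) auto
      also have "(\<Sum>i<n. u (\<tau> (Suc i)) \<omega> - u (\<tau> i) \<omega>) = u T \<omega>"
        using sum_lessThan_telescope[of "\<lambda>i. u (\<tau> i) \<omega>" n] by (simp add: \<tau>n u_0 \<omega>)
      finally show "ennreal (u T \<omega>) = (\<Sum>i<n. ennreal (u (\<tau> (Suc i)) \<omega> - u (\<tau> i) \<omega>))" ..
    qed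
    also have "\<dots> = (\<Sum>i<n. \<integral>\<^sup>+\<omega>. ennreal (u (\<tau> (Suc i)) \<omega> - u (\<tau> i) \<omega>) \<partial>P)"
    proof (rule nn_integral_sum)
      fix i assume "i \<in> {..<n}"
      then have "\<tau> i \<in> {0..T}" "\<tau> (Suc i) \<in> {0..T}" using \<tau>[of i] \<tau>(1)[of "Suc i"] by auto
      then show "(\<lambda>\<omega>. ennreal (u (\<tau> (Suc i)) \<omega> - u (\<tau> i) \<omega>)) \<in> borel_measurable P" by measurable
    qed
    also have "\<dots> \<le> (\<Sum>i<n. \<integral>\<^sup>+\<omega>. ennreal ((d i \<omega>)\<^sup>2) \<partial>P)"
      unfolding d_def using \<tau> by (intro sum_mono increment_bound) auto
    also have "\<dots> = (\<integral>\<^sup>+\<omega>. (\<Sum>i<n. ennreal ((d i \<omega>)\<^sup>2)) \<partial>P)"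
      using d_meas by (intro nn_integral_sum[symmetric]) auto
    finally have "ennreal (real n / T) * ?m \<le> ennreal (real n / T) * (\<integral>\<^sup>+\<omega>. (\<Sum>i<n. ennreal ((d i \<omega>)\<^sup>2)) \<partial>P)"
      by (intro mult_left_mono) auto
    also have "\<dots> = (\<integral>\<^sup>+\<omega>. ennreal (real n / T) * (\<Sum>i<n. ennreal ((d i \<omega>)\<^sup>2)) \<partial>P)"
      using d_meas by (intro nn_integral_cmult[symmetric]) (auto intro!: borel_measurable_sum)
    also have "\<dots> \<le> ?R"
      unfolding d_def \<tau>_def by (intro nn_integral_mono H1_norm_sq_ge_increments T_pos n)
    finally show ?thesis .
  qed
  show ?thesis
  proof (rule ccontr)
    assume "?R \<noteq> \<infinity>"
    then obtain x where x: "0 \<le> x" "?R = ennreal x" by (cases ?R) auto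
    have "ennreal (1 / T) * ?m \<le> ennreal x" using bound[of 1] by (simp add: x)
    then have "?m \<noteq> \<infinity>" using T_pos by (auto simp: ennreal_mult_top top_unique)
    then obtain m where m: "0 \<le> m" "?m = ennreal m" by (cases ?m) auto
    then have "0 < m" using mean_total_pos by simp
    obtain n where "x * T / m < real n" using reals_Archimedean2 by blast
    then have n: "x < real (Suc n) / T * m" using \<open>0 < m\<close> T_pos by (simp add: field_simps)
    have "ennreal (real (Suc n) / T * m) = ennreal (real (Suc n) / T) * ennreal m"
      using m(1) T_pos by (intro ennreal_mult) auto
    also have "\<dots> \<le> ennreal x"
      using bound[of "Suc n"] by (simp only: m(2) x(2))
    finally show False using n x by (simp add: ennreal_le_iff)
  qed
qed

end

theorem theorem3p3:
  fixes M :: "'a measure" and T :: real and F :: "real \<Rightarrow> 'a measure"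
    and X :: "real \<Rightarrow> 'a \<Rightarrow> nat" and \<xi> :: "real \<Rightarrow> 'a \<Rightarrow> real"
  assumes "0 < T"
    and "filtered_prob_space M T F"
    and "poisson_process M T F X"
    and "estimator M T \<xi>"
    and "unbiased M T F X \<xi>"
  shows "(\<forall>\<alpha>::real. 0 < \<alpha> \<and> \<alpha> < 1 \<longrightarrow>
            (\<forall>(u, v)\<in>Theta M T F X.
               (\<integral>\<^sup>+\<omega>. W_norm_sq T \<alpha> (\<lambda>t. \<xi> t \<omega> - u t \<omega>) \<partial>girsanov_measure M T X v)
               \<ge> 2 * (\<integral>\<^sup>+r\<in>{0..T}.
                    (\<integral>\<^sup>+\<omega>. ennreal (v r \<omega>) \<partial>girsanov_measure M T X v) *
                    (\<integral>\<^sup>+t\<in>{r..T}. (\<integral>\<^sup>+s\<in>{0..r}.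
                       ennreal (1 / (t - s) powr (2 * \<alpha> + 1)) \<partial>lborel) \<partial>lborel) \<partial>lborel)))
       \<and> (\<forall>\<alpha>::real. 1 / 2 \<le> \<alpha> \<and> \<alpha> < 1 \<longrightarrow>
            (\<forall>(u, v)\<in>Theta M T F X.
               (\<integral>\<^sup>+\<omega>. W_norm_sq T \<alpha> (\<lambda>t. \<xi> t \<omega> - u t \<omega>) \<partial>girsanov_measure M T X v) = \<infinity>))
       \<and> (\<forall>(u, v)\<in>Theta M T F X.
            (\<integral>\<^sup>+\<omega>. H1_norm_sq T (\<lambda>t. \<xi> t \<omega> - u t \<omega>) \<partial>girsanov_measure M T X v) = \<infinity>)"
proof -
  have model: "unbiased_model M T F X u v \<xi>" if "(u, v) \<in> Theta M T F X" for u v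
    using assms that
    by (simp add: unbiased_model_def unbiased_model_axioms_def girsanov_model_def girsanov_model_axioms_def
        poisson_model_def)
  show ?thesis
    using unbiased_model.risk_W_lower_bound[OF model] unbiased_model.risk_W_infinite[OF model]
      unbiased_model.risk_H1_infinite[OF model]
    by (intro conjI allI impI ballI) auto
qed

end
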